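(* Let $n\ge 1$, let $\mathbb{M}_n$ be the space of real $n\times n$ matrices, and suppose that (a) $A\in L^\infty(\mathbb{R};\mathbb{M}_n)$ is $1$-periodic; (b) $\operatorname{ess\,inf}\{A(y)u\cdot u:\ y\in\mathbb{R},\ u\in\mathbb{R}^n,\ \|u\|=1\}>0$ (i.e. there is $a>0$ with $A(y)u\cdot u\ge a\|u\|^2$ for almost all $y\in\mathbb{R}$ and all $u\in\mathbb{R}^n$); (c) $c,d:(0,1)\times\mathbb{R}^n\to\mathbb{R}^n$ are such that the map $u\in\mathbb{R}^n\mapsto (c(\cdot,u),d(\cdot,u))\in L^\infty((0,1);\mathbb{R}^n)^2$ is $C^1$-smooth. Put $A_0:=\left(\int_0^1A(y)^{-1}dy\right)^{-1}$. Let $u_0$ be a weak solution to the homogenized problem $$\big(A_0u'(x)+c(x,u(x))\big)'=d(x,u(x))\ \text{ for } x\in(0,1),\qquad u(0)=u(1)=0,$$ such that the linearized problem $$\big(A_0u'(x)+\partial_uc(x,u_0(x))u(x)\big)'=\partial_ud(x,u_0(x))u(x)\ \text{ for } x\in(0,1),\qquad u(0)=u(1)=0$$ does not have weak solutions $u\neq 0$. Then for any $r>1$ there exist $\varepsilon_r>0$ and $\delta_r>0$ such that the following is true: (i) For all $\varepsilon\in(0,\varepsilon_r]$ and all $B\in\mathcal{M}_r$ there exists exactly one weak solution $u=u_{\varepsilon,B}$ to $$\Big(\big(A(x/\varepsilon)+B(x/\varepsilon)\big)u'(x)+c(x,u(x))\Big)'=d(x,u(x))\ \text{ for } x\in(0,1),\qquad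 u(0)=u(1)=0$$ with $\|u-u_0\|_\infty\le\delta_r$. Moreover, $\|u_{\varepsilon,B}-u_0\|_\infty\to0$ for $\varepsilon\to0$ uniformly with respect to $B\in\mathcal{M}_r$. (ii) If $c(\cdot,u_0(\cdot))\in W^{1,\infty}((0,1);\mathbb{R}^n)$, then $\|u_{\varepsilon,B}-u_0\|_\infty=O(\varepsilon)$ for $\varepsilon\to0$ uniformly with respect to $B\in\mathcal{M}_r$.
   Context: $u\cdot v$ is the Euclidean scalar product in $\mathbb{R}^n$, $\|u\|$ the Euclidean norm, and $\|M\|:=\max\{\|Mu\|:u\in\mathbb{R}^n,\|u\|\le1\}$ for $M\in\mathbb{M}_n$. For functions on $(0,1)$, $\|u\|_\infty$ is the $L^\infty((0,1);\mathbb{R}^n)$ norm. For $M:\mathbb{R}\to\mathbb{M}_n$, $\|M\|_\infty:=\operatorname{ess\,sup}_{x\in\mathbb{R}}\|M(x)\|$ and $\|M\|_1:=\int_{-\infty}^\infty\|M(x)\|dx$. For $r>1$, $$\mathcal{B}_r:=\{B\in L^\infty(\mathbb{R};\mathbb{M}_n)\cap L^1(\mathbb{R};\mathbb{M}_n):\ \|B\|_\infty+\|B\|_1\le r\},$$ $$\mathcal{M}_r:=\Big\{B\in\mathcal{B}_r:\ (A(y)+B(y))u\cdot u\ge\frac{\|u\|^2}{r}\text{ for almost all }y\in\mathbb{R}\text{ and all }u\in\mathbb{R}^n\Big\}.$$ $\partial_uc(x,u)$ and $\partial_ud(x,u)$ are the Jacobi matrices of $c(x,\cdot)$ and $d(x,\cdot)$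 at $u$. Under (a), (b) the matrices $A(y)$ and $\int_0^1A(y)^{-1}dy$ are invertible, so $A_0$ is well defined. A function $u\in W^{1,2}_0((0,1);\mathbb{R}^n)$ is a weak solution to the problem with $A(x/\varepsilon)+B(x/\varepsilon)$ if for all $\varphi\in W_0^{1,2}((0,1);\mathbb{R}^n)$ $$\int_0^1\Big(\big((A(x/\varepsilon)+B(x/\varepsilon))u'(x)+c(x,u(x))\big)\cdot\varphi'(x)+d(x,u(x))\cdot\varphi(x)\Big)dx=0,$$ and similarly for the homogenized problem (with $A_0$ in place of $A(x/\varepsilon)+B(x/\varepsilon)$) and for its linearization (with moreover $\partial_uc(x,u_0(x))u(x)$, $\partial_ud(x,u_0(x))u(x)$ in place of $c(x,u(x))$, $d(x,u(x))$). *)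

theory Defs
  imports "HOL-Analysis.Analysis" "HOL-Probability.Essential_Supremum"
begin

text \<open>
  Elements of \<open>L\<^sup>p\<close> and Sobolev spaces are represented by functions rather than by equivalence
  classes; equality in these spaces is equality almost everywhere.  Functions on \<open>(0,1)\<close> are total
  functions of which only the restriction to \<open>(0,1)\<close> matters.
\<close>

abbreviation I01 :: "real measure"
  where "I01 \<equiv> lebesgue_on {0<..<1}"

section \<open>Lebesgue spaces\<close>

text \<open>The norms are extended-valued.  On matrices the pointwise norm is the operator norm
  \<open>onorm\<close>, not the Frobenius norm that \<open>norm\<close> denotes on the type \<open>real^'n^'n\<close>.\<close>

definition Linf_norm :: "real measure \<Rightarrow> (real \<Rightarrow> 'a::euclidean_space) \<Rightarrow> ennreal"
  where "Linf_norm \<mu> u = esssup \<mu> (\<lambda>x. ennreal (norm (u x)))"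

definition Linf_norm_mat :: "real measure \<Rightarrow> (real \<Rightarrow> real^'n^'n) \<Rightarrow> ennreal"
  where "Linf_norm_mat \<mu> M = esssup \<mu> (\<lambda>x. ennreal (onorm ((*v) (M x))))"

definition L1_norm_mat :: "real measure \<Rightarrow> (real \<Rightarrow> real^'n^'n) \<Rightarrow> ennreal"
  where "L1_norm_mat \<mu> M = (\<integral>\<^sup>+ x. ennreal (onorm ((*v) (M x))) \<partial>\<mu>)"

definition Linf :: "real measure \<Rightarrow> (real \<Rightarrow> 'a::euclidean_space) set"
  where "Linf \<mu> = {u \<in> borel_measurable \<mu>. Linf_norm \<mu> u < \<infinity>}"

definition Linf_mat :: "real measure \<Rightarrow> (real \<Rightarrow> real^'n^'n) set"
  where "Linf_mat \<mu> = {M \<in> borel_measurable \<mu>. Linf_norm_mat \<mu> M < \<infinity>}"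

definition L1_mat :: "real measure \<Rightarrow> (real \<Rightarrow> real^'n^'n) set"
  where "L1_mat \<mu> = {M \<in> borel_measurable \<mu>. L1_norm_mat \<mu> M < \<infinity>}"

definition L2 :: "real measure \<Rightarrow> (real \<Rightarrow> 'a::euclidean_space) set"
  where "L2 \<mu> = {u \<in> borel_measurable \<mu>. integrable \<mu> (\<lambda>x. (norm (u x))\<^sup>2)}"

section \<open>Weak derivatives and Sobolev spaces on \<open>(0,1)\<close>\<close>

text \<open>\<open>C\<^sub>c\<^sup>\<infinity>((0,1))\<close>, functions being extended by \<open>0\<close> to the real line\<close>

definition test_functions :: "(real \<Rightarrow> 'a::euclidean_space) set"
  where "test_functions = {\<phi>.
    (\<forall>k x. ((\<lambda>f y. vector_derivative f (at y)) ^^ k) \<phi> differentiable (at x)) \<and>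
    (\<exists>K. compact K \<and> K \<subseteq> {0<..<1} \<and> (\<forall>x. x \<notin> K \<longrightarrow> \<phi> x = 0))}"

definition locally_integrable :: "(real \<Rightarrow> 'a::euclidean_space) \<Rightarrow> bool"
  where "locally_integrable u \<longleftrightarrow>
    (\<forall>K. compact K \<and> K \<subseteq> {0<..<1} \<longrightarrow> u absolutely_integrable_on K)"

definition has_weak_derivative ::
    "(real \<Rightarrow> 'a::euclidean_space) \<Rightarrow> (real \<Rightarrow> 'a) \<Rightarrow> bool"
  where "has_weak_derivative u w \<longleftrightarrow> locally_integrable u \<and> locally_integrable w \<and>
    (\<forall>\<phi> :: real \<Rightarrow> real. \<phi> \<in> test_functions \<longrightarrow>
      (\<integral>x. vector_derivative \<phi> (at x) *\<^sub>R u x \<partial>I01) = - (\<integral>x. \<phi> x *\<^sub>R w x \<partial>I01))"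

text \<open>A weak derivative is determined only almost everywhere; this is some representative.\<close>

definition weak_derivative :: "(real \<Rightarrow> 'a::euclidean_space) \<Rightarrow> real \<Rightarrow> 'a"
  where "weak_derivative u = (SOME w. has_weak_derivative u w)"

definition W12 :: "(real \<Rightarrow> 'a::euclidean_space) set"
  where "W12 = {u \<in> L2 I01. \<exists>w \<in> L2 I01. has_weak_derivative u w}"

definition W12_norm :: "(real \<Rightarrow> 'a::euclidean_space) \<Rightarrow> real"
  where "W12_norm u =
    sqrt ((\<integral>x. (norm (u x))\<^sup>2 \<partial>I01) + (\<integral>x. (norm (weak_derivative u x))\<^sup>2 \<partial>I01))"

text \<open>\<open>W\<^sub>0\<^sup>1\<^sup>,\<^sup>2\<close> is the closure of the test functions in \<open>W\<^sup>1\<^sup>,\<^sup>2\<close>.\<close>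

definition W12_0 :: "(real \<Rightarrow> 'a::euclidean_space) set"
  where "W12_0 = {u \<in> W12. \<forall>e>0. \<exists>\<phi> \<in> test_functions. W12_norm (\<lambda>x. u x - \<phi> x) < e}"

definition W1inf :: "(real \<Rightarrow> 'a::euclidean_space) set"
  where "W1inf = {u \<in> Linf I01. \<exists>w \<in> Linf I01. has_weak_derivative u w}"

section \<open>The nonlinearities\<close>

text \<open>
  \<open>u \<mapsto> f(\<cdot>,u)\<close> is a \<open>C\<^sup>1\<close> map from \<open>\<real>\<^sup>n\<close> to \<open>L\<^sup>\<infinity>((0,1);\<real>\<^sup>n)\<close> in the sense of Frechet.  Its derivative
  at \<open>u\<close>, a linear map from \<open>\<real>\<^sup>n\<close> to \<open>L\<^sup>\<infinity>((0,1);\<real>\<^sup>n)\<close>, is written as \<open>h \<mapsto> J u (\<cdot>) h\<close> with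
  \<open>J u \<in> L\<^sup>\<infinity>((0,1);\<bbbM>\<^sub>n)\<close>, the columns of \<open>J u\<close> being the images of the unit vectors.
\<close>

definition C1_into_Linf :: "(real \<Rightarrow> real^'n \<Rightarrow> real^'n) \<Rightarrow> bool"
  where "C1_into_Linf f \<longleftrightarrow> (\<forall>u. (\<lambda>x. f x u) \<in> Linf I01) \<and>
    (\<exists>J :: real^'n \<Rightarrow> real \<Rightarrow> real^'n^'n.
      (\<forall>u. J u \<in> Linf_mat I01) \<and>
      (\<forall>u. ((\<lambda>h. Linf_norm I01 (\<lambda>x. f x (u + h) - f x u - J u x *v h) / ennreal (norm h))
              \<longlongrightarrow> 0) (at 0)) \<and>
      (\<forall>u. ((\<lambda>v. Linf_norm_mat I01 (\<lambda>x. J v x - J u x)) \<longlongrightarrow> 0) (at u)))"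

text \<open>
  \<open>C1_into_Linf\<close> sees each \<open>f(\<cdot>,u)\<close> only up to a null set depending on \<open>u\<close>.  For \<open>x \<mapsto> f(x,u(x))\<close>
  and for the Jacobi matrices of \<open>f(x,\<cdot>)\<close> to be meaningful, the representative has to be
  continuous in \<open>u\<close> for almost every \<open>x\<close> (differentiability in \<open>u\<close> is then a consequence).
\<close>

definition continuous_representative :: "(real \<Rightarrow> real^'n \<Rightarrow> real^'n) \<Rightarrow> bool"
  where "continuous_representative f \<longleftrightarrow> (AE x in I01. continuous_on UNIV (f x))"

section \<open>The boundary value problems\<close>

text \<open>
  Weak solutions of \<open>(M u' + f(x,u))' = g(x,u)\<close>, \<open>u(0) = u(1) = 0\<close>.  The integral is stated with
  \<open>has_bochner_integral\<close>, since the integral of a non-integrable function is \<open>0\<close> by convention.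
\<close>

definition weak_solution ::
    "(real \<Rightarrow> real^'n^'n) \<Rightarrow> (real \<Rightarrow> real^'n \<Rightarrow> real^'n) \<Rightarrow> (real \<Rightarrow> real^'n \<Rightarrow> real^'n) \<Rightarrow>
     (real \<Rightarrow> real^'n) \<Rightarrow> bool"
  where "weak_solution M f g u \<longleftrightarrow> u \<in> W12_0 \<and>
    (\<forall>\<phi> \<in> W12_0. has_bochner_integral I01
      (\<lambda>x. (M x *v weak_derivative u x + f x (u x)) \<bullet> weak_derivative \<phi> x + g x (u x) \<bullet> \<phi> x) 0)"

definition homogenized_matrix :: "(real \<Rightarrow> real^'n^'n) \<Rightarrow> real^'n^'n"
  where "homogenized_matrix A = matrix_inv (\<integral>y. matrix_inv (A y) \<partial>I01)"

definition \<B> :: "real \<Rightarrow> (real \<Rightarrow> real^'n^'n) set"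
  where "\<B> r = {B \<in> Linf_mat lebesgue \<inter> L1_mat lebesgue.
    Linf_norm_mat lebesgue B + L1_norm_mat lebesgue B \<le> ennreal r}"

definition \<M> :: "(real \<Rightarrow> real^'n^'n) \<Rightarrow> real \<Rightarrow> (real \<Rightarrow> real^'n^'n) set"
  where "\<M> A r = {B \<in> \<B> r.
    AE y in lebesgue. \<forall>u. ((A y + B y) *v u) \<bullet> u \<ge> (norm u)\<^sup>2 / r}"

end

theory Submission
  imports Defs
begin

text \<open>
  Integrating the equation once shows that the weak solutions are the solutions with \<open>u(1) = 0\<close> of
  the Volterra equation \<open>u(x) = \<integral>\<^sub>0\<^sup>x N (p - c(\<cdot>,u) + \<integral>\<^sub>0 d(\<cdot>,u))\<close>, where \<open>N\<close> is the inverse of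
  \<open>A(\<cdot>/\<epsilon>) + B(\<cdot>/\<epsilon>)\<close> and the vector \<open>p\<close> is the initial flux.  The primitive of \<open>N\<close> differs from
  that of \<open>A\<^sub>0\<^sup>-\<^sup>1\<close> by \<open>O(\<epsilon>)\<close>, uniformly in \<open>x\<close> and \<open>B\<close>: for \<open>B = 0\<close> by periodicity, and the
  contribution of \<open>B\<close> is bounded by a multiple of the \<open>L\<^sup>1\<close> norm of \<open>B(\<cdot>/\<epsilon>)\<close>.  Hence the primitive
  of \<open>N h\<close> is uniformly close to that of \<open>A\<^sub>0\<^sup>-\<^sup>1 h\<close> for every bounded \<open>h\<close>, and up to \<open>O(\<epsilon>)\<close> for
  Lipschitz \<open>h\<close> (integration by parts).  By the Gronwall lemma the shooting map \<open>p \<mapsto> u(1)\<close> is close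
  to the homogenized one up to the first order, whose derivative at the flux of \<open>u\<^sub>0\<close> is injective
  because \<open>u\<^sub>0\<close> is nondegenerate; so a contraction argument in \<open>\<real>\<^sup>n\<close> yields exactly one zero nearby.
\<close>

section \<open>Primitives on the unit interval\<close>

text \<open>The reduction to a finite-dimensional equation has a reason: as \<epsilon> tends to 0
  the operators h -> \<open>prim\<close> (N h) do not converge in operator norm on L^infinity,
  because h may oscillate in step with the coefficient, so an implicit function theorem in a
  function space is not directly available. They do converge for each fixed h, and after the
  reduction only n + 1 fixed functions matter: the \<open>H i\<close>, belonging to the fundamental
  solutions of the linearized homogenized problem, and \<open>h0\<close>, belonging to the limit
  solution. Nonlinear remainders are estimated by the mere boundedness of N and absorbed by a small
  neighbourhood, whose radius is therefore fixed before \<epsilon>. Initial value problems need not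
  be solvable up to x = 1, so the nonlinearities are truncated near the limit solution. A second
  obstacle is the C^1 hypothesis: its remainder estimates hold off null sets that depend on the
  arguments. A countable dense set and the continuity of the representative convert them into
  estimates for almost all x and all arguments at once.\<close>

lemma finite_measure_I01: "finite_measure I01"
  by (rule finite_measure_lebesgue_on) simp

lemma emeasure_I01: "emeasure I01 (space I01) = 1"
proof -
  have "emeasure I01 {0<..<1} = emeasure lebesgue {0<..<1::real}"
    by (rule emeasure_restrict_space) auto
  also have "\<dots> = emeasure lborel {0<..<1::real}"
    by simp
  finally show ?thesis by simp
qed

lemma measure_I01_interval [simp]: "measure I01 {0<..<1} = 1"
  using emeasure_I01 by (simp add: measure_def)

lemma measure_I01: "measure I01 (space I01) = 1"
  using emeasure_I01 by (simp add: measure_def)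

lemma measurable_id_I01 [measurable]: "(\<lambda>x. x) \<in> borel_measurable I01"
  by (metis id_borel_measurable_lebesgue_on id_def eq_id_iff)

lemma borel_measurable_I01 [measurable (raw)]: "f \<in> borel_measurable borel \<Longrightarrow> f \<in> borel_measurable I01"
  using measurable_compose[OF measurable_id_I01] by auto

lemma continuous_measurable_I01: "continuous_on UNIV f \<Longrightarrow> f \<in> borel_measurable I01"
  by (simp add: borel_measurable_continuous_onI borel_measurable_I01)

text \<open>Rests on the completeness of Lebesgue measure. It lets functions such as
  \<open>weak_derivative\<close> or an a.e. defined inverse matrix be compared with representatives
  whose measurability is known.\<close>

lemma measurable_I01_AE:
  fixes f g :: "real \<Rightarrow> 'a::euclidean_space"
  assumes f: "f \<in> borel_measurable I01" and ae: "AE x in I01. f x = g x"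
  shows "g \<in> borel_measurable I01"
proof -
  let ?S = "{0<..<1::real}"
  have 1: "(\<lambda>x. if x \<in> ?S then f x else 0) \<in> borel_measurable lebesgue"
    using f by (subst borel_measurable_if) auto
  have "AE x in lebesgue. x \<in> ?S \<longrightarrow> f x = g x"
    using ae by (subst (asm) AE_restrict_space_iff) auto
  then have "AE x in lebesgue. (if x \<in> ?S then f x else 0) = (if x \<in> ?S then g x else 0)"
    by eventually_elim auto
  from borel_measurable_AE[OF 1 this] show ?thesis
    by (subst (asm) borel_measurable_if) auto
qed

lemma integrable_const_I01 [simp]: "integrable I01 (\<lambda>_. c :: 'a::euclidean_space)"
  by (rule finite_measure.integrable_const[OF finite_measure_I01])

lemma integral_const_I01 [simp]: "(\<integral>x. c \<partial>I01) = (c :: 'a::euclidean_space)"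
  using measure_I01 by simp

lemma integrable_bounded_I01:
  fixes f :: "real \<Rightarrow> 'a::euclidean_space"
  assumes "f \<in> borel_measurable I01" "AE x in I01. norm (f x) \<le> C"
  shows "integrable I01 f"
  using assms(1) by (rule Bochner_Integration.integrable_bound[OF integrable_const_I01[of C]])
    (use assms(2) in eventually_elim, auto)

text \<open>Stated for an arbitrary bilinear product because scaling, the scalar product and the
  matrix-vector product all occur later.\<close>

lemma integrable_mult_bounded_I01:
  fixes f :: "real \<Rightarrow> 'a::euclidean_space" and g :: "real \<Rightarrow> 'b::euclidean_space"
    and p :: "'a \<Rightarrow> 'b \<Rightarrow> 'c::euclidean_space"
  assumes p: "bounded_bilinear p" and f: "f \<in> borel_measurable I01" and b: "AE x in I01. norm (f x) \<le> C"
    and g: "integrable I01 g"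
  shows "integrable I01 (\<lambda>x. p (f x) (g x))"
proof -
  obtain K where K: "0 < K" "\<And>a b. norm (p a b) \<le> norm a * norm b * K"
    using bounded_bilinear.pos_bounded[OF p] by blast
  have [measurable]: "g \<in> borel_measurable I01" using g by auto
  have cont: "continuous_on UNIV (\<lambda>z. p (fst z) (snd z))"
    by (intro bounded_bilinear.continuous_on[OF p] continuous_intros)
  have m: "(\<lambda>x. p (f x) (g x)) \<in> borel_measurable I01"
    using borel_measurable_continuous_Pair[OF f \<open>g \<in> borel_measurable I01\<close> cont] by simp
  show ?thesis
  proof (rule Bochner_Integration.integrable_bound[OF _ m])
    show "integrable I01 (\<lambda>x. (\<bar>C\<bar> * K) * norm (g x))" using g by auto
    show "AE x in I01. norm (p (f x) (g x)) \<le> norm ((\<bar>C\<bar> * K) * norm (g x))"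
      using b
    proof eventually_elim
      fix x assume "norm (f x) \<le> C"
      then have "norm (f x) * norm (g x) * K \<le> \<bar>C\<bar> * norm (g x) * K"
        using K by (intro mult_right_mono) auto
      then have "norm (p (f x) (g x)) \<le> \<bar>C\<bar> * norm (g x) * K"
        using K(2)[of "f x" "g x"] by linarith
      then show "norm (p (f x) (g x)) \<le> norm ((\<bar>C\<bar> * K) * norm (g x))"
        using K(1) by (simp add: abs_mult mult_ac)
    qed
  qed
qed

text \<open>\<open>prim w x\<close> is the integral of \<open>w\<close> over \<open>(0,x)\<close>, extended by constants outside \<open>(0,1)\<close>; thus
  pointwise statements on solutions need no restriction of \<open>x\<close>.\<close>

definition prim :: "(real \<Rightarrow> 'a::euclidean_space) \<Rightarrow> real \<Rightarrow> 'a"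
  where "prim w x = (\<integral>y. indicator {..x} y *\<^sub>R w y \<partial>I01)"

lemma integrable_prim:
  fixes w :: "real \<Rightarrow> 'a::euclidean_space"
  assumes "integrable I01 w"
  shows "integrable I01 (\<lambda>y. indicator {..x} y *\<^sub>R w y)"
proof -
  have [measurable]: "w \<in> borel_measurable I01" using assms by auto
  show ?thesis
    by (rule Bochner_Integration.integrable_bound[OF assms])
      (auto intro!: AE_I2 borel_measurable_scaleR borel_measurable_I01 simp: indicator_def)
qed

lemma prim_zero [simp]: "prim (\<lambda>_. 0) x = 0" "prim w 0 = 0"
proof -
  show "prim w 0 = 0" unfolding prim_def
    by (subst Bochner_Integration.integral_cong[OF refl, of _ _ "\<lambda>_. 0"]) auto
qed (simp add: prim_def)

lemma prim_ge_1: "x \<ge> 1 \<Longrightarrow> prim w x = (\<integral>y. w y \<partial>I01)"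
  unfolding prim_def by (rule Bochner_Integration.integral_cong) auto

lemma prim_cong_AE:
  assumes "AE x in I01. v x = w x" "v \<in> borel_measurable I01"
  shows "prim v x = prim w x"
proof -
  have [measurable]: "v \<in> borel_measurable I01" "w \<in> borel_measurable I01"
    using assms measurable_I01_AE by auto
  show ?thesis unfolding prim_def using assms(1) by (intro integral_cong_AE) auto
qed

lemma prim_add: "integrable I01 v \<Longrightarrow> integrable I01 w \<Longrightarrow> prim (\<lambda>y. v y + w y) x = prim v x + prim w x"
  unfolding prim_def by (simp add: scaleR_add_right integrable_prim)

lemma prim_diff: "integrable I01 v \<Longrightarrow> integrable I01 w \<Longrightarrow> prim (\<lambda>y. v y - w y) x = prim v x - prim w x"
  unfolding prim_def by (simp add: scaleR_diff_right integrable_prim)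

lemma prim_scaleR: fixes w :: "real \<Rightarrow> 'a::euclidean_space" shows "prim (\<lambda>y. c *\<^sub>R w y) x = c *\<^sub>R prim w x"
  unfolding prim_def by (subst integral_scaleR_right[symmetric]) (simp add: mult.commute)

lemma prim_mult: fixes w :: "real \<Rightarrow> real" shows "prim (\<lambda>y. c * w y) x = c * prim w x"
  using prim_scaleR[of c w x] by simp

lemma prim_bounded_linear:
  "bounded_linear T \<Longrightarrow> integrable I01 w \<Longrightarrow> prim (\<lambda>y. T (w y)) x = T (prim w x)"
  unfolding prim_def
  by (subst integral_bounded_linear[symmetric]) (auto simp: integrable_prim linear_simps)

lemma prim_mono:
  fixes v w :: "real \<Rightarrow> real"
  assumes "integrable I01 v" "integrable I01 w" "AE y in I01. v y \<le> w y"
  shows "prim v x \<le> prim w x"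
  unfolding prim_def using assms
  by (intro integral_mono_AE integrable_prim) (auto elim!: eventually_mono simp: indicator_def)

lemma norm_prim_le:
  assumes "integrable I01 \<phi>" "w \<in> borel_measurable I01" "AE y in I01. norm (w y) \<le> \<phi> y"
  shows "norm (prim w x) \<le> prim \<phi> x"
proof -
  have "integrable I01 w"
    using assms(3) by (intro Bochner_Integration.integrable_bound[OF assms(1,2)]) (auto elim!: eventually_mono)
  then have "norm (prim w x) \<le> (\<integral>y. norm (indicator {..x} y *\<^sub>R w y) \<partial>I01)"
    unfolding prim_def by (intro integral_norm_bound)
  also have "\<dots> = prim (\<lambda>y. norm (w y)) x"
    unfolding prim_def by (intro Bochner_Integration.integral_cong) auto
  also have "\<dots> \<le> prim \<phi> x"
    using assms \<open>integrable I01 w\<close> by (intro prim_mono) auto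
  finally show ?thesis .
qed

lemma prim_nonneg:
  fixes w :: "real \<Rightarrow> real"
  assumes "AE y in I01. 0 \<le> w y"
  shows "0 \<le> prim w x"
  unfolding prim_def using assms by (intro integral_nonneg_AE) (auto elim!: eventually_mono)

lemma prim_le_integral:
  fixes w :: "real \<Rightarrow> real"
  assumes "integrable I01 w" "AE y in I01. 0 \<le> w y"
  shows "prim w x \<le> (\<integral>y. w y \<partial>I01)"
  unfolding prim_def using assms
  by (intro integral_mono_AE integrable_prim) (auto elim!: eventually_mono simp: indicator_def)

lemma norm_prim_le_integral:
  assumes "integrable I01 w"
  shows "norm (prim w x) \<le> (\<integral>y. norm (w y) \<partial>I01)"
  using norm_prim_le[of "\<lambda>y. norm (w y)" w x] prim_le_integral[of "\<lambda>y. norm (w y)" x] assms by fastforce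

lemma norm_prim_le_const:
  assumes "w \<in> borel_measurable I01" "AE y in I01. norm (w y) \<le> C"
  shows "norm (prim w x) \<le> C"
proof -
  have i: "integrable I01 w" by (rule integrable_bounded_I01[OF assms])
  have "(\<integral>y. norm (w y) \<partial>I01) \<le> (\<integral>y. C \<partial>I01)"
    using assms i by (intro integral_mono_AE) auto
  then show ?thesis using norm_prim_le_integral[OF i, of x] by simp
qed

text \<open>\<open>prim \<phi>\<close> is nondecreasing and the interval has length 1, so
  integrating once more does not increase the value. This absorbs double integrals into single ones
  in the Volterra estimates.\<close>

lemma prim_prim_le:
  fixes \<phi> :: "real \<Rightarrow> real"
  assumes i: "integrable I01 \<phi>" and ip: "integrable I01 (prim \<phi>)" and nn: "AE y in I01. 0 \<le> \<phi> y"
  shows "prim (prim \<phi>) x \<le> prim \<phi> x"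
proof -
  have mono: "prim \<phi> y \<le> prim \<phi> x" if "y \<le> x" for y
    unfolding prim_def using nn that
    by (intro integral_mono_AE integrable_prim i) (auto elim!: eventually_mono simp: indicator_def)
  have "prim (prim \<phi>) x \<le> (\<integral>y. prim \<phi> x \<partial>I01)"
    unfolding prim_def[of "prim \<phi>"]
    using mono prim_nonneg[OF nn]
    by (intro integral_mono integrable_prim ip) (auto simp: indicator_def)
  then show ?thesis by simp
qed

section \<open>Continuity of primitives and integration by parts\<close>

lemma AE_I01_neq: "AE y in I01. y \<noteq> x"
proof -
  have "AE y in lebesgue. y \<noteq> x"
    by (metis AE_lborel_singleton AE_completion)
  then show ?thesis by (subst AE_restrict_space_iff) (auto elim!: eventually_mono)
qed

lemma continuous_prim:
  fixes w :: "real \<Rightarrow> 'a::euclidean_space"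
  assumes "integrable I01 w"
  shows "continuous_on UNIV (prim w)"
proof -
  have [measurable]: "w \<in> borel_measurable I01" using assms by auto
  have "(\<lambda>k. prim w (s k)) \<longlonglongrightarrow> prim w x" if s: "s \<longlonglongrightarrow> x" for s x
    unfolding prim_def
  proof (rule integral_dominated_convergence[where w="\<lambda>y. norm (w y)"])
    \<comment> \<open>Off the null set {x} the indicator of \<open>{..s k}\<close> at y is
      eventually constant in k.\<close>
    show "AE y in I01. (\<lambda>k. indicator {..s k} y *\<^sub>R w y) \<longlonglongrightarrow> indicator {..x} y *\<^sub>R w y"
      using AE_I01_neq[of x]
    proof eventually_elim
      fix y assume "y \<noteq> x"
      then consider "y < x" | "x < y" by linarith
      then have "eventually (\<lambda>k. indicator {..s k} y = (indicator {..x} y :: real)) sequentially"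
      proof cases
        case 1
        with s have "eventually (\<lambda>k. y < s k) sequentially" by (rule order_tendstoD)
        then show ?thesis by eventually_elim (use 1 in auto)
      next
        case 2
        with s have "eventually (\<lambda>k. s k < y) sequentially" by (rule order_tendstoD)
        then show ?thesis by eventually_elim (use 2 in auto)
      qed
      then show "(\<lambda>k. indicator {..s k} y *\<^sub>R w y) \<longlonglongrightarrow> indicator {..x} y *\<^sub>R w y"
        by (intro tendsto_eventually) (auto elim!: eventually_mono)
    qed
  qed (use assms in \<open>auto intro!: integrable_prim borel_measurable_integrable simp: indicator_def\<close>)
  then show ?thesis
    by (auto simp: continuous_on_eq_continuous_within continuous_within_sequentially o_def)
qed

lemma measurable_prim:
  fixes w :: "real \<Rightarrow> 'a::euclidean_space"
  shows "integrable I01 w \<Longrightarrow> prim w \<in> borel_measurable I01"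
  by (intro continuous_measurable_I01 continuous_prim)

lemma integrable_prim_I01:
  fixes w :: "real \<Rightarrow> 'a::euclidean_space"
  shows "integrable I01 w \<Longrightarrow> integrable I01 (prim w)"
  by (rule integrable_bounded_I01[OF measurable_prim, of _ "\<integral>y. norm (w y) \<partial>I01"])
    (auto intro!: AE_I2 norm_prim_le_integral)

text \<open>Fubini on the unit square for p (a y) (b z): the triangles y < z and z \<le> y
  contribute the two integrals on the left, and the whole square gives the product on the
  right.\<close>

lemma prim_by_parts_total:
  fixes a :: "real \<Rightarrow> 'a::euclidean_space" and b :: "real \<Rightarrow> 'b::euclidean_space"
    and p :: "'a \<Rightarrow> 'b \<Rightarrow> 'c::euclidean_space"
  assumes p: "bounded_bilinear p" and a: "integrable I01 a" and b: "integrable I01 b"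
  shows "(\<integral>y. p (prim a y) (b y) \<partial>I01) + (\<integral>y. p (a y) (prim b y) \<partial>I01)
       = p (\<integral>y. a y \<partial>I01) (\<integral>y. b y \<partial>I01)"
proof -
  interpret finite_measure I01 by (rule finite_measure_I01)
  interpret pair_sigma_finite I01 I01 by unfold_locales
  interpret p: bounded_bilinear p by fact
  obtain K where K: "0 < K" "\<And>a b. norm (p a b) \<le> norm a * norm b * K"
    using p.pos_bounded by blast
  have [measurable]: "a \<in> borel_measurable I01" "b \<in> borel_measurable I01" using a b by auto
  have cont: "continuous_on UNIV (\<lambda>z. p (fst z) (snd z))"
    by (intro bounded_bilinear.continuous_on[OF p] continuous_intros)
  have m [measurable]: "(\<lambda>z. p (a (fst z)) (b (snd z))) \<in> borel_measurable (I01 \<Otimes>\<^sub>M I01)"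
    by (rule borel_measurable_continuous_Pair[OF _ _ cont, simplified]) measurable
  have int: "integrable (I01 \<Otimes>\<^sub>M I01) (\<lambda>z. p (a (fst z)) (b (snd z)))"
  proof (rule Bochner_Integration.integrable_bound[OF _ m])
    have "integrable (I01 \<Otimes>\<^sub>M I01) (\<lambda>z. norm (a (fst z)) * norm (b (snd z)))"
      by (rule Fubini_integrable) (use a b in auto)
    then show "integrable (I01 \<Otimes>\<^sub>M I01) (\<lambda>z. norm (a (fst z)) * norm (b (snd z)) * K)" by simp
    show "AE x in I01 \<Otimes>\<^sub>M I01. norm (p (a (fst x)) (b (snd x))) \<le> norm (norm (a (fst x)) * norm (b (snd x)) * K)"
      using K by (intro AE_I2) (simp add: abs_mult)
  qed
  define L where "L = {z :: real \<times> real. snd z \<le> fst z}"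
  have L: "(\<lambda>z. indicator L z :: real) \<in> borel_measurable (I01 \<Otimes>\<^sub>M I01)"
  proof -
    have "{z \<in> space (I01 \<Otimes>\<^sub>M I01). snd z \<le> fst z} \<in> sets (I01 \<Otimes>\<^sub>M I01)"
      by measurable
    then have "(\<lambda>z. indicator {z \<in> space (I01 \<Otimes>\<^sub>M I01). snd z \<le> fst z} z :: real) \<in> borel_measurable (I01 \<Otimes>\<^sub>M I01)"
      by measurable
    then show ?thesis
      by (subst measurable_cong) (auto simp: L_def indicator_def)
  qed
  have int1: "integrable (I01 \<Otimes>\<^sub>M I01) (\<lambda>z. indicator L z *\<^sub>R p (a (fst z)) (b (snd z)))"
    by (rule Bochner_Integration.integrable_bound[OF int])
      (use L in \<open>auto intro!: AE_I2 borel_measurable_scaleR simp: indicator_def\<close>)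
  have int2: "integrable (I01 \<Otimes>\<^sub>M I01) (\<lambda>z. p (a (fst z)) (b (snd z)) - indicator L z *\<^sub>R p (a (fst z)) (b (snd z)))"
    using int int1 by simp
  have A: "(\<integral>z. indicator L z *\<^sub>R p (a (fst z)) (b (snd z)) \<partial>(I01 \<Otimes>\<^sub>M I01)) = (\<integral>y. p (a y) (prim b y) \<partial>I01)"
  proof (subst integral_fst'[OF int1, symmetric], rule Bochner_Integration.integral_cong[OF refl])
    fix y
    have "(\<integral>z. p (a y) (indicator {..y} z *\<^sub>R b z) \<partial>I01) = p (a y) (prim b y)"
      unfolding prim_def by (rule integral_bounded_linear[OF p.bounded_linear_right integrable_prim[OF b]])
    then show "(\<integral>z. indicator L (y, z) *\<^sub>R p (a (fst (y, z))) (b (snd (y, z))) \<partial>I01) = p (a y) (prim b y)"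
      by (simp add: L_def indicator_def p.scaleR_right cong: if_cong)
  qed
  have B: "(\<integral>z. p (a (fst z)) (b (snd z)) - indicator L z *\<^sub>R p (a (fst z)) (b (snd z)) \<partial>(I01 \<Otimes>\<^sub>M I01))
      = (\<integral>y. p (prim a y) (b y) \<partial>I01)"
  proof -
    have "(\<integral>z. (\<integral>y. p (a y) (b z) - indicator L (y, z) *\<^sub>R p (a y) (b z) \<partial>I01) \<partial>I01) =
      (\<integral>y. p (prim a y) (b y) \<partial>I01)"
    proof (rule Bochner_Integration.integral_cong[OF refl])
      fix z
      have "(\<integral>y. p (indicator {..z} y *\<^sub>R a y) (b z) \<partial>I01) = p (prim a z) (b z)"
        unfolding prim_def by (rule integral_bounded_linear[OF p.bounded_linear_left integrable_prim[OF a]])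
      moreover have "(\<integral>y. p (a y) (b z) - indicator L (y, z) *\<^sub>R p (a y) (b z) \<partial>I01)
        = (\<integral>y. p (indicator {..z} y *\<^sub>R a y) (b z) \<partial>I01)"
      proof (rule integral_cong_AE)
        have [measurable]: "(\<lambda>y. p (a y) (b z)) \<in> borel_measurable I01"
          by (rule borel_measurable_integrable[OF integrable_bounded_linear[OF p.bounded_linear_left a]])
        have *: "(\<lambda>y. indicator L (y, z) :: real) = indicator {z..}"
          by (auto simp: L_def indicator_def fun_eq_iff)
        have iL: "(\<lambda>y. indicator L (y, z) :: real) \<in> borel_measurable I01"
          unfolding * by (rule borel_measurable_I01) simp
        show "(\<lambda>y. p (a y) (b z) - indicator L (y, z) *\<^sub>R p (a y) (b z)) \<in> borel_measurable I01"
          by (intro borel_measurable_diff borel_measurable_scaleR iL) auto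
        show "(\<lambda>y. p (indicator {..z} y *\<^sub>R a y) (b z)) \<in> borel_measurable I01"
          by (rule borel_measurable_integrable[OF integrable_bounded_linear[OF p.bounded_linear_left integrable_prim[OF a]]])
        \<comment> \<open>The complement of the triangle requires y < z, whereas \<open>prim\<close>
          integrates over y \<le> z; the two differ by the null set {z}.\<close>
        show "AE y in I01. p (a y) (b z) - indicator L (y, z) *\<^sub>R p (a y) (b z) = p (indicator {..z} y *\<^sub>R a y) (b z)"
          using AE_I01_neq[of z] by eventually_elim (auto simp: L_def indicator_def p.zero_left)
      qed
      ultimately show "(\<integral>y. p (a y) (b z) - indicator L (y, z) *\<^sub>R p (a y) (b z) \<partial>I01) = p (prim a z) (b z)"
        by simp
    qed
    then show ?thesis
      using integral_snd[of "\<lambda>y z. p (a y) (b z) - indicator L (y, z) *\<^sub>R p (a y) (b z)"] int2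
      by (simp add: case_prod_beta' split_beta')
  qed
  have C: "(\<integral>z. p (a (fst z)) (b (snd z)) \<partial>(I01 \<Otimes>\<^sub>M I01)) = p (\<integral>y. a y \<partial>I01) (\<integral>y. b y \<partial>I01)"
  proof -
    have "(\<integral>z. p (a (fst z)) (b (snd z)) \<partial>(I01 \<Otimes>\<^sub>M I01)) = (\<integral>y. p (a y) (\<integral>z. b z \<partial>I01) \<partial>I01)"
    proof (subst integral_fst'[OF int, symmetric], rule Bochner_Integration.integral_cong[OF refl])
      fix y show "(\<integral>z. p (a (fst (y, z))) (b (snd (y, z))) \<partial>I01) = p (a y) (\<integral>z. b z \<partial>I01)"
        by simp (rule integral_bounded_linear[OF p.bounded_linear_right b])
    qed
    also have "\<dots> = p (\<integral>y. a y \<partial>I01) (\<integral>y. b y \<partial>I01)"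
      by (rule integral_bounded_linear[OF p.bounded_linear_left a])
    finally show ?thesis .
  qed
  show ?thesis
    unfolding A[symmetric] B[symmetric] C[symmetric]
    by (subst Bochner_Integration.integral_add[symmetric]) (use int1 int in \<open>auto simp: mult.commute\<close>)
qed

text \<open>Follows from the total integral by cutting both functions off at x, since the primitive
  of a function cut off at x is the original primitive stopped at x.\<close>

lemma prim_by_parts:
  fixes a :: "real \<Rightarrow> 'a::euclidean_space" and b :: "real \<Rightarrow> 'b::euclidean_space"
    and p :: "'a \<Rightarrow> 'b \<Rightarrow> 'c::euclidean_space"
  assumes p: "bounded_bilinear p" and a: "integrable I01 a" and b: "integrable I01 b"
  shows "prim (\<lambda>y. p (prim a y) (b y)) x + prim (\<lambda>y. p (a y) (prim b y)) x
       = p (prim a x) (prim b x)"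
proof -
  interpret p: bounded_bilinear p by fact
  define a' where "a' = (\<lambda>y. indicator {..x} y *\<^sub>R a y)"
  define b' where "b' = (\<lambda>y. indicator {..x} y *\<^sub>R b y)"
  have ab: "integrable I01 a'" "integrable I01 b'"
    unfolding a'_def b'_def using a b by (auto intro: integrable_prim)
  have pa: "prim a' y = prim a (min x y)" "prim b' y = prim b (min x y)" for y
    unfolding a'_def b'_def prim_def by (auto intro!: Bochner_Integration.integral_cong simp: indicator_def)
  have "prim (\<lambda>y. p (prim a y) (b y)) x = (\<integral>y. p (prim a' y) (b' y) \<partial>I01)"
    unfolding prim_def[of "\<lambda>y. p (prim a y) (b y)"] pa
    by (rule Bochner_Integration.integral_cong) (auto simp: b'_def indicator_def p.scaleR_right min_def)
  moreover have "prim (\<lambda>y. p (a y) (prim b y)) x = (\<integral>y. p (a' y) (prim b' y) \<partial>I01)"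
    unfolding prim_def[of "\<lambda>y. p (a y) (prim b y)"] pa
    by (rule Bochner_Integration.integral_cong) (auto simp: a'_def indicator_def p.scaleR_left min_def)
  moreover have "(\<integral>y. a' y \<partial>I01) = prim a x" "(\<integral>y. b' y \<partial>I01) = prim b x"
    by (auto simp: a'_def b'_def prim_def)
  ultimately show ?thesis using prim_by_parts_total[OF p ab] by simp
qed

text \<open>Bridge from the Lebesgue integral over the open interval to the gauge integral over
  [0,x], for which the fundamental theorem of calculus is available; the endpoints 0 and 1 are
  negligible.\<close>

lemma prim_eq_integral:
  fixes w :: "real \<Rightarrow> 'a::euclidean_space"
  assumes "integrable I01 w" "0 \<le> x" "x \<le> 1"
  shows "prim w x = integral {0..x} w" "w integrable_on {0..x}"
proof -
  have "integrable lebesgue (\<lambda>y. indicator {0<..<1} y *\<^sub>R indicator {..x} y *\<^sub>R w y)"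
    using integrable_prim[OF assms(1), of x] by (subst (asm) integrable_restrict_space) auto
  moreover have "(\<lambda>y. indicator {0<..<1} y *\<^sub>R indicator {..x} y *\<^sub>R w y) = (\<lambda>y. indicator ({0<..<1} \<inter> {..x}) y *\<^sub>R w y)"
    by (auto simp: indicator_def)
  ultimately have s: "set_integrable lebesgue ({0<..<1} \<inter> {..x}) w" by (simp add: set_integrable_def)
  have "prim w x = (\<integral>y. indicator {0<..<1} y *\<^sub>R indicator {..x} y *\<^sub>R w y \<partial>lebesgue)"
    unfolding prim_def by (subst integral_restrict_space) auto
  also have "\<dots> = (LINT y:{0<..<1} \<inter> {..x}|lebesgue. w y)"
    unfolding set_lebesgue_integral_def by (rule Bochner_Integration.integral_cong) (auto simp: indicator_def)
  also have "\<dots> = integral ({0<..<1} \<inter> {..x}) w"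
    by (rule set_lebesgue_integral_eq_integral(2)[OF s])
  finally have 1: "prim w x = integral ({0<..<1} \<inter> {..x}) w" .
  have i: "w integrable_on ({0<..<1} \<inter> {..x})"
    by (rule set_lebesgue_integral_eq_integral(1)[OF s])
  have n: "negligible {0::real, 1}" by simp

  show "prim w x = integral {0..x} w" unfolding 1
    by (rule integral_spike_set; rule negligible_subset[OF n]) (use assms in auto)
  show "w integrable_on {0..x}"
    by (rule integrable_spike_set[OF i]; rule negligible_subset[OF n]) (use assms in auto)
qed

text \<open>Bielecki weight exp(l x), with x clamped to [0,1] so that it is bounded on the whole
  line and constant wherever \<open>prim\<close> is.\<close>

definition weight :: "real \<Rightarrow> real \<Rightarrow> real"
  where "weight l x = exp (l * min 1 (max 0 x))"

lemma weight_bounds: "l \<ge> 0 \<Longrightarrow> 1 \<le> weight l x" "l \<ge> 0 \<Longrightarrow> weight l x \<le> exp l" "0 < weight l x"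
  unfolding weight_def by (auto simp: mult_left_le)

lemma continuous_weight: "continuous_on A (weight l)"
  unfolding weight_def by (intro continuous_intros)

lemma prim_weight_le:
  assumes l: "l > 0"
  shows "integrable I01 (weight l)" "prim (weight l) x \<le> weight l x / l"
proof -
  show i: "integrable I01 (weight l)"
    by (rule integrable_bounded_I01[of _ "exp l"])
      (use l in \<open>auto intro!: continuous_measurable_I01 continuous_weight AE_I2 simp: weight_bounds less_imp_le\<close>)
  define z where "z = min 1 (max 0 x)"
  have z: "0 \<le> z" "z \<le> 1" by (auto simp: z_def)
  have "prim (weight l) x = prim (weight l) z"
    unfolding prim_def by (rule Bochner_Integration.integral_cong) (auto simp: z_def indicator_def)
  also have "\<dots> = integral {0..z} (weight l)"
    by (rule prim_eq_integral[OF i z])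
  also have "\<dots> = integral {0..z} (\<lambda>y. exp (l * y))"
    by (rule Henstock_Kurzweil_Integration.integral_cong) (use z in \<open>auto simp: weight_def\<close>)
  also have "\<dots> = exp (l * z) / l - exp (l * 0) / l"
    by (rule integral_unique, rule fundamental_theorem_of_calculus[OF z(1)])
      (use l in \<open>auto intro!: derivative_eq_intros simp flip: has_real_derivative_iff_has_vector_derivative\<close>)
  also have "\<dots> \<le> weight l x / l" using l by (simp add: weight_def z_def divide_simps)
  finally show "prim (weight l) x \<le> weight l x / l" .
qed

lemma prim_weighted_le:
  fixes \<phi> :: "real \<Rightarrow> real"
  assumes "l > 0" "m \<ge> 0" "\<phi> \<in> borel_measurable I01" "AE y in I01. \<bar>\<phi> y\<bar> \<le> m * weight l y"
  shows "prim \<phi> x \<le> m * weight l x / l"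
proof -
  have "\<bar>prim \<phi> x\<bar> \<le> prim (\<lambda>y. m * weight l y) x"
    using norm_prim_le[of "\<lambda>y. m * weight l y" \<phi> x] assms prim_weight_le(1)[of l] by simp
  also have "\<dots> = m * prim (weight l) x" by (rule prim_mult)
  also have "\<dots> \<le> m * (weight l x / l)" using assms by (intro mult_left_mono prim_weight_le)
  finally show ?thesis by simp
qed

text \<open>The supremum M of \<phi> / weight satisfies M \<le> a + M / 2, because the Volterra
  operator is a contraction in the weighted norm. The bound b only serves to make M finite and does
  not enter the result.\<close>

lemma Volterra_Gronwall:
  fixes \<phi> :: "real \<Rightarrow> real"
  assumes m: "\<phi> \<in> borel_measurable I01" and b: "\<And>x. \<bar>\<phi> x\<bar> \<le> b"
    and C: "C > 0" "a \<ge> 0" and nn: "\<And>x. 0 \<le> \<phi> x"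
    and G: "\<And>x. \<phi> x \<le> a + C * prim \<phi> x"
  shows "\<phi> x \<le> 2 * exp (2 * C) * a"
proof -
  \<comment> \<open>\<open>prim_weighted_le\<close> gains a factor 1 / l, so this choice reduces the
    constant C to 1/2.\<close>
  define l where "l = 2 * C"
  have l: "l > 0" using C by (simp add: l_def)
  have w: "1 \<le> weight l x" for x using l by (simp add: weight_bounds)
  define q where "q = (\<lambda>x. \<phi> x / weight l x)"
  have qb: "q x \<le> b" for x
  proof -
    have "q x \<le> \<phi> x / 1" unfolding q_def using w[of x] nn[of x] by (intro divide_left_mono) auto
    then show ?thesis using b[of x] by linarith
  qed
  define M where "M = (SUP x. q x)"
  have bdd: "bdd_above (range q)" using qb by (intro bdd_aboveI[of _ b]) auto
  have qM: "q x \<le> M" for x unfolding M_def by (rule cSUP_upper[OF _ bdd]) simp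
  have "0 \<le> q x" for x unfolding q_def using nn w[of x] by (intro divide_nonneg_nonneg) auto
  then have M0: "0 \<le> M" using qM[of 0] by (meson order_trans)
  have phiM: "\<phi> x \<le> M * weight l x" for x
    using qM[of x] w[of x] unfolding q_def by (subst (asm) pos_divide_le_eq) auto
  have "q x \<le> a + M / 2" for x
  proof -
    have "prim \<phi> x \<le> M * weight l x / l"
      by (rule prim_weighted_le[OF l M0 m]) (use phiM nn in auto)
    then have "\<phi> x \<le> a + C * (M * weight l x / l)"
      using G[of x] C by (meson add_left_mono mult_left_mono less_imp_le order_trans)
    also have "\<dots> = a + M / 2 * weight l x" using C by (simp add: l_def)
    also have "\<dots> \<le> a * weight l x + M / 2 * weight l x"
      using w[of x] C by (simp add: mult_le_cancel_left1)
    finally have "\<phi> x \<le> (a + M / 2) * weight l x" by (simp add: algebra_simps)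
    then show ?thesis unfolding q_def using w[of x] by (subst pos_divide_le_eq) auto
  qed
  then have "M \<le> a + M / 2" unfolding M_def by (intro cSUP_least) auto
  then have "M \<le> 2 * a" by simp
  have "\<phi> x \<le> M * weight l x" by (rule phiM)
  also have "\<dots> \<le> (2 * a) * exp l"
    using \<open>M \<le> 2 * a\<close> M0 C l by (intro mult_mono) (auto simp: weight_bounds less_imp_le weight_def)
  finally show ?thesis by (simp add: l_def mult_ac)
qed

section \<open>Test functions\<close>

text \<open>The smoothness half of \<open>test_functions\<close>, split off so that smoothness and
  support can be treated separately.\<close>

definition smooth_curve :: "(real \<Rightarrow> 'a::euclidean_space) \<Rightarrow> bool"
  where "smooth_curve f \<longleftrightarrow> (\<forall>k x. ((\<lambda>f y. vector_derivative f (at y)) ^^ k) f differentiable (at x))"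

text \<open>A function is smooth as soon as it lies in some class closed under differentiation. The
  smoothness proofs below merely exhibit such a class and so avoid formulas for the k-th
  derivative.\<close>

lemma smooth_curve_coinduct:
  assumes f: "f \<in> S"
    and "\<And>g. g \<in> S \<Longrightarrow> \<exists>g'\<in>S. \<forall>x. (g has_vector_derivative g' x) (at x)"
  shows "smooth_curve f"
proof -
  note S = assms(2)
  have 1: "(\<lambda>y. vector_derivative g (at y)) \<in> S \<and> (\<forall>x. g differentiable (at x))" if gS: "g \<in> S" for g
  proof -
    obtain g' where g': "g' \<in> S" "\<And>x. (g has_vector_derivative g' x) (at x)"
      using S[OF gS] by blast
    then have "(\<lambda>y. vector_derivative g (at y)) = g'" by (auto simp: vector_derivative_at)
    then show ?thesis using g' by (auto intro: differentiableI_vector)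
  qed
  have "((\<lambda>f y. vector_derivative f (at y)) ^^ k) f \<in> S" for k
    by (induction k) (use f 1 in auto)
  then show ?thesis unfolding smooth_curve_def using 1 by blast
qed

lemma smooth_curveD:
  assumes "smooth_curve f"
  shows "(f has_vector_derivative vector_derivative f (at x)) (at x)"
    and "smooth_curve (\<lambda>y. vector_derivative f (at y))"
proof -
  let ?D = "\<lambda>f y. vector_derivative f (at y)"
  have "(?D ^^ 0) f differentiable (at x)" using assms unfolding smooth_curve_def by blast
  then show "(f has_vector_derivative vector_derivative f (at x)) (at x)"
    by (simp add: vector_derivative_works)
  have e: "(?D ^^ k) (?D f) = (?D ^^ (Suc k)) f" for k by (simp only: funpow_Suc_right o_def)
  show "smooth_curve (?D f)" unfolding smooth_curve_def e using assms unfolding smooth_curve_def by blast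
qed

lemma smooth_curve_antiderivative:
  assumes "smooth_curve f" "\<And>x. (F has_vector_derivative f x) (at x)"
  shows "smooth_curve F"
proof (rule smooth_curve_coinduct[of _ "insert F (Collect smooth_curve)"])
  fix g assume "g \<in> insert F (Collect smooth_curve)"
  then consider "g = F" | "smooth_curve g" by blast
  then show "\<exists>g'\<in>insert F (Collect smooth_curve). \<forall>x. (g has_vector_derivative g' x) (at x)"
  proof cases
    case 1
    then show ?thesis using assms by (intro bexI[of _ f]) auto
  next
    case 2
    then show ?thesis
      using smooth_curveD by (intro bexI[of _ "\<lambda>x. vector_derivative g (at x)"]) auto
  qed
qed blast

lemma continuous_smooth_curve: "smooth_curve f \<Longrightarrow> continuous_on A f"
  using smooth_curveD(1)[of f]
  by (intro continuous_at_imp_continuous_on ballI) (auto intro: has_vector_derivative_continuous)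

text \<open>The Leibniz rule turns a product into a sum of two products, so finite sums of products
  are closed under differentiation, as \<open>smooth_curve_coinduct\<close> requires.\<close>

inductive_set smooth_products :: "(real \<Rightarrow> 'a::euclidean_space) set" where
  prod: "smooth_curve f \<Longrightarrow> smooth_curve g \<Longrightarrow> (\<lambda>x. f x *\<^sub>R g x) \<in> smooth_products"
| sum: "a \<in> smooth_products \<Longrightarrow> b \<in> smooth_products \<Longrightarrow> (\<lambda>x. a x + b x) \<in> smooth_products"

lemma smooth_curve_scaleR:
  fixes g :: "real \<Rightarrow> 'a::euclidean_space"
  assumes "smooth_curve f" "smooth_curve g"
  shows "smooth_curve (\<lambda>x. f x *\<^sub>R g x)"
proof (rule smooth_curve_coinduct[of _ smooth_products])
  show "(\<lambda>x. f x *\<^sub>R g x) \<in> smooth_products" using assms by (rule prod)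
  fix h :: "real \<Rightarrow> 'a" assume "h \<in> smooth_products"
  then show "\<exists>h'\<in>smooth_products. \<forall>x. (h has_vector_derivative h' x) (at x)"
  proof induction
    case (prod f g)
    let ?f' = "\<lambda>y. vector_derivative f (at y)" and ?g' = "\<lambda>y. vector_derivative g (at y)"
    have "((\<lambda>x. f x *\<^sub>R g x) has_vector_derivative (f x *\<^sub>R ?g' x + ?f' x *\<^sub>R g x)) (at x)" for x
      using smooth_curveD(1)[OF prod(1), of x] smooth_curveD(1)[OF prod(2), of x]
      by (intro has_vector_derivative_scaleR) (auto simp: has_real_derivative_iff_has_vector_derivative)
    moreover have "(\<lambda>x. f x *\<^sub>R ?g' x + ?f' x *\<^sub>R g x) \<in> smooth_products"
      using prod smooth_curveD(2)[of f] smooth_curveD(2)[of g] by (intro smooth_products.intros)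
    ultimately show ?case by (intro bexI[of _ "\<lambda>x. f x *\<^sub>R ?g' x + ?f' x *\<^sub>R g x"]) auto
  next
    case (sum a b)
    then obtain a' b' where "a' \<in> smooth_products" "b' \<in> smooth_products"
      "\<And>x. (a has_vector_derivative a' x) (at x)" "\<And>x. (b has_vector_derivative b' x) (at x)" by blast
    then show ?case
      by (intro bexI[of _ "\<lambda>x. a' x + b' x"] allI has_vector_derivative_add smooth_products.sum)
  qed
qed

lemma smooth_curve_polynomial:
  fixes p :: "real \<Rightarrow> 'a::euclidean_space"
  assumes "polynomial_function p"
  shows "smooth_curve p"
proof (rule smooth_curve_coinduct[of _ "Collect polynomial_function"])
  fix g :: "real \<Rightarrow> 'a" assume "g \<in> Collect polynomial_function"
  then obtain g' where "polynomial_function g'" "\<And>x. (g has_vector_derivative g' x) (at x)"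
    using has_vector_derivative_polynomial_function[of g] by auto
  then show "\<exists>g'\<in>Collect polynomial_function. \<forall>x. (g has_vector_derivative g' x) (at x)"
    by (intro bexI[of _ g']) auto
qed (use assms in simp)

lemma smooth_curve_const: "smooth_curve (\<lambda>_. c)"
  by (rule smooth_curve_polynomial) simp

lemma smooth_curve_add: "smooth_curve f \<Longrightarrow> smooth_curve g \<Longrightarrow> smooth_curve (\<lambda>x. f x + g x)"
proof (rule smooth_curve_coinduct[of _ "{\<lambda>x. f x + g x |f g. smooth_curve f \<and> smooth_curve g}"])
  fix h :: "real \<Rightarrow> 'a" assume "h \<in> {\<lambda>x. f x + g x |f g. smooth_curve f \<and> smooth_curve g}"
  then obtain f g where h: "h = (\<lambda>x. f x + g x)" "smooth_curve f" "smooth_curve g" by blast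
  show "\<exists>h'\<in>{\<lambda>x. f x + g x |f g. smooth_curve f \<and> smooth_curve g}. \<forall>x. (h has_vector_derivative h' x) (at x)"
  proof (rule bexI[of _ "\<lambda>x. vector_derivative f (at x) + vector_derivative g (at x)"])
    show "\<forall>x. (h has_vector_derivative vector_derivative f (at x) + vector_derivative g (at x)) (at x)"
      unfolding h(1) using h smooth_curveD(1) by (intro allI has_vector_derivative_add) auto
    show "(\<lambda>x. vector_derivative f (at x) + vector_derivative g (at x)) \<in> {\<lambda>x. f x + g x |f g. smooth_curve f \<and> smooth_curve g}"
      using smooth_curveD(2)[OF h(2)] smooth_curveD(2)[OF h(3)] by (intro CollectI exI conjI) (rule refl)
  qed
qed blast

lemma smooth_curve_affine:
  fixes f :: "real \<Rightarrow> 'a::euclidean_space"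
  assumes "smooth_curve f"
  shows "smooth_curve (\<lambda>x. f (a * x + b))"
\<comment> \<open>The free factor c collects the powers of a that the chain rule produces.\<close>
proof (rule smooth_curve_coinduct[of _ "{\<lambda>x. c *\<^sub>R f (a * x + b) |c f. smooth_curve f}"])
  show "(\<lambda>x. f (a * x + b)) \<in> {\<lambda>x. c *\<^sub>R f (a * x + b) |c f. smooth_curve f}"
    using assms by (auto intro!: exI[of _ "1::real"] exI[of _ f])
  fix g :: "real \<Rightarrow> 'a" assume "g \<in> {\<lambda>x. c *\<^sub>R f (a * x + b) |c f. smooth_curve f}"
  then obtain c f where g: "g = (\<lambda>x. c *\<^sub>R f (a * x + b))" and f: "smooth_curve f" by blast
  let ?f' = "\<lambda>y. vector_derivative f (at y)"
  have d: "((f \<circ> (\<lambda>x. a * x + b)) has_vector_derivative (a *\<^sub>R ?f' (a * x + b))) (at x)" for x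
    by (rule vector_diff_chain_at)
      (auto intro!: derivative_eq_intros smooth_curveD f simp flip: has_real_derivative_iff_has_vector_derivative)
  have "(g has_vector_derivative (c *\<^sub>R a *\<^sub>R ?f' (a * x + b))) (at x)" for x
    using bounded_linear.has_vector_derivative[OF bounded_linear_scaleR_right d] by (simp add: g o_def)
  moreover have "(\<lambda>x. c *\<^sub>R a *\<^sub>R ?f' (a * x + b)) \<in> {\<lambda>x. c *\<^sub>R f (a * x + b) |c f. smooth_curve f}"
    using smooth_curveD(2)[OF f] by (auto intro!: exI[of _ "c * a"] exI[of _ ?f'])
  ultimately show "\<exists>g'\<in>{\<lambda>x. c *\<^sub>R f (a * x + b) |c f. smooth_curve f}. \<forall>x. (g has_vector_derivative g' x) (at x)"
    by (intro bexI[of _ "\<lambda>x. c *\<^sub>R a *\<^sub>R ?f' (a * x + b)"]) auto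
qed

section \<open>Smooth cutoff functions built from exp(-1/x)\<close>

definition flat :: "real poly \<Rightarrow> real \<Rightarrow> real"
  where "flat p x = (if x > 0 then poly p (inverse x) * exp (- inverse x) else 0)"

lemma poly_times_exp_tendsto_0: "((\<lambda>t. poly p t * exp (- t)) \<longlongrightarrow> (0::real)) at_top"
proof -
  have "((\<lambda>t. \<Sum>i\<le>degree p. coeff p i * (t ^ i / exp t)) \<longlongrightarrow> (\<Sum>i\<le>degree p. coeff p i * 0)) at_top"
    by (intro tendsto_intros tendsto_power_div_exp_0)
  moreover have "(\<Sum>i\<le>degree p. coeff p i * (t ^ i / exp t)) = poly p t * exp (- t)" for t
    by (simp add: poly_altdef sum_distrib_left exp_minus divide_inverse mult_ac)
  ultimately show ?thesis by simp
qed

text \<open>With t = 1/x the derivative of p(t) exp(-t) in x is t^2 (p(t) - p'(t)) exp(-t), and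
  \<open>[:0,0,1:]\<close> is t^2. Letting p range over all polynomials closes the family under
  differentiation.\<close>

lemma flat_derivative:
  "(flat p has_real_derivative flat ([:0,0,1:] * (p - pderiv p)) x) (at x)"
proof -
  consider "x < 0" | "x = 0" | "x > 0" by linarith
  then show ?thesis
  proof cases
    case 1
    have "((\<lambda>_. 0) has_real_derivative 0) (at x)" by simp
    then have "(flat p has_real_derivative 0) (at x)"
      by (rule has_field_derivative_transform_within_open[of _ _ _ "{..<0}"]) (use 1 in \<open>auto simp: flat_def\<close>)
    then show ?thesis using 1 by (simp add: flat_def)
  next
    case 3
    let ?y = "inverse x"
    have d: "(inverse has_real_derivative - (?y * ?y)) (at x)"
      using DERIV_inverse[of x UNIV] 3 by (simp add: power2_eq_square)
    have "((\<lambda>x. poly p (inverse x) * exp (- inverse x)) has_real_derivative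
        poly (pderiv p) ?y * - (?y * ?y) * exp (- ?y) + exp (- ?y) * - (- (?y * ?y)) * poly p ?y) (at x)"
      by (intro DERIV_mult DERIV_chain2[OF poly_DERIV] DERIV_chain2[OF DERIV_exp] DERIV_minus d)
    then have "(flat p has_real_derivative
        poly (pderiv p) ?y * - (?y * ?y) * exp (- ?y) + exp (- ?y) * - (- (?y * ?y)) * poly p ?y) (at x)"
      by (rule has_field_derivative_transform_within_open[of _ _ _ "{0<..}"]) (use 3 in \<open>auto simp: flat_def\<close>)
    moreover have "flat ([:0,0,1:] * (p - pderiv p)) x
        = poly (pderiv p) ?y * - (?y * ?y) * exp (- ?y) + exp (- ?y) * - (- (?y * ?y)) * poly p ?y"
      using 3 by (simp add: flat_def) (simp add: algebra_simps)
    ultimately show ?thesis by simp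
  next
    case 2
    have "((\<lambda>h. (flat p h - flat p 0) / h) \<longlongrightarrow> 0) (at (0::real))"
    proof (rule filterlim_split_at)
      have "eventually (\<lambda>h. h < 0) (at_left (0::real))" by (simp add: eventually_at_filter)
      then show "((\<lambda>h. (flat p h - flat p 0) / h) \<longlongrightarrow> 0) (at_left (0::real))"
        by (intro tendsto_eventually) (auto elim!: eventually_mono simp: flat_def)
      \<comment> \<open>With h = 1/t the right difference quotient at 0 is t p(t) exp(-t), so the
        exponential decay applies to the polynomial \<open>[:0,1:] * p\<close>.\<close>
      have "((\<lambda>t. (flat p (inverse t) - flat p 0) / inverse t) \<longlongrightarrow> 0) at_top"
      proof (rule Lim_transform_eventually[OF poly_times_exp_tendsto_0[of "[:0,1:] * p"]])
        show "\<forall>\<^sub>F t in at_top. poly ([:0, 1:] * p) t * exp (- t) = (flat p (inverse t) - flat p 0) / inverse t"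
          using eventually_gt_at_top[of 0] by eventually_elim (auto simp: flat_def field_simps)
      qed
      then show "((\<lambda>h. (flat p h - flat p 0) / h) \<longlongrightarrow> 0) (at_right (0::real))"
        unfolding filterlim_at_right_to_top .
    qed
    then have "(flat p has_real_derivative 0) (at 0)" by (simp add: has_field_derivative_iff)
    then show ?thesis using 2 by (simp add: flat_def)
  qed
qed

lemma smooth_curve_flat: "smooth_curve (flat p)"
proof (rule smooth_curve_coinduct[of _ "range flat"])
  fix g assume "g \<in> range flat"
  then show "\<exists>g'\<in>range flat. \<forall>x. (g has_vector_derivative g' x) (at x)"
    using flat_derivative unfolding has_real_derivative_iff_has_vector_derivative by blast
qed blast

text \<open>A product of two factors exp(-1/s), with s = (k+1) x - 1 and s = (k+1)(1 - x) - 1, which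
  vanish near 0 and near 1 respectively. The function is nowhere equal to 1, but it tends to 1
  pointwise on (0,1), and that is how it is used.\<close>

definition cutoff :: "nat \<Rightarrow> real \<Rightarrow> real"
  where "cutoff k x = flat [:1:] (real (Suc k) * x + - 1) * flat [:1:] (- real (Suc k) * x + (real (Suc k) - 1))"

lemma smooth_cutoff: "smooth_curve (cutoff k)"
  using smooth_curve_scaleR[OF smooth_curve_affine[OF smooth_curve_flat, of "[:1:]" "real (Suc k)" "-1"]
      smooth_curve_affine[OF smooth_curve_flat, of "[:1:]" "- real (Suc k)" "real (Suc k) - 1"]]
  unfolding cutoff_def[abs_def] real_scaleR_def .

lemma cutoff_bounds: "0 \<le> cutoff k x" "cutoff k x \<le> 1"
proof -
  have *: "0 \<le> flat [:1:] x \<and> flat [:1:] x \<le> 1" for x by (simp add: flat_def)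
  show "0 \<le> cutoff k x" "cutoff k x \<le> 1"
    unfolding cutoff_def using * by (auto intro!: mult_le_one mult_nonneg_nonneg)
qed

lemma cutoff_support: "x \<notin> {1 / real (Suc k) .. 1 - 1 / real (Suc k)} \<Longrightarrow> cutoff k x = 0"
proof -
  assume "x \<notin> {1 / real (Suc k) .. 1 - 1 / real (Suc k)}"
  then consider "x < 1 / real (Suc k)" | "1 - 1 / real (Suc k) < x" by fastforce
  then have "real (Suc k) * x + - 1 \<le> 0 \<or> - real (Suc k) * x + (real (Suc k) - 1) \<le> 0"
  proof cases
    case 1
    then have "real (Suc k) * x \<le> real (Suc k) * (1 / real (Suc k))" by (intro mult_left_mono) auto
    then show ?thesis by simp
  next
    case 2
    then have "real (Suc k) * (1 - 1 / real (Suc k)) \<le> real (Suc k) * x" by (intro mult_left_mono) auto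
    moreover have "real (Suc k) * (1 - 1 / real (Suc k)) = real (Suc k) - 1" by (simp add: right_diff_distrib)
    ultimately show ?thesis by linarith
  qed
  then show ?thesis by (auto simp: cutoff_def flat_def)
qed

lemma cutoff_tendsto: "0 < x \<Longrightarrow> x < 1 \<Longrightarrow> (\<lambda>k. cutoff k x) \<longlonglongrightarrow> 1"
proof -
  have F: "(\<lambda>k. flat [:1:] (real (Suc k) * y + - 1)) \<longlonglongrightarrow> 1" if "0 < y" for y
  proof -
    have f: "filterlim (\<lambda>k. real (Suc k) * y + - 1) at_top sequentially"
    proof -
      have "filterlim (\<lambda>k. real (Suc k)) at_top sequentially"
        by (rule filterlim_compose[OF filterlim_real_sequentially filterlim_Suc])
      then have "filterlim (\<lambda>k. real (Suc k) * y) at_top sequentially"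
        using that by (intro filterlim_at_top_mult_tendsto_pos[of _ y]) auto
      then show ?thesis
        using filterlim_tendsto_add_at_top[OF tendsto_const[of "-1"], of _ sequentially]
        by (simp only: add.commute[of _ "-1"])
    qed
    have "((\<lambda>t. exp (- inverse t)) \<longlongrightarrow> exp (- 0)) (at_top :: real filter)"
      by (intro tendsto_exp tendsto_minus tendsto_inverse_0_at_top filterlim_ident)
    then have "(flat [:1:] \<longlongrightarrow> 1) at_top"
      unfolding exp_zero minus_zero
    proof (rule Lim_transform_eventually)
      show "\<forall>\<^sub>F t in at_top. exp (- inverse t) = flat [:1:] t"
        using eventually_gt_at_top[of "0::real"] by eventually_elim (simp add: flat_def)
    qed
    then show ?thesis using f by (rule filterlim_compose)
  qed
  assume "0 < x" "x < 1"
  then have "(\<lambda>k. flat [:1:] (real (Suc k) * x + - 1) * flat [:1:] (real (Suc k) * (1 - x) + - 1)) \<longlonglongrightarrow> 1 * 1"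
    by (intro tendsto_mult F) auto
  moreover have "real (Suc k) * (1 - x) + - 1 = - real (Suc k) * x + (real (Suc k) - 1)" for k
    by (simp add: algebra_simps)
  ultimately show ?thesis unfolding cutoff_def by simp
qed

section \<open>Elementary properties and density of test functions\<close>

lemma test_functions_iff: "\<phi> \<in> test_functions \<longleftrightarrow>
    smooth_curve \<phi> \<and> (\<exists>a b. 0 < a \<and> b < 1 \<and> (\<forall>x. x \<notin> {a..b} \<longrightarrow> \<phi> x = 0))"
proof -
  have "(\<exists>K. compact K \<and> K \<subseteq> {0<..<1} \<and> (\<forall>x. x \<notin> K \<longrightarrow> \<phi> x = 0)) \<longleftrightarrow>
      (\<exists>a b. 0 < a \<and> b < 1 \<and> (\<forall>x. x \<notin> {a..b} \<longrightarrow> \<phi> x = 0))"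
  proof
    assume "\<exists>K. compact K \<and> K \<subseteq> {0<..<1} \<and> (\<forall>x. x \<notin> K \<longrightarrow> \<phi> x = 0)"
    then obtain K where K: "compact K" "K \<subseteq> {0<..<1}" "\<And>x. x \<notin> K \<Longrightarrow> \<phi> x = 0" by blast
    show "\<exists>a b. 0 < a \<and> b < 1 \<and> (\<forall>x. x \<notin> {a..b} \<longrightarrow> \<phi> x = 0)"
    proof (cases "K = {}")
      case True
      then show ?thesis using K(3) by (intro exI[of _ "1/2"]) auto
    next
      case False
      obtain a where a: "a \<in> K" "\<And>x. x \<in> K \<Longrightarrow> a \<le> x" using compact_attains_inf[OF K(1) False] by blast
      obtain b where b: "b \<in> K" "\<And>x. x \<in> K \<Longrightarrow> x \<le> b" using compact_attains_sup[OF K(1) False] by blast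
      have "\<phi> x = 0" if "x \<notin> {a..b}" for x using that a(2)[of x] b(2)[of x] K(3)[of x] by auto
      moreover have "0 < a" "b < 1" using a(1) b(1) K(2) by auto
      ultimately show ?thesis by blast
    qed
  next
    assume "\<exists>a b. 0 < a \<and> b < 1 \<and> (\<forall>x. x \<notin> {a..b} \<longrightarrow> \<phi> x = 0)"
    then obtain a b where "0 < a" "b < 1" "\<And>x. x \<notin> {a..b} \<Longrightarrow> \<phi> x = 0" by blast
    then show "\<exists>K. compact K \<and> K \<subseteq> {0<..<1} \<and> (\<forall>x. x \<notin> K \<longrightarrow> \<phi> x = 0)"
      by (intro exI[of _ "{a..b}"]) auto
  qed
  then show ?thesis unfolding test_functions_def smooth_curve_def by blast
qed

lemma test_functionsE:
  assumes "\<phi> \<in> test_functions"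
  obtains a b where "smooth_curve \<phi>" "0 < a" "b < 1" "\<And>x. x \<notin> {a..b} \<Longrightarrow> \<phi> x = 0"
  using assms unfolding test_functions_iff by blast

lemma test_function_outside: "\<phi> \<in> test_functions \<Longrightarrow> x \<notin> {0<..<1} \<Longrightarrow> \<phi> x = 0"
  by (erule test_functionsE) auto

lemma test_function_bounded:
  assumes "\<phi> \<in> test_functions"
  obtains C where "0 \<le> C" "\<And>x. norm (\<phi> x) \<le> C"
proof -
  obtain a b where ab: "smooth_curve \<phi>" "\<And>x. x \<notin> {a..b} \<Longrightarrow> \<phi> x = 0"
    using assms by (rule test_functionsE) blast
  have "compact (\<phi> ` {a..b})" by (intro compact_continuous_image continuous_smooth_curve ab) auto
  then obtain C where "\<And>x. x \<in> {a..b} \<Longrightarrow> norm (\<phi> x) \<le> C"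
    by (meson bounded_iff compact_imp_bounded imageI)
  then have "norm (\<phi> x) \<le> max C 0" for x using ab(2) by (cases "x \<in> {a..b}") (auto simp: le_max_iff_disj)
  then show ?thesis by (rule that[of "max C 0", rotated]) auto
qed

lemma continuous_test_function: "\<phi> \<in> test_functions \<Longrightarrow> continuous_on A \<phi>"
  by (simp add: test_functions_iff continuous_smooth_curve)

lemma measurable_test_function [measurable_dest]: "\<phi> \<in> test_functions \<Longrightarrow> \<phi> \<in> borel_measurable I01"
  by (intro continuous_measurable_I01 continuous_test_function)

lemma integrable_test_function: "\<phi> \<in> test_functions \<Longrightarrow> integrable I01 \<phi>"
  by (metis test_function_bounded integrable_bounded_I01 measurable_test_function AE_I2)

lemma test_function_derivative:
  assumes "\<phi> \<in> test_functions"
  shows "(\<lambda>y. vector_derivative \<phi> (at y)) \<in> test_functions"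
proof -
  obtain a b where ab: "smooth_curve \<phi>" "0 < a" "b < 1" "\<And>x. x \<notin> {a..b} \<Longrightarrow> \<phi> x = 0"
    using assms by (rule test_functionsE) blast
  have "vector_derivative \<phi> (at x) = 0" if "x \<notin> {a..b}" for x
  proof (rule vector_derivative_at)
    have "((\<lambda>_. 0) has_vector_derivative 0) (at x)" by simp
    then show "(\<phi> has_vector_derivative 0) (at x)"
      by (rule has_vector_derivative_transform_within_open[of _ _ _ "- {a..b}"]) (use that ab in auto)
  qed
  then show ?thesis using ab smooth_curveD(2) unfolding test_functions_iff by blast
qed

lemma prim_test_function_derivative:
  assumes "\<phi> \<in> test_functions"
  shows "prim (\<lambda>y. vector_derivative \<phi> (at y)) x = \<phi> x"
    and "(\<integral>y. vector_derivative \<phi> (at y) \<partial>I01) = 0"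
proof -
  let ?d = "\<lambda>y. vector_derivative \<phi> (at y)"
  have i: "integrable I01 ?d" using assms by (intro integrable_test_function test_function_derivative)
  have s: "smooth_curve \<phi>" using assms by (auto simp: test_functions_iff)
  have 01: "\<phi> x = 0" if "x \<le> 0 \<or> 1 \<le> x" for x using that assms by (intro test_function_outside) auto
  have 1: "prim ?d x = \<phi> x" if "0 \<le> x" "x \<le> 1" for x
  proof -
    have "(?d has_integral (\<phi> x - \<phi> 0)) {0..x}"
      by (rule fundamental_theorem_of_calculus[OF that(1)])
        (auto intro: smooth_curveD(1)[OF s] has_vector_derivative_at_within)
    then show ?thesis using prim_eq_integral(1)[OF i that] 01[of 0] by (simp add: integral_unique)
  qed
  show 2: "(\<integral>y. ?d y \<partial>I01) = 0" using 1[of 1] prim_ge_1[of 1 ?d] 01[of 1] by simp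
  have 3: "prim ?d x = 0" if "x \<le> 0"
    unfolding prim_def by (subst Bochner_Integration.integral_cong[OF refl, of _ _ "\<lambda>_. 0"]) (use that in auto)
  show "prim ?d x = \<phi> x"
    using 1[of x] 3 prim_ge_1[of x ?d] 2 01[of x] by (cases "x \<le> 0"; cases "1 \<le> x") auto
qed

text \<open>To the right of the support the primitive equals the total integral, so vanishing mean
  is what keeps its support compact. Hence exactly the mean-zero test functions are derivatives of
  test functions.\<close>

lemma test_function_antiderivative:
  fixes \<phi> :: "real \<Rightarrow> 'a::euclidean_space"
  assumes \<phi>: "\<phi> \<in> test_functions" and mean: "(\<integral>x. \<phi> x \<partial>I01) = 0"
  shows "prim \<phi> \<in> test_functions" "(prim \<phi> has_vector_derivative \<phi> x) (at x)"
proof -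
  obtain a b where ab: "smooth_curve \<phi>" "0 < a" "b < 1" "\<And>x. x \<notin> {a..b} \<Longrightarrow> \<phi> x = 0"
    using \<phi> by (rule test_functionsE) blast
  note i = integrable_test_function[OF \<phi>]
  have left: "prim \<phi> y = 0" if "y < a" for y
    unfolding prim_def by (subst Bochner_Integration.integral_cong[OF refl, of _ _ "\<lambda>_. 0"]) (use that ab in \<open>auto simp: indicator_def\<close>)
  have right: "prim \<phi> y = 0" if "y > b" for y
    unfolding prim_def mean[symmetric] by (rule Bochner_Integration.integral_cong) (use that ab in \<open>auto simp: indicator_def\<close>)
  have D: "(prim \<phi> has_vector_derivative \<phi> x) (at x)" for x
  proof -
    consider "x < a" | "x > b" | "0 < x" "x < 1" using ab by fastforce
    then show ?thesis
    proof cases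
      case 1
      have "((\<lambda>_. 0) has_vector_derivative \<phi> x) (at x)" using 1 ab(4)[of x] by simp
      then show ?thesis
        by (rule has_vector_derivative_transform_within_open[of _ _ _ "{..<a}"]) (use 1 left in auto)
    next
      case 2
      have "((\<lambda>_. 0) has_vector_derivative \<phi> x) (at x)" using 2 ab(4)[of x] by simp
      then show ?thesis
        by (rule has_vector_derivative_transform_within_open[of _ _ _ "{b<..}"]) (use 2 right in auto)
    next
      case 3
      have "((\<lambda>u. integral {0..u} \<phi>) has_vector_derivative \<phi> x) (at x within {0..1})"
        using 3 by (intro integral_has_vector_derivative continuous_test_function \<phi>) auto
      then have "((\<lambda>u. integral {0..u} \<phi>) has_vector_derivative \<phi> x) (at x)"
        using 3 by (subst (asm) at_within_interior) auto
      then show ?thesis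
        by (rule has_vector_derivative_transform_within_open[of _ _ _ "{0<..<1}"])
          (use 3 in \<open>auto simp: prim_eq_integral[OF i]\<close>)
    qed
  qed
  then show "(prim \<phi> has_vector_derivative \<phi> x) (at x)" .
  have "prim \<phi> x = 0" if "x \<notin> {a..b}" for x using left[of x] right[of x] that by fastforce
  moreover have "smooth_curve (prim \<phi>)" by (rule smooth_curve_antiderivative[OF ab(1) D])
  ultimately show "prim \<phi> \<in> test_functions" unfolding test_functions_iff using ab by blast
qed

lemma test_function_scaleR_const:
  assumes "\<phi> \<in> test_functions"
  shows "(\<lambda>x. \<phi> x *\<^sub>R c) \<in> test_functions"
proof -
  obtain a b where ab: "smooth_curve \<phi>" "0 < a" "b < 1" "\<And>x. x \<notin> {a..b} \<Longrightarrow> \<phi> x = 0"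
    using assms by (rule test_functionsE) blast
  have "\<forall>x. x \<notin> {a..b} \<longrightarrow> \<phi> x *\<^sub>R c = 0" using ab(4) by simp
  then show ?thesis unfolding test_functions_iff
    using smooth_curve_scaleR[OF ab(1) smooth_curve_const[of c]] ab(2,3) by blast
qed

lemma test_function_const_scaleR:
  fixes c :: real
  assumes "\<phi> \<in> test_functions"
  shows "(\<lambda>x. c *\<^sub>R \<phi> x) \<in> test_functions"
proof -
  obtain a b where ab: "smooth_curve \<phi>" "0 < a" "b < 1" "\<And>x. x \<notin> {a..b} \<Longrightarrow> \<phi> x = 0"
    using assms by (rule test_functionsE) blast
  have "\<forall>x. x \<notin> {a..b} \<longrightarrow> c *\<^sub>R \<phi> x = 0" using ab(4) by simp
  then show ?thesis unfolding test_functions_iff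
    using smooth_curve_scaleR[OF smooth_curve_const[of c] ab(1)] ab(2,3) by blast
qed

lemma test_function_add:
  assumes "\<phi> \<in> test_functions" "\<psi> \<in> test_functions"
  shows "(\<lambda>x. \<phi> x + \<psi> x) \<in> test_functions"
proof -
  obtain a b where ab: "smooth_curve \<phi>" "0 < a" "b < 1" "\<And>x. x \<notin> {a..b} \<Longrightarrow> \<phi> x = 0"
    using assms(1) by (rule test_functionsE) blast
  obtain c d where cd: "smooth_curve \<psi>" "0 < c" "d < 1" "\<And>x. x \<notin> {c..d} \<Longrightarrow> \<psi> x = 0"
    using assms(2) by (rule test_functionsE) blast
  have "\<phi> x + \<psi> x = 0" if "x \<notin> {min a c..max b d}" for x using that ab(4)[of x] cd(4)[of x]
    by (cases "x < a"; cases "x < c"; cases "x > b"; cases "x > d") auto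
  moreover have "0 < min a c" "max b d < 1" using ab cd by auto
  ultimately show ?thesis unfolding test_functions_iff using smooth_curve_add[OF ab(1) cd(1)] by blast
qed

lemma test_function_diff:
  assumes "\<phi> \<in> test_functions" "\<psi> \<in> test_functions"
  shows "(\<lambda>x. \<phi> x - \<psi> x) \<in> test_functions"
  using test_function_add[OF assms(1) test_function_const_scaleR[OF assms(2), of "-1"]]
  by (simp only: scaleR_minus1_left add_uminus_conv_diff)

lemma cutoff_scaleR_test_function:
  assumes "smooth_curve f"
  shows "(\<lambda>x. cutoff k x *\<^sub>R f x) \<in> test_functions"
proof -
  have "cutoff k x *\<^sub>R f x = 0" if "x \<notin> {1 / real (Suc k) .. 1 - 1 / real (Suc k)}" for x
    using cutoff_support[OF that] by simp
  moreover have "0 < 1 / real (Suc k)" "1 - 1 / real (Suc k) < 1" by auto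
  ultimately show ?thesis
    unfolding test_functions_iff using smooth_curve_scaleR[OF smooth_cutoff assms] by blast
qed

lemma cutoff_test_function: "cutoff k \<in> test_functions"
  using cutoff_scaleR_test_function[OF smooth_curve_const[of "1::real"], of k] by simp

text \<open>Takes the place of mollification: a measurable function is an a.e. limit of continuous
  ones; these are clipped by projection onto the ball of radius C, approximated by polynomials
  uniformly on [0,1], and multiplied by \<open>cutoff\<close>. The common bound prepares for
  dominated convergence.\<close>

lemma test_functions_dense:
  fixes s :: "real \<Rightarrow> 'a::euclidean_space"
  assumes m: "s \<in> borel_measurable I01" and C: "C \<ge> 0" "AE x in I01. norm (s x) \<le> C"
  obtains \<phi> where "\<And>k::nat. \<phi> k \<in> test_functions" "\<And>k x. norm (\<phi> k x) \<le> C + 1"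
    "AE x in I01. (\<lambda>k. \<phi> k x) \<longlonglongrightarrow> s x"
proof -
  have "s measurable_on {0<..<1}" using m by (subst measurable_on_iff_borel_measurable) auto
  then obtain N g where N: "negligible N" and g: "\<And>n. continuous_on UNIV (g n)"
    and lim: "\<And>x. x \<notin> N \<Longrightarrow> (\<lambda>n. g n x) \<longlonglongrightarrow> (if x \<in> {0<..<1} then s x else 0)"
    unfolding measurable_on_def by blast
  let ?B = "cball (0::'a) C"
  have B: "closed ?B" "convex ?B" "?B \<noteq> {}" using C by auto
  define h where "h = (\<lambda>n x. closest_point ?B (g n x))"
  have hc: "continuous_on {0..1} (h n)" for n
    unfolding h_def
    by (rule continuous_on_compose2[OF continuous_on_closest_point[OF B(2,1,3), of UNIV]])
       (auto intro: continuous_on_subset[OF g])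
  have "\<exists>p. polynomial_function p \<and> (\<forall>x\<in>{0..1}. norm (h n x - p x) < 1 / real (Suc n))" for n
    by (rule Stone_Weierstrass_polynomial_function[OF _ hc]) auto
  then obtain p where p: "\<And>n. polynomial_function (p n)"
    "\<And>n x. x \<in> {0..1} \<Longrightarrow> norm (h n x - p n x) < 1 / real (Suc n)"
    by metis
  define \<phi> where "\<phi> = (\<lambda>k x. cutoff k x *\<^sub>R p k x)"
  show thesis
  proof
    show t: "\<phi> k \<in> test_functions" for k
      unfolding \<phi>_def by (intro cutoff_scaleR_test_function smooth_curve_polynomial p)
    show "norm (\<phi> k x) \<le> C + 1" for k x
    proof (cases "x \<in> {0<..<1}")
      case False
      then show ?thesis using test_function_outside[OF t False] C by simp
    next
      case True
      have "norm (p k x) \<le> norm (h k x) + norm (h k x - p k x)"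
        by (metis norm_minus_commute norm_triangle_sub)
      moreover have "norm (h k x) \<le> C"
        using closest_point_in_set[OF B(1,3), of "g k x"] by (simp add: h_def)
      moreover have "1 / real (Suc k) \<le> 1" by simp
      moreover have "norm (h k x - p k x) < 1 / real (Suc k)" using p(2)[of x k] True by auto
      ultimately have "norm (p k x) \<le> C + 1" by linarith
      then have "cutoff k x * norm (p k x) \<le> 1 * (C + 1)"
        using cutoff_bounds[of k x] by (intro mult_mono) auto
      then show ?thesis using cutoff_bounds[of k x] by (simp add: \<phi>_def)
    qed
    have "AE x in lebesgue. x \<notin> N" using N by (simp add: negligible_iff_null_sets AE_not_in)
    then have "AE x in I01. x \<notin> N" by (subst AE_restrict_space_iff) (auto elim!: eventually_mono)
    moreover have "AE x in I01. x \<in> {0<..<1}" by (rule AE_I2) simp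
    ultimately show "AE x in I01. (\<lambda>k. \<phi> k x) \<longlonglongrightarrow> s x"
      using C(2)
    proof eventually_elim
      case (elim x)
      \<comment> \<open>Clipping keeps the limit: the projection is continuous and fixes s x, whose
        norm is at most C.\<close>
      have "(\<lambda>n. closest_point ?B (g n x)) \<longlonglongrightarrow> closest_point ?B (s x)"
        using lim[OF elim(1)] elim(2)
        by (intro isCont_tendsto_compose[OF continuous_at_closest_point[OF B(2,1,3)]]) auto
      then have h: "(\<lambda>n. h n x) \<longlonglongrightarrow> s x"
        using elim(3) by (simp add: h_def closest_point_self)
      have "(\<lambda>n. h n x - p n x) \<longlonglongrightarrow> 0"
      proof (rule Lim_null_comparison)
        show "\<forall>\<^sub>F n in sequentially. norm (h n x - p n x) \<le> 1 / real (Suc n)"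
          using p(2)[of x] elim(2) by (intro always_eventually allI less_imp_le) auto
        show "(\<lambda>n. 1 / real (Suc n)) \<longlonglongrightarrow> 0"
          using LIMSEQ_inverse_real_of_nat by (simp add: inverse_eq_divide)
      qed
      from tendsto_diff[OF h this] have "(\<lambda>n. p n x) \<longlonglongrightarrow> s x" by simp
      from tendsto_scaleR[OF cutoff_tendsto this] elim(2) show ?case by (simp add: \<phi>_def)
    qed
  qed
qed

text \<open>Obtained by rescaling a member of a sequence that tends boundedly to 1 and whose
  integrals are therefore eventually positive.\<close>

lemma unit_test_function:
  obtains \<theta> :: "real \<Rightarrow> real" where "\<theta> \<in> test_functions" "(\<integral>x. \<theta> x \<partial>I01) = 1"
proof -
  obtain \<phi> :: "nat \<Rightarrow> real \<Rightarrow> real" where \<phi>: "\<And>k::nat. \<phi> k \<in> test_functions" "\<And>k x. norm (\<phi> k x) \<le> 1 + 1"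
    "AE x in I01. (\<lambda>k. \<phi> k x) \<longlonglongrightarrow> 1"
    by (rule test_functions_dense[of "\<lambda>_. 1::real" 1]) auto
  have "(\<lambda>k. \<integral>x. \<phi> k x \<partial>I01) \<longlonglongrightarrow> (\<integral>x. 1 \<partial>I01)"
    using \<phi> by (intro integral_dominated_convergence[where w="\<lambda>_. 2"]) (auto intro: measurable_test_function)
  then have "(\<lambda>k. \<integral>x. \<phi> k x \<partial>I01) \<longlonglongrightarrow> 1" by simp
  then have "eventually (\<lambda>k. (\<integral>x. \<phi> k x \<partial>I01) > 0) sequentially" by (rule order_tendstoD) simp
  then obtain k where k: "(\<integral>x. \<phi> k x \<partial>I01) > 0" by (metis eventually_sequentially order_refl)
  show thesis
    by (rule that[OF test_function_const_scaleR[OF \<phi>(1)[of k], of "1 / (\<integral>x. \<phi> k x \<partial>I01)"]]) (use k in simp)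
qed

section \<open>Weak derivatives\<close>

text \<open>Test functions converging boundedly to the sign of v turn the hypothesis into the
  vanishing of the integral of |v|.\<close>

lemma fundamental_lemma_real:
  fixes v :: "real \<Rightarrow> real"
  assumes v: "integrable I01 v" and 0: "\<And>\<phi> :: real \<Rightarrow> real. \<phi> \<in> test_functions \<Longrightarrow> (\<integral>x. \<phi> x * v x \<partial>I01) = 0"
  shows "AE x in I01. v x = 0"
proof -
  have [measurable]: "v \<in> borel_measurable I01" using v by auto
  have m: "(\<lambda>x. sgn (v x)) \<in> borel_measurable I01"
    unfolding sgn_real_def by measurable
  obtain \<phi> :: "nat \<Rightarrow> real \<Rightarrow> real" where \<phi>: "\<And>k::nat. \<phi> k \<in> test_functions" "\<And>k x. norm (\<phi> k x) \<le> 1 + 1"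
    "AE x in I01. (\<lambda>k. \<phi> k x) \<longlonglongrightarrow> sgn (v x)"
    by (rule test_functions_dense[OF m, of 1]) (auto simp: sgn_real_def)
  note [measurable] = measurable_test_function[OF \<phi>(1)]
  have "(\<lambda>k. \<integral>x. \<phi> k x * v x \<partial>I01) \<longlonglongrightarrow> (\<integral>x. sgn (v x) * v x \<partial>I01)"
  proof (rule integral_dominated_convergence[where w="\<lambda>x. 2 * norm (v x)"])
    show "AE x in I01. (\<lambda>k. \<phi> k x * v x) \<longlonglongrightarrow> sgn (v x) * v x"
      using \<phi>(3) by eventually_elim (intro tendsto_intros)
    show "AE x in I01. norm (\<phi> k x * v x) \<le> 2 * norm (v x)" for k
      using \<phi>(2)[of k] by (intro AE_I2) (auto simp: abs_mult intro!: mult_right_mono)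
    show "(\<lambda>x. sgn (v x) * v x) \<in> borel_measurable I01" using m by simp
  qed (use v in auto)
  then have "(\<integral>x. sgn (v x) * v x \<partial>I01) = 0" using 0[OF \<phi>(1)] by (simp add: LIMSEQ_const_iff)
  moreover have "sgn (v x) * v x = \<bar>v x\<bar>" for x by (metis abs_sgn mult.commute)
  ultimately have "(\<integral>x. \<bar>v x\<bar> \<partial>I01) = 0" by simp
  then show ?thesis using v by (subst (asm) integral_nonneg_eq_0_iff_AE) auto
qed

lemma fundamental_lemma:
  fixes v :: "real \<Rightarrow> 'a::euclidean_space"
  assumes v: "integrable I01 v" and 0: "\<And>\<phi> :: real \<Rightarrow> real. \<phi> \<in> test_functions \<Longrightarrow> (\<integral>x. \<phi> x *\<^sub>R v x \<partial>I01) = 0"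
  shows "AE x in I01. v x = 0"
proof -
  have "AE x in I01. v x \<bullet> i = 0" if "i \<in> Basis" for i
  proof (rule fundamental_lemma_real)
    show "integrable I01 (\<lambda>x. v x \<bullet> i)"
      by (rule integrable_bounded_linear[OF bounded_linear_inner_left v])
    fix \<phi> :: "real \<Rightarrow> real" assume \<phi>: "\<phi> \<in> test_functions"
    obtain C where "\<And>x. norm (\<phi> x) \<le> C" by (rule test_function_bounded[OF \<phi>]) blast
    then have "integrable I01 (\<lambda>x. \<phi> x *\<^sub>R v x)"
      by (intro integrable_mult_bounded_I01[OF bounded_bilinear_scaleR _ _ v] measurable_test_function[OF \<phi>]) auto
    then have "(\<integral>x. (\<phi> x *\<^sub>R v x) \<bullet> i \<partial>I01) = (\<integral>x. \<phi> x *\<^sub>R v x \<partial>I01) \<bullet> i"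
      by (rule integral_inner_left)
    then show "(\<integral>x. \<phi> x * (v x \<bullet> i) \<partial>I01) = 0" using 0[OF \<phi>] by simp
  qed
  then have "AE x in I01. \<forall>i\<in>Basis. v x \<bullet> i = 0"
    by (intro AE_finite_allI) auto
  then show ?thesis by eventually_elim (simp add: euclidean_all_zero_iff)
qed

text \<open>Every test function is a mean-zero one plus a multiple of a fixed \<theta> of integral
  1, and mean-zero ones are derivatives of test functions. So h - c is orthogonal to all test
  functions if c is the \<theta>-weighted mean of h.\<close>

lemma du_Bois_Reymond:
  fixes h :: "real \<Rightarrow> 'a::euclidean_space"
  assumes h: "integrable I01 h"
    and 0: "\<And>\<phi> :: real \<Rightarrow> real. \<phi> \<in> test_functions \<Longrightarrow> (\<integral>x. vector_derivative \<phi> (at x) *\<^sub>R h x \<partial>I01) = 0"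
  obtains c where "AE x in I01. h x = c"
proof -
  obtain \<theta> :: "real \<Rightarrow> real" where \<theta>: "\<theta> \<in> test_functions" "(\<integral>x. \<theta> x \<partial>I01) = 1" by (rule unit_test_function)
  have int: "integrable I01 (\<lambda>x. \<phi> x *\<^sub>R v x)" if \<phi>: "\<phi> \<in> test_functions" and "integrable I01 v"
    for \<phi> :: "real \<Rightarrow> real" and v :: "real \<Rightarrow> 'a"
    by (rule test_function_bounded[OF \<phi>])
      (intro integrable_mult_bounded_I01[OF bounded_bilinear_scaleR _ _ that(2)] measurable_test_function[OF \<phi>], auto)
  define c where "c = (\<integral>x. \<theta> x *\<^sub>R h x \<partial>I01)"
  have "AE x in I01. h x - c = 0"
  proof (rule fundamental_lemma)
    show "integrable I01 (\<lambda>x. h x - c)" using h by auto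
    fix \<phi> :: "real \<Rightarrow> real" assume \<phi>: "\<phi> \<in> test_functions"
    define m where "m = (\<integral>x. \<phi> x \<partial>I01)"
    define \<psi> where "\<psi> = (\<lambda>x. \<phi> x - m *\<^sub>R \<theta> x)"
    have \<psi>: "\<psi> \<in> test_functions" unfolding \<psi>_def by (intro test_function_diff \<phi> test_function_const_scaleR \<theta>)
    have "(\<integral>x. \<psi> x \<partial>I01) = 0"
      unfolding \<psi>_def using integrable_test_function[OF \<phi>] integrable_test_function[OF \<theta>(1)] \<theta>(2)
      by (simp add: m_def)
    note * = test_function_antiderivative[OF \<psi> this]
    have "(\<integral>x. \<psi> x *\<^sub>R h x \<partial>I01) = 0"
      using 0[OF *(1)] vector_derivative_at[OF *(2)] by simp
    then have "(\<integral>x. \<phi> x *\<^sub>R h x \<partial>I01) = m *\<^sub>R c"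
      unfolding \<psi>_def c_def using int[OF \<phi> h] int[OF \<theta>(1) h]
      by (simp add: scaleR_diff_left flip: scaleR_scaleR)
    moreover have "(\<integral>x. \<phi> x *\<^sub>R c \<partial>I01) = m *\<^sub>R c"
      unfolding m_def by (rule integral_scaleR_left) (rule integrable_test_function[OF \<phi>])
    ultimately show "(\<integral>x. \<phi> x *\<^sub>R (h x - c) \<partial>I01) = 0"
      using int[OF \<phi> h] int[OF \<phi>, of "\<lambda>_. c"] by (simp add: scaleR_diff_right)
  qed
  then show thesis by (intro that[of c]) auto
qed

lemma integrable_I01_iff: "integrable I01 w \<longleftrightarrow> set_integrable lebesgue {0<..<1} w"
  for w :: "real \<Rightarrow> 'a::euclidean_space"
  unfolding set_integrable_def by (rule integrable_restrict_space) simp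

lemma locally_integrable_I01: "integrable I01 w \<Longrightarrow> locally_integrable w"
  unfolding locally_integrable_def integrable_I01_iff
  by (meson lmeasurable_compact fmeasurableD set_integrable_subset)

lemma integrable_test_times_locally_integrable:
  fixes \<phi> :: "real \<Rightarrow> real" and w :: "real \<Rightarrow> 'a::euclidean_space"
  assumes \<phi>: "\<phi> \<in> test_functions" and w: "locally_integrable w"
  shows "integrable I01 (\<lambda>x. \<phi> x *\<^sub>R w x)"
proof -
  obtain a b where ab: "0 < a" "b < 1" "\<And>x. x \<notin> {a..b} \<Longrightarrow> \<phi> x = 0"
    using \<phi> by (rule test_functionsE) blast
  obtain C where C: "\<And>x. norm (\<phi> x) \<le> C" by (rule test_function_bounded[OF \<phi>]) blast
  have "w absolutely_integrable_on {a..b}"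
  proof -
    have "compact {a..b} \<and> {a..b} \<subseteq> {0<..<1}" using ab(1,2) by auto
    then show ?thesis using w unfolding locally_integrable_def by blast
  qed
  then have i: "integrable lebesgue (\<lambda>x. indicator {a..b} x *\<^sub>R w x)" by (simp add: set_integrable_def)
  have m: "\<phi> \<in> borel_measurable lebesgue"
    using borel_measurable_continuous_onI[OF continuous_test_function[OF \<phi>]]
    by (intro measurable_completion) simp
  have "integrable lebesgue (\<lambda>x. \<phi> x *\<^sub>R (indicator {a..b} x *\<^sub>R w x))"
  proof (rule Bochner_Integration.integrable_bound)
    show "integrable lebesgue (\<lambda>x. C *\<^sub>R (indicator {a..b} x *\<^sub>R w x))"
      by (rule integrable_scaleR_right) (rule i)
    show "(\<lambda>x. \<phi> x *\<^sub>R (indicator {a..b} x *\<^sub>R w x)) \<in> borel_measurable lebesgue"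
      by (intro borel_measurable_scaleR[OF m] borel_measurable_integrable[OF i])
    show "AE x in lebesgue. norm (\<phi> x *\<^sub>R (indicator {a..b} x *\<^sub>R w x)) \<le> norm (C *\<^sub>R (indicator {a..b} x *\<^sub>R w x))"
      using C by (intro AE_I2) (auto intro!: mult_mono simp: indicator_def order_trans[OF _ abs_ge_self])
  qed
  moreover have "\<phi> x *\<^sub>R (indicator {a..b} x *\<^sub>R w x) = indicator {0<..<1} x *\<^sub>R (\<phi> x *\<^sub>R w x)" for x
    using ab(1,2) ab(3)[of x] by (auto simp: indicator_def)
  ultimately show ?thesis unfolding integrable_I01_iff set_integrable_def by (simp only:)
qed

lemma locally_integrable_diff:
  "locally_integrable v \<Longrightarrow> locally_integrable w \<Longrightarrow> locally_integrable (\<lambda>x. v x - w x)"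
  unfolding locally_integrable_def by (auto intro: set_integral_diff)

lemma has_weak_derivative_diff:
  assumes "has_weak_derivative u v" "has_weak_derivative u' v'"
  shows "has_weak_derivative (\<lambda>x. u x - u' x) (\<lambda>x. v x - v' x)"
  unfolding has_weak_derivative_def
proof (intro conjI allI impI)
  have li: "locally_integrable u" "locally_integrable v" "locally_integrable u'" "locally_integrable v'"
    using assms unfolding has_weak_derivative_def by auto
  then show "locally_integrable (\<lambda>x. u x - u' x)" "locally_integrable (\<lambda>x. v x - v' x)"
    by (auto intro: locally_integrable_diff)
  fix \<phi> :: "real \<Rightarrow> real" assume \<phi>: "\<phi> \<in> test_functions"
  note int = integrable_test_times_locally_integrable
  have "(\<integral>x. vector_derivative \<phi> (at x) *\<^sub>R u x \<partial>I01) = - (\<integral>x. \<phi> x *\<^sub>R v x \<partial>I01)"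
    "(\<integral>x. vector_derivative \<phi> (at x) *\<^sub>R u' x \<partial>I01) = - (\<integral>x. \<phi> x *\<^sub>R v' x \<partial>I01)"
    using assms \<phi> unfolding has_weak_derivative_def by auto
  then show "(\<integral>x. vector_derivative \<phi> (at x) *\<^sub>R (u x - u' x) \<partial>I01) = - (\<integral>x. \<phi> x *\<^sub>R (v x - v' x) \<partial>I01)"
    using int[OF \<phi> li(2)] int[OF \<phi> li(4)]
      int[OF test_function_derivative[OF \<phi>] li(1)] int[OF test_function_derivative[OF \<phi>] li(3)]
    by (simp add: scaleR_diff_right)
qed

text \<open>Weak derivatives are only locally integrable, so \<open>fundamental_lemma\<close> is
  applied to \<open>cutoff k\<close> times their difference for every k; the difference itself is
  recovered because \<open>cutoff k\<close> tends to 1.\<close>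

lemma has_weak_derivative_unique:
  fixes u :: "real \<Rightarrow> 'a::euclidean_space"
  assumes "has_weak_derivative u v" "has_weak_derivative u w"
  shows "AE x in I01. v x = w x"
proof -
  let ?d = "\<lambda>x. v x - w x"
  have li: "locally_integrable v" "locally_integrable w" "locally_integrable ?d"
    using assms unfolding has_weak_derivative_def by (auto intro: locally_integrable_diff)
  note int = integrable_test_times_locally_integrable
  have "AE x in I01. cutoff k x *\<^sub>R ?d x = 0" for k
  proof (rule fundamental_lemma)
    show "integrable I01 (\<lambda>x. cutoff k x *\<^sub>R ?d x)"
      by (intro int cutoff_test_function li)
    fix \<phi> :: "real \<Rightarrow> real" assume \<phi>: "\<phi> \<in> test_functions"
    define \<psi> where "\<psi> = (\<lambda>x. cutoff k x *\<^sub>R \<phi> x)"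
    have \<psi>: "\<psi> \<in> test_functions"
      unfolding \<psi>_def using \<phi> by (intro cutoff_scaleR_test_function) (simp add: test_functions_iff)
    have "(\<integral>x. \<psi> x *\<^sub>R v x \<partial>I01) = (\<integral>x. \<psi> x *\<^sub>R w x \<partial>I01)"
    proof -
      have "(\<integral>x. vector_derivative \<psi> (at x) *\<^sub>R u x \<partial>I01) = - (\<integral>x. \<psi> x *\<^sub>R v x \<partial>I01)"
        using assms(1) \<psi> unfolding has_weak_derivative_def by blast
      moreover have "(\<integral>x. vector_derivative \<psi> (at x) *\<^sub>R u x \<partial>I01) = - (\<integral>x. \<psi> x *\<^sub>R w x \<partial>I01)"
        using assms(2) \<psi> unfolding has_weak_derivative_def by blast
      ultimately show ?thesis by simp
    qed
    then have "(\<integral>x. \<psi> x *\<^sub>R ?d x \<partial>I01) = 0"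
      unfolding scaleR_diff_right
      by (subst Bochner_Integration.integral_diff[OF int[OF \<psi> li(1)] int[OF \<psi> li(2)]]) simp
    then show "(\<integral>x. \<phi> x *\<^sub>R cutoff k x *\<^sub>R ?d x \<partial>I01) = 0"
      by (simp add: \<psi>_def mult.commute)
  qed
  then have "AE x in I01. \<forall>k. cutoff k x *\<^sub>R ?d x = 0" unfolding AE_all_countable by blast
  moreover have "AE x in I01. x \<in> {0<..<1}" by (rule AE_I2) simp
  ultimately show ?thesis
  proof eventually_elim
    case (elim x)
    have "(\<lambda>k. cutoff k x *\<^sub>R ?d x) \<longlonglongrightarrow> ?d x"
      using tendsto_scaleR[OF cutoff_tendsto tendsto_const[of "?d x"], of x] elim(2) by simp
    then show "v x = w x" using elim(1) by (simp add: LIMSEQ_const_iff)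
  qed
qed

lemma has_weak_derivative_prim:
  fixes w :: "real \<Rightarrow> 'a::euclidean_space"
  assumes w: "integrable I01 w"
  shows "has_weak_derivative (\<lambda>x. c + prim w x) w"
  unfolding has_weak_derivative_def
proof (intro conjI allI impI)
  note ip = integrable_prim_I01[OF w]
  show "locally_integrable w" by (rule locally_integrable_I01[OF w])
  show li: "locally_integrable (\<lambda>x. c + prim w x)" by (rule locally_integrable_I01) (use ip in simp)
  fix \<phi> :: "real \<Rightarrow> real" assume \<phi>: "\<phi> \<in> test_functions"
  let ?d = "\<lambda>x. vector_derivative \<phi> (at x)"
  have d: "?d \<in> test_functions" by (rule test_function_derivative[OF \<phi>])
  note id = integrable_test_function[OF d]
  have "(\<integral>y. prim ?d y *\<^sub>R w y \<partial>I01) + (\<integral>y. ?d y *\<^sub>R prim w y \<partial>I01) = (\<integral>y. ?d y \<partial>I01) *\<^sub>R (\<integral>y. w y \<partial>I01)"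
    by (rule prim_by_parts_total[OF bounded_bilinear_scaleR id w])
  then have "(\<integral>y. ?d y *\<^sub>R prim w y \<partial>I01) = - (\<integral>y. \<phi> y *\<^sub>R w y \<partial>I01)"
    unfolding prim_test_function_derivative[OF \<phi>] by (simp add: eq_neg_iff_add_eq_0 add.commute)
  moreover have "(\<integral>y. ?d y *\<^sub>R c \<partial>I01) = 0"
    using integral_scaleR_left[OF id, of c] prim_test_function_derivative(2)[OF \<phi>] by simp
  moreover have "integrable I01 (\<lambda>y. ?d y *\<^sub>R prim w y)"
    by (rule integrable_test_times_locally_integrable[OF d locally_integrable_I01[OF ip]])
  ultimately show "(\<integral>x. ?d x *\<^sub>R (c + prim w x) \<partial>I01) = - (\<integral>x. \<phi> x *\<^sub>R w x \<partial>I01)"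
    using id by (simp add: scaleR_add_right)
qed

text \<open>The difference between u and the primitive of w has weak derivative 0, hence is constant
  by \<open>du_Bois_Reymond\<close>.\<close>

lemma has_weak_derivative_imp_prim:
  fixes u :: "real \<Rightarrow> 'a::euclidean_space"
  assumes u: "integrable I01 u" and w: "integrable I01 w" and h: "has_weak_derivative u w"
  obtains c where "AE x in I01. u x = c + prim w x"
proof -
  note ip = integrable_prim_I01[OF w]
  obtain c where "AE x in I01. u x - (0 + prim w x) = c"
  proof (rule du_Bois_Reymond)
    show "integrable I01 (\<lambda>x. u x - (0 + prim w x))" using u ip by simp
    fix \<phi> :: "real \<Rightarrow> real" assume \<phi>: "\<phi> \<in> test_functions"
    have "has_weak_derivative (\<lambda>x. u x - (0 + prim w x)) (\<lambda>x. w x - w x)"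
      by (rule has_weak_derivative_diff[OF h has_weak_derivative_prim[OF w]])
    then show "(\<integral>x. vector_derivative \<phi> (at x) *\<^sub>R (u x - (0 + prim w x)) \<partial>I01) = 0"
      using \<phi> unfolding has_weak_derivative_def by simp
  qed
  then show thesis by (intro that[of c]) (auto elim!: eventually_mono simp: algebra_simps)
qed

section \<open>Sobolev spaces\<close>

lemma L2_I01_integrable:
  fixes u :: "real \<Rightarrow> 'a::euclidean_space"
  assumes "u \<in> L2 I01"
  shows "integrable I01 u"
proof (rule Bochner_Integration.integrable_bound)
  show "integrable I01 (\<lambda>x. (norm (u x))\<^sup>2 + 1)" using assms by (simp add: L2_def)
  show "u \<in> borel_measurable I01" using assms by (simp add: L2_def)
  have "t \<le> t\<^sup>2 + 1" for t :: real using zero_le_power2[of "t - 1/2"] by (simp add: power2_eq_square algebra_simps)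
  then show "AE x in I01. norm (u x) \<le> norm ((norm (u x))\<^sup>2 + 1)" by (intro AE_I2) simp
qed

lemma L2_I01_diff:
  fixes u v :: "real \<Rightarrow> 'a::euclidean_space"
  assumes "u \<in> L2 I01" "v \<in> L2 I01"
  shows "(\<lambda>x. u x - v x) \<in> L2 I01"
proof -
  have m: "(\<lambda>x. u x - v x) \<in> borel_measurable I01" using assms by (auto simp: L2_def)
  have "integrable I01 (\<lambda>x. (norm (u x - v x))\<^sup>2)"
  proof (rule Bochner_Integration.integrable_bound)
    show "integrable I01 (\<lambda>x. 2 * (norm (u x))\<^sup>2 + 2 * (norm (v x))\<^sup>2)" using assms by (simp add: L2_def)
    show "(\<lambda>x. (norm (u x - v x))\<^sup>2) \<in> borel_measurable I01" using m by simp
    have "(norm (a - b))\<^sup>2 \<le> 2 * (norm a)\<^sup>2 + 2 * (norm b)\<^sup>2" for a b :: 'a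
    proof -
      have "(norm (a - b))\<^sup>2 \<le> (norm a + norm b)\<^sup>2" by (intro power_mono norm_triangle_ineq4) simp
      also have "\<dots> \<le> 2 * (norm a)\<^sup>2 + 2 * (norm b)\<^sup>2"
        using zero_le_power2[of "norm a - norm b"] by (simp add: power2_eq_square algebra_simps)
      finally show ?thesis .
    qed
    then show "AE x in I01. norm ((norm (u x - v x))\<^sup>2) \<le> norm (2 * (norm (u x))\<^sup>2 + 2 * (norm (v x))\<^sup>2)"
      by (intro AE_I2) simp
  qed
  then show ?thesis using m by (simp add: L2_def)
qed

lemma L2_I01_bounded:
  fixes u :: "real \<Rightarrow> 'a::euclidean_space"
  assumes "u \<in> borel_measurable I01" "AE x in I01. norm (u x) \<le> C"
  shows "u \<in> L2 I01"
proof -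
  have "AE x in I01. norm ((norm (u x))\<^sup>2) \<le> C\<^sup>2"
    using assms(2) by eventually_elim (simp add: power_mono)
  then have "integrable I01 (\<lambda>x. (norm (u x))\<^sup>2)"
    using assms(1) by (intro integrable_bounded_I01) auto
  then show ?thesis using assms by (simp add: L2_def)
qed

lemma L2_I01_cong_AE:
  fixes u v :: "real \<Rightarrow> 'a::euclidean_space"
  assumes "u \<in> L2 I01" "AE x in I01. u x = v x"
  shows "v \<in> L2 I01"
proof -
  have m: "v \<in> borel_measurable I01" "u \<in> borel_measurable I01"
    using assms measurable_I01_AE[of u v] by (auto simp: L2_def)
  have "integrable I01 (\<lambda>x. (norm (v x))\<^sup>2) \<longleftrightarrow> integrable I01 (\<lambda>x. (norm (u x))\<^sup>2)"
    using m assms(2) by (intro integrable_cong_AE) (auto elim!: eventually_mono)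
  then show ?thesis using assms(1) m by (simp add: L2_def)
qed

text \<open>Cauchy-Schwarz on an interval of length 1, obtained from the pointwise inequality t
  \<le> t^2 / (2 e) + e / 2.\<close>

lemma integral_norm_le_L2:
  fixes u :: "real \<Rightarrow> 'a::euclidean_space"
  assumes u: "u \<in> L2 I01" and e: "e > 0" "(\<integral>x. (norm (u x))\<^sup>2 \<partial>I01) \<le> e\<^sup>2"
  shows "(\<integral>x. norm (u x) \<partial>I01) \<le> e"
proof -
  have i: "integrable I01 (\<lambda>x. (norm (u x))\<^sup>2)" using u by (simp add: L2_def)
  have "t \<le> t\<^sup>2 / (2 * e) + e / 2" for t
  proof -
    have "0 \<le> (t - e)\<^sup>2 / (2 * e)" using e by simp
    also have "(t - e)\<^sup>2 / (2 * e) = t\<^sup>2 / (2 * e) + e / 2 - t"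
      using e by (simp add: power2_eq_square field_simps)
    finally show ?thesis by simp
  qed
  then have "(\<integral>x. norm (u x) \<partial>I01) \<le> (\<integral>x. (norm (u x))\<^sup>2 / (2 * e) + e / 2 \<partial>I01)"
    using i L2_I01_integrable[OF u] by (intro integral_mono) auto
  also have "\<dots> = (\<integral>x. (norm (u x))\<^sup>2 \<partial>I01) / (2 * e) + e / 2"
    using i by simp
  also have "\<dots> \<le> e\<^sup>2 / (2 * e) + e / 2" using e by (intro add_right_mono divide_right_mono) auto
  also have "\<dots> = e" using e by (simp add: power2_eq_square)
  finally show ?thesis .
qed

lemma weak_derivative_AE:
  assumes "has_weak_derivative u w"
  shows "has_weak_derivative u (weak_derivative u)" "AE x in I01. weak_derivative u x = w x"
proof -
  show "has_weak_derivative u (weak_derivative u)"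
    unfolding weak_derivative_def using someI[of "has_weak_derivative u", OF assms] by simp
  then show "AE x in I01. weak_derivative u x = w x" by (rule has_weak_derivative_unique[OF _ assms])
qed

lemma W12_norm_eq:
  fixes u :: "real \<Rightarrow> 'a::euclidean_space"
  assumes w: "w \<in> L2 I01" and h: "has_weak_derivative u w"
  shows "W12_norm u = sqrt ((\<integral>x. (norm (u x))\<^sup>2 \<partial>I01) + (\<integral>x. (norm (w x))\<^sup>2 \<partial>I01))"
proof -
  have "AE x in I01. weak_derivative u x = w x" by (rule weak_derivative_AE[OF h])
  moreover have "weak_derivative u \<in> L2 I01"
    using calculation by (intro L2_I01_cong_AE[OF w]) (auto elim!: eventually_mono)
  ultimately have "(\<integral>x. (norm (weak_derivative u x))\<^sup>2 \<partial>I01) = (\<integral>x. (norm (w x))\<^sup>2 \<partial>I01)"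
    using w by (intro integral_cong_AE) (auto simp: L2_def elim!: eventually_mono)
  then show ?thesis by (simp add: W12_norm_def)
qed

lemma test_function_L2: "\<phi> \<in> test_functions \<Longrightarrow> \<phi> \<in> L2 I01"
  by (metis test_function_bounded L2_I01_bounded measurable_test_function AE_I2)

lemma has_weak_derivative_test_function:
  assumes "\<phi> \<in> test_functions"
  shows "has_weak_derivative \<phi> (\<lambda>x. vector_derivative \<phi> (at x))"
  using has_weak_derivative_prim[OF integrable_test_function[OF test_function_derivative[OF assms]], of 0]
  unfolding prim_test_function_derivative(1)[OF assms] add_0 .

text \<open>Gives the boundary conditions a usable form: the absence of a constant in front of the
  primitive means u(0) = 0, and the vanishing mean of the derivative then means u(1) = 0. Both are
  inherited from the approximating test functions.\<close>

lemma W12_0_D: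
  fixes u :: "real \<Rightarrow> 'a::euclidean_space"
  assumes "u \<in> W12_0"
  shows "u \<in> L2 I01" "weak_derivative u \<in> L2 I01" "(\<integral>x. weak_derivative u x \<partial>I01) = 0"
    "AE x in I01. u x = prim (weak_derivative u) x"
proof -
  let ?w = "weak_derivative u"
  obtain w0 where w0: "w0 \<in> L2 I01" "has_weak_derivative u w0"
    using assms unfolding W12_0_def W12_def by blast
  show u: "u \<in> L2 I01" using assms unfolding W12_0_def W12_def by blast
  note h = weak_derivative_AE(1)[OF w0(2)]
  show w: "?w \<in> L2 I01"
    using weak_derivative_AE(2)[OF w0(2)] by (intro L2_I01_cong_AE[OF w0(1)]) (auto elim!: eventually_mono)
  note ui = L2_I01_integrable[OF u] and wi = L2_I01_integrable[OF w]
  obtain c where c: "AE x in I01. u x = c + prim ?w x"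
    by (rule has_weak_derivative_imp_prim[OF ui wi h])
  \<comment> \<open>The approximating test function is the primitive of its own derivative, so c is
    the difference of two small quantities; averaging this pointwise bound over the interval leaves
    only L^1 distances.\<close>
  have key: "norm (\<integral>x. ?w x \<partial>I01) \<le> e \<and> norm c \<le> e + e" if e: "e > 0" for e
  proof -
    obtain \<phi> where \<phi>: "\<phi> \<in> test_functions" and n: "W12_norm (\<lambda>x. u x - \<phi> x) < e"
      using assms e unfolding W12_0_def by blast
    let ?d = "\<lambda>x. vector_derivative \<phi> (at x)"
    have d: "?d \<in> test_functions" by (rule test_function_derivative[OF \<phi>])
    have L: "(\<lambda>x. u x - \<phi> x) \<in> L2 I01" "(\<lambda>x. ?w x - ?d x) \<in> L2 I01"
      using u w test_function_L2[OF \<phi>] test_function_L2[OF d] by (auto intro: L2_I01_diff)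
    have "has_weak_derivative (\<lambda>x. u x - \<phi> x) (\<lambda>x. ?w x - ?d x)"
      by (rule has_weak_derivative_diff[OF h has_weak_derivative_test_function[OF \<phi>]])
    then have "sqrt ((\<integral>x. (norm (u x - \<phi> x))\<^sup>2 \<partial>I01) + (\<integral>x. (norm (?w x - ?d x))\<^sup>2 \<partial>I01)) < e"
      using W12_norm_eq[OF L(2)] n by simp
    then have "(\<integral>x. (norm (u x - \<phi> x))\<^sup>2 \<partial>I01) + (\<integral>x. (norm (?w x - ?d x))\<^sup>2 \<partial>I01) < e\<^sup>2"
      using real_le_rsqrt[of e] by (meson not_le)
    moreover have "0 \<le> (\<integral>x. (norm (u x - \<phi> x))\<^sup>2 \<partial>I01)" "0 \<le> (\<integral>x. (norm (?w x - ?d x))\<^sup>2 \<partial>I01)" by auto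
    ultimately have "(\<integral>x. (norm (u x - \<phi> x))\<^sup>2 \<partial>I01) \<le> e\<^sup>2" "(\<integral>x. (norm (?w x - ?d x))\<^sup>2 \<partial>I01) \<le> e\<^sup>2" by linarith+
    then have le: "(\<integral>x. norm (u x - \<phi> x) \<partial>I01) \<le> e" "(\<integral>x. norm (?w x - ?d x) \<partial>I01) \<le> e"
      using integral_norm_le_L2 L e by blast+
    note di = integrable_test_function[OF d] and fi = integrable_test_function[OF \<phi>]
    have wdi: "integrable I01 (\<lambda>x. ?w x - ?d x)" using wi di by simp
    have "(\<integral>x. ?w x - ?d x \<partial>I01) = (\<integral>x. ?w x \<partial>I01)"
      using wi di prim_test_function_derivative(2)[OF \<phi>] by simp
    then have 1: "norm (\<integral>x. ?w x \<partial>I01) \<le> e"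
      using integral_norm_bound[of I01 "\<lambda>x. ?w x - ?d x"] le(2) by simp
    have "AE x in I01. norm c \<le> norm (u x - \<phi> x) + e"
      using c
    proof eventually_elim
      case (elim x)
      have "prim (\<lambda>x. ?w x - ?d x) x = prim ?w x - \<phi> x"
        using prim_diff[OF wi di] prim_test_function_derivative(1)[OF \<phi>] by simp
      then have "c = (u x - \<phi> x) - prim (\<lambda>x. ?w x - ?d x) x" using elim by simp
      then have "norm c \<le> norm (u x - \<phi> x) + norm (prim (\<lambda>x. ?w x - ?d x) x)" by (metis norm_triangle_ineq4)
      then show ?case using norm_prim_le_integral[OF wdi, of x] le(2) by simp
    qed
    then have "(\<integral>x. norm c \<partial>I01) \<le> (\<integral>x. norm (u x - \<phi> x) + e \<partial>I01)"
      using ui fi by (intro integral_mono_AE) auto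
    also have "\<dots> = (\<integral>x. norm (u x - \<phi> x) \<partial>I01) + e" using ui fi by simp
    finally show ?thesis using 1 le by simp
  qed
  show "(\<integral>x. ?w x \<partial>I01) = 0"
  proof -
    have "norm (\<integral>x. ?w x \<partial>I01) \<le> 0"
      by (rule field_le_epsilon) (use key in auto)
    then show ?thesis by simp
  qed
  have "norm c \<le> 0"
  proof (rule field_le_epsilon)
    fix e :: real assume "e > 0"
    then show "norm c \<le> 0 + e" using key[of "e/2"] by simp
  qed
  then show "AE x in I01. u x = prim ?w x" using c by simp
qed

text \<open>A converse for bounded slopes, which is what shooting produces: w is approximated by
  test functions of mean zero, whose primitives are then test functions close to
  \<open>prim w\<close>.\<close>

lemma prim_in_W12_0:
  fixes w :: "real \<Rightarrow> 'a::euclidean_space"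
  assumes m: "w \<in> borel_measurable I01" and C: "AE x in I01. norm (w x) \<le> C" and mean: "(\<integral>x. w x \<partial>I01) = 0"
  shows "prim w \<in> W12_0" "AE x in I01. weak_derivative (prim w) x = w x"
proof -
  have "AE x in I01. norm (w x) \<le> max C 0" using C by eventually_elim auto
  then obtain \<phi> where \<phi>: "\<And>k::nat. \<phi> k \<in> test_functions" "\<And>k x. norm (\<phi> k x) \<le> max C 0 + 1"
    "AE x in I01. (\<lambda>k. \<phi> k x) \<longlonglongrightarrow> w x"
    using test_functions_dense[OF m, of "max C 0"] by auto
  note [measurable] = measurable_test_function[OF \<phi>(1)] m
  have i: "integrable I01 w" by (rule integrable_bounded_I01[OF m C])
  have h: "has_weak_derivative (prim w) w" using has_weak_derivative_prim[OF i, of 0] by simp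
  show "AE x in I01. weak_derivative (prim w) x = w x" by (rule weak_derivative_AE[OF h])
  obtain \<theta> :: "real \<Rightarrow> real" where \<theta>: "\<theta> \<in> test_functions" "(\<integral>x. \<theta> x \<partial>I01) = 1" by (rule unit_test_function)
  obtain D where D: "0 \<le> D" "\<And>x. norm (\<theta> x) \<le> D" by (rule test_function_bounded[OF \<theta>(1)]) blast
  define m where "m = (\<lambda>k. \<integral>x. \<phi> k x \<partial>I01)"
  have m0: "m \<longlonglongrightarrow> 0"
    unfolding m_def mean[symmetric]
    by (rule integral_dominated_convergence[where w="\<lambda>_. max C 0 + 1"]) (use \<phi> in auto)
  have mat_bdd: "norm (m k) \<le> max C 0 + 1" for k
    unfolding m_def
    using norm_prim_le_const[of "\<phi> k" "max C 0 + 1" 1] prim_ge_1[of 1 "\<phi> k"] \<phi>(2) by auto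
  \<comment> \<open>Subtracting a bump of integral 1 times the mean m k restores mean zero; the
    limit is not disturbed because m k tends to 0.\<close>
  define \<psi> where "\<psi> = (\<lambda>k x. \<phi> k x - \<theta> x *\<^sub>R m k)"
  have \<psi>: "\<psi> k \<in> test_functions" for k
    unfolding \<psi>_def by (intro test_function_diff \<phi> test_function_scaleR_const \<theta>)
  note [measurable] = measurable_test_function[OF \<psi>]
  have mean\<psi>: "(\<integral>x. \<psi> k x \<partial>I01) = 0" for k
    unfolding \<psi>_def m_def
    using integrable_test_function[OF \<phi>(1)] integrable_test_function[OF \<theta>(1)] \<theta>(2)
    by simp
  define b where "b = (max C 0 + 1) + D * (max C 0 + 1) + max C 0"
  have bd: "AE x in I01. norm (w x - \<psi> k x) \<le> b" for k
    using C
  proof eventually_elim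
    case (elim x)
    have "norm (\<psi> k x) \<le> norm (\<phi> k x) + norm (\<theta> x *\<^sub>R m k)" unfolding \<psi>_def by (rule norm_triangle_ineq4)
    moreover have "norm (\<theta> x *\<^sub>R m k) \<le> D * (max C 0 + 1)"
      using D mat_bdd by (simp) (intro mult_mono, auto)
    moreover have "norm (w x - \<psi> k x) \<le> norm (w x) + norm (\<psi> k x)" by (rule norm_triangle_ineq4)
    ultimately show ?case using elim \<phi>(2)[of k x] unfolding b_def by linarith
  qed
  have lim: "AE x in I01. (\<lambda>k. norm (w x - \<psi> k x)) \<longlonglongrightarrow> 0"
    using \<phi>(3)
  proof eventually_elim
    case (elim x)
    have "(\<lambda>k. norm (w x - (\<phi> k x - \<theta> x *\<^sub>R m k))) \<longlonglongrightarrow> norm (w x - (w x - \<theta> x *\<^sub>R 0))"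
      by (intro tendsto_intros elim m0)
    then show ?case by (simp add: \<psi>_def)
  qed
  define d where "d = (\<lambda>k. \<integral>x. norm (w x - \<psi> k x) \<partial>I01)"
  define E where "E = (\<lambda>k. \<integral>x. (norm (w x - \<psi> k x))\<^sup>2 \<partial>I01)"
  have d0: "d \<longlonglongrightarrow> 0"
  proof -
    have "d \<longlonglongrightarrow> (\<integral>x. 0 \<partial>I01)" unfolding d_def
      by (rule integral_dominated_convergence[where w="\<lambda>_. b"]) (use lim bd in auto)
    then show ?thesis by simp
  qed
  have E0: "E \<longlonglongrightarrow> 0"
  proof -
    have "E \<longlonglongrightarrow> (\<integral>x. 0 \<partial>I01)" unfolding E_def
    proof (rule integral_dominated_convergence[where w="\<lambda>_. b\<^sup>2"])
      show "AE x in I01. (\<lambda>k. (norm (w x - \<psi> k x))\<^sup>2) \<longlonglongrightarrow> 0"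
        using lim by eventually_elim (rule tendsto_null_power, auto)
      show "AE x in I01. norm ((norm (w x - \<psi> k x))\<^sup>2) \<le> b\<^sup>2" for k
        using bd[of k] by eventually_elim (simp add: power_mono)
    qed auto
    then show ?thesis by simp
  qed
  have mw: "w \<in> L2 I01" "prim w \<in> L2 I01"
    using L2_I01_bounded[OF m C] L2_I01_bounded[OF measurable_prim[OF i], of "\<integral>y. norm (w y) \<partial>I01"]
      norm_prim_le_integral[OF i] by auto
  \<comment> \<open>The L^2 distance of the primitives is at most their sup distance, hence at most
    the L^1 distance d k of the slopes.\<close>
  have norm_le: "W12_norm (\<lambda>x. prim w x - prim (\<psi> k) x) \<le> sqrt ((d k)\<^sup>2 + E k)" for k
  proof -
    note ik = integrable_test_function[OF \<psi>, of k]
    have ii: "integrable I01 (\<lambda>x. w x - \<psi> k x)" using i ik by simp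
    have "has_weak_derivative (\<lambda>x. (0 + prim w x) - (0 + prim (\<psi> k) x)) (\<lambda>x. w x - \<psi> k x)"
      by (intro has_weak_derivative_diff has_weak_derivative_prim i ik)
    then have hh: "has_weak_derivative (\<lambda>x. prim w x - prim (\<psi> k) x) (\<lambda>x. w x - \<psi> k x)" by simp
    have le: "norm (prim w x - prim (\<psi> k) x) \<le> d k" for x
      using norm_prim_le_integral[OF ii, of x] prim_diff[OF i ik] by (simp add: d_def)
    have "(\<lambda>x. prim w x - prim (\<psi> k) x) \<in> L2 I01"
      by (intro L2_I01_diff mw test_function_L2 test_function_antiderivative(1)[OF \<psi> mean\<psi>])
    then have "(\<integral>x. (norm (prim w x - prim (\<psi> k) x))\<^sup>2 \<partial>I01) \<le> (\<integral>x. (d k)\<^sup>2 \<partial>I01)"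
      using le by (intro integral_mono) (auto simp: L2_def intro: power_mono)
    then have "(\<integral>x. (norm (prim w x - prim (\<psi> k) x))\<^sup>2 \<partial>I01) \<le> (d k)\<^sup>2" by simp
    then show ?thesis
      using W12_norm_eq[OF L2_I01_diff[OF mw(1) test_function_L2[OF \<psi>]] hh] by (simp add: E_def)
  qed
  have "(\<lambda>k. sqrt ((d k)\<^sup>2 + E k)) \<longlonglongrightarrow> sqrt (0\<^sup>2 + 0)" by (intro tendsto_intros d0 E0)
  then have s0: "(\<lambda>k. sqrt ((d k)\<^sup>2 + E k)) \<longlonglongrightarrow> 0" by simp
  have "\<exists>\<phi>\<in>test_functions. W12_norm (\<lambda>x. prim w x - \<phi> x) < e" if e: "e > 0" for e
  proof -
    obtain k where "sqrt ((d k)\<^sup>2 + E k) < e"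
      using eventually_happens'[OF sequentially_bot order_tendstoD(2)[OF s0 e]] by blast
    then show ?thesis
      using norm_le[of k] test_function_antiderivative(1)[OF \<psi> mean\<psi>, of k]
      by (intro bexI[of _ "prim (\<psi> k)"]) auto
  qed
  moreover have "prim w \<in> W12" unfolding W12_def using mw h by blast
  ultimately show "prim w \<in> W12_0" unfolding W12_0_def by blast
qed

lemma test_function_W12_0:
  assumes "\<phi> \<in> test_functions"
  shows "\<phi> \<in> W12_0" "AE x in I01. weak_derivative \<phi> x = vector_derivative \<phi> (at x)"
proof -
  let ?d = "\<lambda>x. vector_derivative \<phi> (at x)"
  have d: "?d \<in> test_functions" by (rule test_function_derivative[OF assms])
  obtain C where C: "\<And>x. norm (?d x) \<le> C" by (rule test_function_bounded[OF d]) blast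
  have e: "prim ?d = \<phi>" by (rule ext) (rule prim_test_function_derivative[OF assms])
  show "\<phi> \<in> W12_0" "AE x in I01. weak_derivative \<phi> x = ?d x"
    using prim_in_W12_0[OF measurable_test_function[OF d] _ prim_test_function_derivative(2)[OF assms], of C]
      C unfolding e by auto
qed

section \<open>Essential bounds and functions with bounded weak derivative\<close>

lemma Linf_norm_le_iff:
  assumes "u \<in> borel_measurable \<mu>" "C \<ge> 0"
  shows "Linf_norm \<mu> u \<le> ennreal C \<longleftrightarrow> (AE x in \<mu>. norm (u x) \<le> C)"
proof
  assume "Linf_norm \<mu> u \<le> ennreal C"
  then have *: "esssup \<mu> (\<lambda>x. ennreal (norm (u x))) \<le> ennreal C" by (simp add: Linf_norm_def)
  have "AE x in \<mu>. ennreal (norm (u x)) \<le> esssup \<mu> (\<lambda>x. ennreal (norm (u x)))" by (rule esssup_AE)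
  then show "AE x in \<mu>. norm (u x) \<le> C"
    by eventually_elim (use * assms(2) ennreal_le_iff order_trans in blast)
next
  assume "AE x in \<mu>. norm (u x) \<le> C"
  then show "Linf_norm \<mu> u \<le> ennreal C"
    unfolding Linf_norm_def using assms by (intro esssup_I) (auto elim!: eventually_mono)
qed

lemma LinfE:
  assumes "u \<in> Linf \<mu>"
  obtains C where "C \<ge> 0" "u \<in> borel_measurable \<mu>" "AE x in \<mu>. norm (u x) \<le> C"
proof -
  obtain C where "C \<ge> 0" "Linf_norm \<mu> u = ennreal C"
    using assms unfolding Linf_def by (cases "Linf_norm \<mu> u") auto
  then show thesis using that Linf_norm_le_iff[of u \<mu> C] assms unfolding Linf_def by auto
qed

lemma W1infE:
  assumes "f \<in> W1inf"
  obtains c w C where "w \<in> borel_measurable I01" "AE x in I01. norm (w x) \<le> C" "C \<ge> 0"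
    "AE x in I01. f x = c + prim w x"
proof -
  obtain w where f: "f \<in> Linf I01" and w: "w \<in> Linf I01" "has_weak_derivative f w"
    using assms unfolding W1inf_def by blast
  obtain D where "f \<in> borel_measurable I01" "AE x in I01. norm (f x) \<le> D" using f by (rule LinfE)
  note fi = integrable_bounded_I01[OF this]
  obtain C where C: "C \<ge> 0" "w \<in> borel_measurable I01" "AE x in I01. norm (w x) \<le> C" using w(1) by (rule LinfE)
  obtain c where "AE x in I01. f x = c + prim w x"
    by (rule has_weak_derivative_imp_prim[OF fi integrable_bounded_I01[OF C(2,3)] w(2)])
  with C show thesis by (intro that[of w C c]) auto
qed

section \<open>Matrices\<close>

lemma bounded_bilinear_matrix_vector_mult:
  "bounded_bilinear ((*v) :: real^'n^'n \<Rightarrow> real^'n \<Rightarrow> real^'n)"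
  unfolding bilinear_conv_bounded_bilinear[symmetric] bilinear_def
  by (intro conjI allI linearI)
    (simp_all add: matrix_vector_right_distrib matrix_vector_mult_add_rdistrib
      matrix_vector_mult_scaleR flip: scaleR_matrix_vector_assoc)

text \<open>Passes from an operator bound to the Frobenius norm that \<open>norm\<close> denotes on
  matrices: each entry is at most r. The factor is crude but depends on the dimension only.\<close>

lemma norm_matrix_le_bound:
  fixes M :: "real^'n^'n"
  assumes "\<And>v. norm (M *v v) \<le> r * norm v"
  shows "norm M \<le> (real CARD('n))\<^sup>2 * r"
proof -
  have r: "onorm ((*v) M) \<le> r" by (rule onorm_le) (rule assms)
  have "norm M \<le> (\<Sum>i\<in>UNIV. norm (M $ i))" by (simp add: norm_vec_def L2_set_le_sum)
  also have "\<dots> \<le> (\<Sum>i\<in>UNIV. \<Sum>j\<in>UNIV. \<bar>M $ i $ j\<bar>)"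
    by (intro sum_mono norm_le_l1_cart)
  also have "\<dots> \<le> (\<Sum>i\<in>(UNIV::'n set). \<Sum>j\<in>(UNIV::'n set). r)"
  proof -
    have "\<bar>M $ i $ j\<bar> \<le> r" for i j
      using matrix_component_le_onorm[of M i j] r by linarith
    then show ?thesis by (intro sum_mono)
  qed
  finally show ?thesis by (simp add: power2_eq_square)
qed

lemma matrix_bound_norm:
  fixes M :: "real^'n^'n"
  shows "norm (M *v v) \<le> norm M * real CARD('n) * norm v"
proof -
  have "norm (M *v v) \<le> (\<Sum>i\<in>UNIV. \<bar>(M *v v) $ i\<bar>)" by (rule norm_le_l1_cart)
  also have "\<dots> \<le> (\<Sum>i\<in>(UNIV::'n set). norm M * norm v)"
  proof (rule sum_mono)
    fix i
    have "\<bar>(M *v v) $ i\<bar> = \<bar>(M $ i) \<bullet> v\<bar>" by (simp add: matrix_mult_dot)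
    also have "\<dots> \<le> norm (M $ i) * norm v" by (rule Cauchy_Schwarz_ineq2)
    also have "\<dots> \<le> norm M * norm v"
      by (intro mult_right_mono Finite_Cartesian_Product.norm_nth_le) simp
    finally show "\<bar>(M *v v) $ i\<bar> \<le> norm M * norm v" .
  qed
  finally show ?thesis by (simp add: mult_ac)
qed

text \<open>Coercivity and Cauchy-Schwarz give |M v| \<ge> m |v|. This yields injectivity, hence
  invertibility of the square matrix, and also the bound 1 / m for the inverse.\<close>

lemma elliptic_invertible:
  fixes M :: "real^'n^'n"
  assumes m: "m > 0" and ell: "\<And>v. (M *v v) \<bullet> v \<ge> m * (norm v)\<^sup>2"
  shows "M *v (matrix_inv M *v w) = w" "matrix_inv M *v (M *v w) = w"
    "norm (matrix_inv M *v w) \<le> norm w / m" "invertible M" "det M \<noteq> 0"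
proof -
  have lower: "m * norm v \<le> norm (M *v v)" for v
  proof (cases "v = 0")
    case False
    have "m * (norm v)\<^sup>2 \<le> norm (M *v v) * norm v"
      using ell[of v] norm_cauchy_schwarz order_trans by blast
    then show ?thesis using False by (simp add: power2_eq_square mult.assoc[symmetric])
  qed simp
  have "inj ((*v) M)"
  proof (rule injI)
    fix x y assume "M *v x = M *v y"
    then have "M *v (x - y) = 0" by (simp add: matrix_vector_mult_diff_distrib)
    then have "m * norm (x - y) \<le> 0" using lower[of "x - y"] by simp
    then show "x = y" using m by (simp add: mult_le_0_iff)
  qed
  then show inv: "invertible M"
    using matrix_left_invertible_injective[of M] invertible_left_inverse[of M] by auto
  then show "det M \<noteq> 0" by (simp add: invertible_det_nz)
  have "\<exists>B. M ** B = mat 1 \<and> B ** M = mat 1" using inv by (auto simp: invertible_def)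
  then have i: "M ** matrix_inv M = mat 1" "matrix_inv M ** M = mat 1"
    unfolding matrix_inv_def by (metis (mono_tags, lifting) someI_ex)+
  show 1: "M *v (matrix_inv M *v w) = w" "matrix_inv M *v (M *v w) = w"
    by (simp_all add: matrix_vector_mul_assoc i)
  show "norm (matrix_inv M *v w) \<le> norm w / m"
    using lower[of "matrix_inv M *v w"] m by (simp add: 1 pos_le_divide_eq mult.commute)
qed

section \<open>Measurability of the matrix inverse\<close>

lemma measurable_matrix_component:
  fixes M :: "'a \<Rightarrow> real^'n^'n"
  assumes "M \<in> borel_measurable \<mu>"
  shows "(\<lambda>x. M x $ i $ j) \<in> borel_measurable \<mu>"
proof -
  have "(\<lambda>x. M x \<bullet> axis i (axis j 1)) \<in> borel_measurable \<mu>" using assms by simp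
  then show ?thesis by (simp add: inner_axis)
qed

lemma measurable_matrixI:
  fixes M :: "'a \<Rightarrow> real^'n^'n"
  assumes "\<And>i j. (\<lambda>x. M x $ i $ j) \<in> borel_measurable \<mu>"
  shows "M \<in> borel_measurable \<mu>"
proof (subst borel_measurable_euclidean_space, rule ballI)
  fix b :: "real^'n^'n" assume "b \<in> Basis"
  then obtain i j where b: "b = axis i (axis j 1)" by (auto simp: Basis_vec_def)
  show "(\<lambda>x. M x \<bullet> b) \<in> borel_measurable \<mu>" using assms[of i j] by (simp add: b inner_axis)
qed

lemma measurable_det:
  fixes M :: "'a \<Rightarrow> real^'n^'n"
  assumes "\<And>i j. (\<lambda>x. M x $ i $ j) \<in> borel_measurable \<mu>"
  shows "(\<lambda>x. det (M x)) \<in> borel_measurable \<mu>"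
  unfolding det_def
  by (intro borel_measurable_sum borel_measurable_times borel_measurable_prod borel_measurable_const assms)

text \<open>\<open>matrix_inv\<close> is defined by choice, which says nothing about its values on
  singular matrices. Cramer's formula agrees with it on invertible matrices and is measurable
  throughout, being a quotient of determinants.\<close>

definition cramer_inverse :: "real^'n^'n \<Rightarrow> real^'n^'n"
  where "cramer_inverse M = (\<chi> k l. det (\<chi> i j. if j = k then axis l 1 $ i else M $ i $ j) / det M)"

lemma cramer_inverse_eq:
  assumes "invertible M"
  shows "cramer_inverse M = matrix_inv M"
proof -
  have "\<exists>B. M ** B = mat 1 \<and> B ** M = mat 1" using assms by (auto simp: invertible_def)
  then have i: "M ** matrix_inv M = mat 1"
    unfolding matrix_inv_def by (metis (mono_tags, lifting) someI_ex)
  have d: "det M \<noteq> 0" using assms by (simp add: invertible_det_nz)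
  have "matrix_inv M $ k $ l = cramer_inverse M $ k $ l" for k l
  proof -
    have "M *v (matrix_inv M *v axis l 1) = axis l 1" by (simp add: matrix_vector_mul_assoc i)
    then have "matrix_inv M *v axis l 1 = (\<chi> k. det (\<chi> i j. if j = k then axis l 1 $ i else M $ i $ j) / det M)"
      using cramer[OF d] by blast
    then have "(matrix_inv M *v axis l 1) $ k = cramer_inverse M $ k $ l" by (simp add: cramer_inverse_def)
    then show ?thesis by (simp add: matrix_vector_mult_basis column_def)
  qed
  then show ?thesis by (simp add: vec_eq_iff)
qed

lemma measurable_cramer_inverse:
  fixes M :: "'a \<Rightarrow> real^'n^'n"
  assumes "M \<in> borel_measurable \<mu>"
  shows "(\<lambda>x. cramer_inverse (M x)) \<in> borel_measurable \<mu>"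
proof (rule measurable_matrixI)
  fix k l
  note c = measurable_matrix_component[OF assms]
  have "(\<lambda>x. det (\<chi> i j. if j = k then axis l 1 $ i else M x $ i $ j)) \<in> borel_measurable \<mu>"
  proof (rule measurable_det)
    fix i j
    show "(\<lambda>x. (\<chi> i j. if j = k then axis l 1 $ i else M x $ i $ j) $ i $ j) \<in> borel_measurable \<mu>"
      using c[of i j] by (cases "j = k") auto
  qed
  then show "(\<lambda>x. cramer_inverse (M x) $ k $ l) \<in> borel_measurable \<mu>"
    using measurable_det[OF c] by (simp add: cramer_inverse_def)
qed

section \<open>Weak solutions as solutions of an integral equation\<close>

text \<open>The interface through which a nonlinearity enters the passage between weak solutions and
  the integral equation; it is met by the given nonlinearities and by their linearizations
  alike.\<close>

definition bounded_Nemytskii :: "(real \<Rightarrow> real^'n \<Rightarrow> real^'n) \<Rightarrow> bool"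
  where "bounded_Nemytskii f \<longleftrightarrow> (\<forall>u b. u \<in> borel_measurable I01 \<and> (AE x in I01. norm (u x) \<le> b) \<longrightarrow>
    (\<lambda>x. f x (u x)) \<in> borel_measurable I01 \<and> (\<exists>C. AE x in I01. norm (f x (u x)) \<le> C))"

lemma bounded_NemytskiiE:
  assumes "bounded_Nemytskii f" "u \<in> borel_measurable I01" "AE x in I01. norm (u x) \<le> b"
  obtains C where "(\<lambda>x. f x (u x)) \<in> borel_measurable I01" "AE x in I01. norm (f x (u x)) \<le> C"
  using assms unfolding bounded_Nemytskii_def by blast

text \<open>\<open>p\<close> is the value of the flux \<open>M u' + f(\<cdot>,u)\<close> at \<open>0\<close>, and \<open>N\<close> stands for the inverse of \<open>M\<close>.\<close>

definition shoot_slope :: "(real \<Rightarrow> real^'n^'n) \<Rightarrow> (real \<Rightarrow> real^'n \<Rightarrow> real^'n) \<Rightarrow> (real \<Rightarrow> real^'n \<Rightarrow> real^'n) \<Rightarrow>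
    real^'n \<Rightarrow> (real \<Rightarrow> real^'n) \<Rightarrow> real \<Rightarrow> real^'n"
  where "shoot_slope N f g p u y = N y *v (p - f y (u y) + prim (\<lambda>z. g z (u z)) y)"

abbreviation "shoot N f g p u \<equiv> prim (shoot_slope N f g p u)"

lemma integrable_bounded_matrix_mult:
  fixes N :: "real \<Rightarrow> real^'n^'n"
  assumes N: "N \<in> borel_measurable I01" "AE x in I01. \<forall>v. norm (N x *v v) \<le> r * norm v" and h: "integrable I01 h"
  shows "integrable I01 (\<lambda>x. N x *v h x)"
proof (rule integrable_mult_bounded_I01[OF bounded_bilinear_matrix_vector_mult N(1) _ h])
  show "AE x in I01. norm (N x) \<le> (real CARD('n))\<^sup>2 * r"
    using N(2) by eventually_elim (rule norm_matrix_le_bound, blast)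
qed

lemma bounded_matrix_mult:
  fixes N :: "real \<Rightarrow> real^'n^'n"
  assumes N: "N \<in> borel_measurable I01" "AE x in I01. \<forall>v. norm (N x *v v) \<le> r * norm v"
    and h: "h \<in> borel_measurable I01" "AE x in I01. norm (h x) \<le> b" and r: "r \<ge> 0"
  shows "(\<lambda>x. N x *v h x) \<in> borel_measurable I01" "AE x in I01. norm (N x *v h x) \<le> r * b"
proof -
  show "(\<lambda>x. N x *v h x) \<in> borel_measurable I01"
    using integrable_bounded_matrix_mult[OF N integrable_bounded_I01[OF h]] by auto
  show "AE x in I01. norm (N x *v h x) \<le> r * b"
    using N(2) h(2) by eventually_elim (meson mult_left_mono order_trans r)
qed

lemma shoot_slope_bounded:
  fixes N :: "real \<Rightarrow> real^'n^'n"
  assumes N: "N \<in> borel_measurable I01" "AE x in I01. \<forall>v. norm (N x *v v) \<le> r * norm v" "r \<ge> 0"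
    and f: "(\<lambda>x. f x (u x)) \<in> borel_measurable I01" "AE x in I01. norm (f x (u x)) \<le> F"
    and g: "(\<lambda>x. g x (u x)) \<in> borel_measurable I01" "AE x in I01. norm (g x (u x)) \<le> G"
  shows "shoot_slope N f g p u \<in> borel_measurable I01"
    "AE x in I01. norm (shoot_slope N f g p u x) \<le> r * (norm p + F + G)"
proof -
  note gi = integrable_bounded_I01[OF g]
  have 1: "(\<lambda>y. p - f y (u y) + prim (\<lambda>z. g z (u z)) y) \<in> borel_measurable I01"
    using f measurable_prim[OF gi] by simp
  have 2: "AE y in I01. norm (p - f y (u y) + prim (\<lambda>z. g z (u z)) y) \<le> norm p + F + G"
    using f(2)
  proof eventually_elim
    case (elim y)
    have "norm (p - f y (u y) + prim (\<lambda>z. g z (u z)) y) \<le> norm p + norm (f y (u y)) + norm (prim (\<lambda>z. g z (u z)) y)"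
      by (meson add_right_mono norm_triangle_ineq norm_triangle_ineq4 order_trans)
    then show ?case using elim norm_prim_le_const[OF g, of y] by linarith
  qed
  show "shoot_slope N f g p u \<in> borel_measurable I01"
    "AE x in I01. norm (shoot_slope N f g p u x) \<le> r * (norm p + F + G)"
    unfolding shoot_slope_def[abs_def] using bounded_matrix_mult[OF N(1,2) 1 2 N(3)] by auto
qed

text \<open>Used for three coefficients: \<open>A\<close> itself, the constant homogenized matrix
  and the oscillating perturbed one.\<close>

locale elliptic_coefficient =
  fixes M :: "real \<Rightarrow> real^'n^'n" and m L :: real
  assumes M: "M \<in> borel_measurable I01"
    and m: "m > 0"
    and ell: "AE x in I01. \<forall>v. (M x *v v) \<bullet> v \<ge> m * (norm v)\<^sup>2"
    and bd: "AE x in I01. \<forall>v. norm (M x *v v) \<le> L * norm v"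
begin

definition N :: "real \<Rightarrow> real^'n^'n" where "N x = matrix_inv (M x)"

lemma N_inverse: "AE x in I01. \<forall>w. M x *v (N x *v w) = w \<and> N x *v (M x *v w) = w"
  using ell unfolding N_def by eventually_elim (metis elliptic_invertible(1,2) m)

lemma N_bound: "AE x in I01. \<forall>w. norm (N x *v w) \<le> 1 / m * norm w"
  using ell unfolding N_def
proof eventually_elim
  case (elim x)
  then show ?case using elliptic_invertible(3)[OF m, of "M x"] by simp
qed

lemma N_measurable: "N \<in> borel_measurable I01"
proof (rule measurable_I01_AE[OF measurable_cramer_inverse[OF M]])
  show "AE x in I01. cramer_inverse (M x) = N x"
    using ell unfolding N_def by eventually_elim (metis elliptic_invertible(4) m cramer_inverse_eq)
qed

text \<open>Testing with \<phi> times the basis vectors shows that the flux minus the primitive of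
  g(x,u) has zero weak derivative, so it is a constant p; inverting M yields the slope. U is the
  continuous representative of u.\<close>

lemma weak_solution_imp_shoot:
  assumes f: "bounded_Nemytskii f" and g: "bounded_Nemytskii g" and sol: "weak_solution M f g u"
  obtains p U where "\<And>x. U x = shoot N f g p U x" "U 1 = 0" "AE x in I01. u x = U x"
    "\<exists>B. \<forall>x. norm (U x) \<le> B" "U \<in> borel_measurable I01"
proof -
  have uW: "u \<in> W12_0" using sol by (simp add: weak_solution_def)
  define w where "w = weak_derivative u"
  have w: "w \<in> L2 I01" "(\<integral>x. w x \<partial>I01) = 0" "AE x in I01. u x = prim w x"
    using W12_0_D[OF uW] by (auto simp: w_def)
  note wi = L2_I01_integrable[OF w(1)]
  define U where "U = prim w"
  have Um: "U \<in> borel_measurable I01" unfolding U_def by (rule measurable_prim[OF wi])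
  have Ub: "norm (U x) \<le> (\<integral>y. norm (w y) \<partial>I01)" for x unfolding U_def by (rule norm_prim_le_integral[OF wi])
  have uU: "AE x in I01. u x = U x" using w(3) by (simp add: U_def)
  obtain F where F: "(\<lambda>x. f x (U x)) \<in> borel_measurable I01" "AE x in I01. norm (f x (U x)) \<le> F"
    by (rule bounded_NemytskiiE[OF f Um]) (use Ub in auto)
  obtain G where G: "(\<lambda>x. g x (U x)) \<in> borel_measurable I01" "AE x in I01. norm (g x (U x)) \<le> G"
    by (rule bounded_NemytskiiE[OF g Um]) (use Ub in auto)
  note Fi = integrable_bounded_I01[OF F] and Gi = integrable_bounded_I01[OF G]
  have Mw: "integrable I01 (\<lambda>x. M x *v w x)" by (rule integrable_bounded_matrix_mult[OF M bd wi])
  define k where "k = (\<lambda>x. M x *v w x + f x (U x))"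
  have ki: "integrable I01 k" unfolding k_def using Mw Fi by simp
  \<comment> \<open>The summand \<open>0 +\<close> fits \<open>has_weak_derivative_prim\<close> with
    vanishing constant.\<close>
  define h where "h = (\<lambda>x. k x - (0 + prim (\<lambda>z. g z (U z)) x))"
  have hi: "integrable I01 h" unfolding h_def using ki integrable_prim_I01[OF Gi] by simp
  obtain p where p: "AE x in I01. h x = p"
  proof (rule du_Bois_Reymond[OF hi])
    fix \<phi> :: "real \<Rightarrow> real" assume \<phi>: "\<phi> \<in> test_functions"
    let ?d = "\<lambda>x. vector_derivative \<phi> (at x)"
    have d: "?d \<in> test_functions" by (rule test_function_derivative[OF \<phi>])
    have i1: "integrable I01 (\<lambda>x. ?d x *\<^sub>R k x)"
      by (rule integrable_test_times_locally_integrable[OF d locally_integrable_I01[OF ki]])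
    have i2: "integrable I01 (\<lambda>x. \<phi> x *\<^sub>R g x (U x))"
      by (rule integrable_test_times_locally_integrable[OF \<phi> locally_integrable_I01[OF Gi]])
    have i3: "integrable I01 (\<lambda>x. ?d x *\<^sub>R (0 + prim (\<lambda>z. g z (U z)) x))"
      using integrable_test_times_locally_integrable[OF d locally_integrable_I01[OF integrable_prim_I01[OF Gi]]] by simp
    have "(\<integral>x. ?d x *\<^sub>R k x + \<phi> x *\<^sub>R g x (U x) \<partial>I01) = 0"
    proof (rule euclidean_eqI)
      fix i :: "real^'n" assume "i \<in> Basis"
      have t: "(\<lambda>x. \<phi> x *\<^sub>R i) \<in> test_functions" by (rule test_function_scaleR_const[OF \<phi>])
      have vd: "vector_derivative (\<lambda>x. \<phi> x *\<^sub>R i) (at x) = ?d x *\<^sub>R i" for x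
      proof (rule vector_derivative_at)
        have "(\<phi> has_vector_derivative ?d x) (at x)"
          using \<phi> smooth_curveD(1) by (auto simp: test_functions_iff)
        then show "((\<lambda>x. \<phi> x *\<^sub>R i) has_vector_derivative ?d x *\<^sub>R i) (at x)"
          using bounded_linear.has_vector_derivative[OF bounded_linear_scaleR_left] by fastforce
      qed
      have AEt: "AE x in I01. weak_derivative (\<lambda>x. \<phi> x *\<^sub>R i) x = ?d x *\<^sub>R i"
        using test_function_W12_0(2)[OF t] unfolding vd .
      let ?H = "\<lambda>x. (M x *v weak_derivative u x + f x (u x)) \<bullet> weak_derivative (\<lambda>x. \<phi> x *\<^sub>R i) x + g x (u x) \<bullet> (\<phi> x *\<^sub>R i)"
      have H: "has_bochner_integral I01 ?H 0"
        using sol test_function_W12_0(1)[OF t] unfolding weak_solution_def by blast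
      have "(\<integral>x. ?d x *\<^sub>R k x + \<phi> x *\<^sub>R g x (U x) \<partial>I01) \<bullet> i
          = (\<integral>x. (?d x *\<^sub>R k x + \<phi> x *\<^sub>R g x (U x)) \<bullet> i \<partial>I01)"
        using i1 i2 by (intro integral_inner_left[symmetric]) simp
      also have "\<dots> = (\<integral>x. ?H x \<partial>I01)"
      proof (rule integral_cong_AE)
        show "(\<lambda>x. (?d x *\<^sub>R k x + \<phi> x *\<^sub>R g x (U x)) \<bullet> i) \<in> borel_measurable I01"
          using i1 i2 by (intro borel_measurable_inner) auto
        show "?H \<in> borel_measurable I01" using H by (auto simp: has_bochner_integral_iff)
        show "AE x in I01. (?d x *\<^sub>R k x + \<phi> x *\<^sub>R g x (U x)) \<bullet> i = ?H x"
          using uU AEt by eventually_elim (simp add: k_def w_def inner_add_left)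
      qed
      also have "\<dots> = 0" using H by (simp add: has_bochner_integral_iff)
      finally show "(\<integral>x. ?d x *\<^sub>R k x + \<phi> x *\<^sub>R g x (U x) \<partial>I01) \<bullet> i = 0 \<bullet> i" by simp
    qed
    then have "(\<integral>x. ?d x *\<^sub>R k x \<partial>I01) + (\<integral>x. \<phi> x *\<^sub>R g x (U x) \<partial>I01) = 0"
      using i1 i2 by simp
    moreover have "(\<integral>x. ?d x *\<^sub>R (0 + prim (\<lambda>z. g z (U z)) x) \<partial>I01) = - (\<integral>x. \<phi> x *\<^sub>R g x (U x) \<partial>I01)"
      using has_weak_derivative_prim[OF Gi, of 0] \<phi> unfolding has_weak_derivative_def by blast
    ultimately show "(\<integral>x. ?d x *\<^sub>R h x \<partial>I01) = 0"
      unfolding h_def scaleR_diff_right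
      by (subst Bochner_Integration.integral_diff[OF i1 i3]) simp
  qed
  have "AE x in I01. w x = shoot_slope N f g p U x"
    using p N_inverse
  proof eventually_elim
    case (elim x)
    then have "M x *v w x = p - f x (U x) + prim (\<lambda>z. g z (U z)) x"
      by (simp add: h_def k_def algebra_simps)
    then show ?case using elim(2) unfolding shoot_slope_def by metis
  qed
  then have "prim w x = shoot N f g p U x" for x
    using w(1) by (intro prim_cong_AE) (auto simp: L2_def)
  moreover have "U 1 = 0" using w(2) prim_ge_1[of 1 w] by (simp add: U_def)
  ultimately show thesis
    using that[of U p] Um Ub uU unfolding U_def by blast
qed

text \<open>The flux of U is p plus the primitive of g(x,U), so the weak form is an integration by
  parts; the term with p and the boundary term vanish because the derivative of a function in
  \<open>W12_0\<close> has mean zero.\<close>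

lemma shoot_imp_weak_solution:
  assumes f: "bounded_Nemytskii f" and g: "bounded_Nemytskii g"
    and U: "\<And>x. U x = shoot N f g p U x" "U 1 = 0"
    and Um: "U \<in> borel_measurable I01" and Ub: "\<And>x. norm (U x) \<le> B"
  shows "weak_solution M f g U"
proof -
  obtain F where F: "(\<lambda>x. f x (U x)) \<in> borel_measurable I01" "AE x in I01. norm (f x (U x)) \<le> F"
    by (rule bounded_NemytskiiE[OF f Um]) (use Ub in auto)
  obtain G where G: "(\<lambda>x. g x (U x)) \<in> borel_measurable I01" "AE x in I01. norm (g x (U x)) \<le> G"
    by (rule bounded_NemytskiiE[OF g Um]) (use Ub in auto)
  note Gi = integrable_bounded_I01[OF G]
  define w where "w = shoot_slope N f g p U"
  have w: "w \<in> borel_measurable I01" "AE x in I01. norm (w x) \<le> 1 / m * (norm p + F + G)"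
    unfolding w_def
    using shoot_slope_bounded[where f=f and g=g and u=U and p=p, OF N_measurable N_bound _ F G] m by auto
  have Uw: "U = prim w" unfolding w_def using U(1) by (intro ext)
  have mean: "(\<integral>x. w x \<partial>I01) = 0" using U(2) prim_ge_1[of 1 w] by (simp add: Uw)
  note UW = prim_in_W12_0[OF w mean, folded Uw]
  have "has_bochner_integral I01
      (\<lambda>x. (M x *v weak_derivative U x + f x (U x)) \<bullet> weak_derivative \<phi> x + g x (U x) \<bullet> \<phi> x) 0"
    (is "has_bochner_integral I01 ?H 0")
    if \<phi>: "\<phi> \<in> W12_0" for \<phi>
  proof -
    define v where "v = weak_derivative \<phi>"
    have v: "v \<in> L2 I01" "(\<integral>x. v x \<partial>I01) = 0" "AE x in I01. \<phi> x = prim v x"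
      using W12_0_D[OF \<phi>] by (auto simp: v_def)
    note vi = L2_I01_integrable[OF v(1)]
    let ?g = "\<lambda>z. g z (U z)"
    let ?K = "\<lambda>x. p \<bullet> v x + (prim ?g x \<bullet> v x + ?g x \<bullet> prim v x)"
    have i1: "integrable I01 (\<lambda>x. p \<bullet> v x)" by (rule integrable_bounded_linear[OF bounded_linear_inner_right vi])
    have i2: "integrable I01 (\<lambda>x. prim ?g x \<bullet> v x)"
      by (rule integrable_mult_bounded_I01[OF bounded_bilinear_inner measurable_prim[OF Gi] _ vi, of "\<integral>y. norm (?g y) \<partial>I01"])
        (auto intro!: AE_I2 norm_prim_le_integral[OF Gi])
    have i3: "integrable I01 (\<lambda>x. ?g x \<bullet> prim v x)"
      by (rule integrable_mult_bounded_I01[OF bounded_bilinear_inner G integrable_prim_I01[OF vi]])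
    have Ki: "integrable I01 ?K" using i1 i2 i3 by simp
    have "(\<integral>x. p \<bullet> v x \<partial>I01) = 0"
      using integral_bounded_linear[OF bounded_linear_inner_right vi, of p] v(2) by simp
    then have K0: "(\<integral>x. ?K x \<partial>I01) = 0"
      using i1 i2 i3 prim_by_parts_total[OF bounded_bilinear_inner Gi vi] v(2) by simp
    have AEH: "AE x in I01. ?K x = ?H x"
      using v(3) UW(2) N_inverse
    proof eventually_elim
      case (elim x)
      have "M x *v w x = p - f x (U x) + prim ?g x" using elim(3) by (simp add: w_def shoot_slope_def)
      then have "M x *v weak_derivative U x + f x (U x) = p + prim ?g x" using elim(2) by simp
      then show ?case using elim(1) by (simp add: v_def inner_add_left)
    qed
    have Hm: "?H \<in> borel_measurable I01" by (rule measurable_I01_AE[OF borel_measurable_integrable[OF Ki] AEH])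
    have "integrable I01 ?H"
      using integrable_cong_AE[OF borel_measurable_integrable[OF Ki] Hm AEH] Ki by blast
    moreover have "(\<integral>x. ?H x \<partial>I01) = 0"
      using integral_cong_AE[OF borel_measurable_integrable[OF Ki] Hm AEH] K0 by simp
    ultimately show ?thesis by (simp add: has_bochner_integral_iff)
  qed
  then show ?thesis unfolding weak_solution_def using UW(1) by blast
qed

end

section \<open>Nonlinearities that are continuously differentiable into \<open>L\<^sup>\<infinity>\<close>\<close>

lemma AE_norm_le_Linf_norm:
  assumes "Linf_norm \<mu> u \<le> ennreal C" "C \<ge> 0"
  shows "AE x in \<mu>. norm (u x) \<le> C"
proof -
  have "AE x in \<mu>. ennreal (norm (u x)) \<le> esssup \<mu> (\<lambda>x. ennreal (norm (u x)))" by (rule esssup_AE)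
  then show ?thesis
    by eventually_elim (use assms ennreal_le_iff order_trans in \<open>unfold Linf_norm_def, blast\<close>)
qed

lemma AE_bound_Linf_norm_mat:
  assumes "Linf_norm_mat \<mu> M \<le> ennreal C" "C \<ge> 0"
  shows "AE x in \<mu>. \<forall>v. norm (M x *v v) \<le> C * norm v"
proof -
  have "AE x in \<mu>. ennreal (onorm ((*v) (M x))) \<le> esssup \<mu> (\<lambda>x. ennreal (onorm ((*v) (M x))))" by (rule esssup_AE)
  then show ?thesis
  proof eventually_elim
    case (elim x)
    then have "ennreal (onorm ((*v) (M x))) \<le> ennreal C"
      using assms(1) unfolding Linf_norm_mat_def by (rule order_trans)
    then have "onorm ((*v) (M x)) \<le> C" using assms(2) by (simp add: ennreal_le_iff)
    then show ?case
      by (meson matrix_vector_mul_bounded_linear mult_right_mono norm_ge_zero onorm order_trans)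
  qed
qed

lemma ennreal_divide_less_imp_le:
  fixes X :: ennreal
  assumes "X / ennreal c < ennreal e" "c > 0" "e > 0"
  shows "X \<le> ennreal (e * c)"
proof -
  have "X = X / ennreal c * ennreal c"
    using assms(2) by (simp add: ennreal_divide_times mult_divide_eq_ennreal)
  also have "\<dots> \<le> ennreal e * ennreal c" using assms(1) by (intro mult_right_mono) auto
  also have "\<dots> = ennreal (e * c)" using assms by (simp add: ennreal_mult)
  finally show ?thesis .
qed

text \<open>Restates the extended-valued limits as a.e. estimates. The place of the quantifiers
  matters: the remainder estimate has a null set depending on u and h, whereas the matrix estimates
  hold for all h off one null set, since \<open>Linf_norm_mat\<close> is built on the operator
  norm.\<close>

lemma C1_into_LinfE:
  fixes f :: "real \<Rightarrow> real^'n \<Rightarrow> real^'n"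
  assumes "C1_into_Linf f"
  obtains J :: "real^'n \<Rightarrow> real \<Rightarrow> real^'n^'n" where
    "\<And>u. (\<lambda>x. f x u) \<in> Linf I01"
    "\<And>u. \<exists>C\<ge>0. AE x in I01. \<forall>h. norm (J u x *v h) \<le> C * norm h"
    "\<And>u e. e > 0 \<Longrightarrow> \<exists>d>0. \<forall>h. norm h < d \<longrightarrow>
      (AE x in I01. norm (f x (u + h) - f x u - J u x *v h) \<le> e * norm h)"
    "\<And>u e. e > 0 \<Longrightarrow> \<exists>d>0. \<forall>v. norm (v - u) < d \<longrightarrow>
      (AE x in I01. \<forall>h. norm (J v x *v h - J u x *v h) \<le> e * norm h)"
proof -
  obtain J :: "real^'n \<Rightarrow> real \<Rightarrow> real^'n^'n" where
    f: "\<And>u. (\<lambda>x. f x u) \<in> Linf I01" and J: "\<And>u. J u \<in> Linf_mat I01" and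
    d: "\<And>u. ((\<lambda>h. Linf_norm I01 (\<lambda>x. f x (u + h) - f x u - J u x *v h) / ennreal (norm h)) \<longlongrightarrow> 0) (at 0)" and
    c: "\<And>u. ((\<lambda>v. Linf_norm_mat I01 (\<lambda>x. J v x - J u x)) \<longlongrightarrow> 0) (at u)"
    using assms unfolding C1_into_Linf_def by blast
  show thesis
  proof (rule that[OF f])
    fix u
    have "Linf_norm_mat I01 (J u) < \<infinity>" using J[of u] by (simp add: Linf_mat_def)
    then obtain C where C: "C \<ge> 0" "Linf_norm_mat I01 (J u) = ennreal C"
      by (cases "Linf_norm_mat I01 (J u)") auto
    then show "\<exists>C\<ge>0. AE x in I01. \<forall>h. norm (J u x *v h) \<le> C * norm h"
      using AE_bound_Linf_norm_mat[of I01 "J u" C] by auto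
    fix e :: real assume e: "e > 0"
    have "eventually (\<lambda>h. Linf_norm I01 (\<lambda>x. f x (u + h) - f x u - J u x *v h) / ennreal (norm h) < ennreal e) (at 0)"
      using d e by (intro order_tendstoD(2)[OF d]) auto
    then obtain \<delta> where \<delta>: "\<delta> > 0" "\<And>h. h \<noteq> 0 \<Longrightarrow> norm h < \<delta> \<Longrightarrow>
      Linf_norm I01 (\<lambda>x. f x (u + h) - f x u - J u x *v h) / ennreal (norm h) < ennreal e"
      unfolding eventually_at by auto
    show "\<exists>d>0. \<forall>h. norm h < d \<longrightarrow>
      (AE x in I01. norm (f x (u + h) - f x u - J u x *v h) \<le> e * norm h)"
    proof (intro exI[of _ \<delta>] conjI \<delta>(1) allI impI)
      fix h :: "real^'n" assume h: "norm h < \<delta>"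
      show "AE x in I01. norm (f x (u + h) - f x u - J u x *v h) \<le> e * norm h"
      proof (cases "h = 0")
        case False
        show ?thesis
          by (rule AE_norm_le_Linf_norm[OF ennreal_divide_less_imp_le[OF \<delta>(2)[OF False h]]])
            (use False e in auto)
      qed simp
    qed
    have "eventually (\<lambda>v. Linf_norm_mat I01 (\<lambda>x. J v x - J u x) < ennreal e) (at u)"
      using e by (intro order_tendstoD(2)[OF c]) auto
    then obtain \<delta> where \<delta>: "\<delta> > 0" "\<And>v. v \<noteq> u \<Longrightarrow> norm (v - u) < \<delta> \<Longrightarrow>
      Linf_norm_mat I01 (\<lambda>x. J v x - J u x) < ennreal e"
      unfolding eventually_at by (auto simp: dist_norm)
    show "\<exists>d>0. \<forall>v. norm (v - u) < d \<longrightarrow>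
      (AE x in I01. \<forall>h. norm (J v x *v h - J u x *v h) \<le> e * norm h)"
    proof (intro exI[of _ \<delta>] conjI \<delta>(1) allI impI)
      fix v assume v: "norm (v - u) < \<delta>"
      show "AE x in I01. \<forall>h. norm (J v x *v h - J u x *v h) \<le> e * norm h"
      proof (cases "v = u")
        case False
        show ?thesis
          using AE_bound_Linf_norm_mat[OF less_imp_le[OF \<delta>(2)[OF False v]]] e
          by (simp add: matrix_vector_mult_diff_rdistrib)
      qed (use e in simp)
    qed
  qed
qed

text \<open>Heine-Borel: the ball is covered by neighbourhoods on which J varies by at most e / 2,
  and a Lebesgue number of this cover is a modulus valid on the whole ball.\<close>

lemma C1_into_Linf_uniform:
  fixes J :: "real^'n \<Rightarrow> real \<Rightarrow> real^'n^'n"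
  assumes c: "\<And>u e. e > 0 \<Longrightarrow> \<exists>d>0. \<forall>v. norm (v - u) < d \<longrightarrow>
      (AE x in I01. \<forall>h. norm (J v x *v h - J u x *v h) \<le> e * norm h)"
    and e: "e > 0"
  shows "\<exists>d>0. \<forall>u v. norm u \<le> R \<and> norm v \<le> R \<and> norm (v - u) < d \<longrightarrow>
      (AE x in I01. \<forall>h. norm (J v x *v h - J u x *v h) \<le> e * norm h)"
proof -
  have "\<forall>u. \<exists>d>0. \<forall>v. norm (v - u) < d \<longrightarrow>
      (AE x in I01. \<forall>h. norm (J v x *v h - J u x *v h) \<le> e / 2 * norm h)"
    using c[of "e/2"] e by simp
  from choice[OF this] obtain d where d: "\<And>u. d u > 0" "\<And>u v. norm (v - u) < d u \<Longrightarrow>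
      (AE x in I01. \<forall>h. norm (J v x *v h - J u x *v h) \<le> e / 2 * norm h)"
    by blast
  have "cball (0 :: real^'n) R \<subseteq> \<Union> (range (\<lambda>u. ball u (d u)))" using d(1) by (meson UN_iff centre_in_ball rangeI subsetI UnionI)
  then obtain \<delta> where \<delta>: "\<delta> > 0" "\<And>u. u \<in> cball 0 R \<Longrightarrow> \<exists>G\<in>range (\<lambda>u. ball u (d u)). ball u \<delta> \<subseteq> G"
    by (rule Heine_Borel_lemma[OF compact_cball]) auto
  show ?thesis
  proof (intro exI[of _ \<delta>] conjI \<delta>(1) allI impI)
    fix u v :: "real^'n" assume uv: "norm u \<le> R \<and> norm v \<le> R \<and> norm (v - u) < \<delta>"
    then obtain w where w: "ball u \<delta> \<subseteq> ball w (d w)" using \<delta>(2)[of u] by auto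
    have "norm (u - w) < d w" "norm (v - w) < d w"
      using w uv \<delta>(1) by (auto simp: subset_iff dist_norm norm_minus_commute)
    from d(2)[OF this(1)] d(2)[OF this(2)] show "AE x in I01. \<forall>h. norm (J v x *v h - J u x *v h) \<le> e * norm h"
    proof eventually_elim
      case (elim x)
      show ?case
      proof
        fix h
        have "norm (J v x *v h - J u x *v h) \<le> norm (J v x *v h - J w x *v h) + norm (J u x *v h - J w x *v h)"
          using dist_triangle2[of "J v x *v h" "J u x *v h" "J w x *v h"] by (simp add: dist_norm)
        then show "norm (J v x *v h - J u x *v h) \<le> e * norm h"
          using elim(1)[rule_format, of h] elim(2)[rule_format, of h] by linarith
      qed
    qed
  qed
qed

text \<open>The segment is subdivided (\<open>Bolzano\<close>), since the estimates hold only up to null sets that depend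
  on the points involved.\<close>

lemma C1_into_Linf_mean_value:
  fixes f :: "real \<Rightarrow> real^'n \<Rightarrow> real^'n" and J :: "real^'n \<Rightarrow> real \<Rightarrow> real^'n^'n"
  assumes d: "\<And>u e. e > 0 \<Longrightarrow> \<exists>d>0. \<forall>h. norm h < d \<longrightarrow>
      (AE x in I01. norm (f x (u + h) - f x u - J u x *v h) \<le> e * norm h)"
    and c: "\<And>w. w \<in> closed_segment u v \<Longrightarrow> AE x in I01. \<forall>h. norm (J w x *v h - J u x *v h) \<le> e * norm h"
    and e: "e > 0"
  shows "AE x in I01. norm (f x v - f x u - J u x *v (v - u)) \<le> 2 * e * norm (v - u)"
proof -
  define \<gamma> where "\<gamma> = (\<lambda>t::real. u + t *\<^sub>R (v - u))"
  define P where "P = (\<lambda>s t. AE x in I01. norm (f x (\<gamma> t) - f x (\<gamma> s) - J u x *v (\<gamma> t - \<gamma> s)) \<le> 2 * e * (t - s) * norm (v - u))"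
  define Q where "Q = (\<lambda>s t. 0 \<le> s \<longrightarrow> t \<le> 1 \<longrightarrow> s \<le> t \<longrightarrow> P s t)"
  have "Q 0 1"
  proof (rule Bolzano)
    fix a b c assume Q: "Q a b" "Q b c" "a \<le> b" "b \<le> c"
    show "Q a c" unfolding Q_def
    proof (intro impI)
      assume "0 \<le> a" "c \<le> 1" "a \<le> c"
      then have "P a b" "P b c" using Q unfolding Q_def by auto
      then show "P a c" unfolding P_def
      proof eventually_elim
        case (elim x)
        have "f x (\<gamma> c) - f x (\<gamma> a) - J u x *v (\<gamma> c - \<gamma> a)
          = (f x (\<gamma> c) - f x (\<gamma> b) - J u x *v (\<gamma> c - \<gamma> b)) + (f x (\<gamma> b) - f x (\<gamma> a) - J u x *v (\<gamma> b - \<gamma> a))"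
          by (simp add: matrix_vector_mult_diff_distrib)
        then have "norm (f x (\<gamma> c) - f x (\<gamma> a) - J u x *v (\<gamma> c - \<gamma> a))
          \<le> 2 * e * (c - b) * norm (v - u) + 2 * e * (b - a) * norm (v - u)"
          using elim norm_triangle_mono by metis
        then show ?case by (simp add: algebra_simps)
      qed
    qed
  next
    fix \<tau> :: real assume \<tau>: "0 \<le> \<tau>" "\<tau> \<le> 1"
    obtain \<delta> where \<delta>: "\<delta> > 0" "\<And>h. norm h < \<delta> \<Longrightarrow>
      (AE x in I01. norm (f x (\<gamma> \<tau> + h) - f x (\<gamma> \<tau>) - J (\<gamma> \<tau>) x *v h) \<le> e * norm h)"
      using d[OF e, of "\<gamma> \<tau>"] by blast
    have "\<gamma> \<tau> \<in> closed_segment u v" unfolding \<gamma>_def in_segment using \<tau>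
      by (intro exI[of _ \<tau>]) (simp add: algebra_simps)
    note c\<tau> = c[OF this]
    let ?n = "norm (v - u)"
    \<comment> \<open>One e comes from differentiability at the intermediate point, the other from
      exchanging the Jacobian there for the one at u; hence 2 e in the claim.\<close>
    have pt: "AE x in I01. norm (f x (\<gamma> s) - f x (\<gamma> \<tau>) - J u x *v (\<gamma> s - \<gamma> \<tau>)) \<le> 2 * e * (\<bar>s - \<tau>\<bar> * ?n)"
      if s: "\<bar>s - \<tau>\<bar> * ?n < \<delta>" for s
    proof -
      have g: "\<gamma> s = \<gamma> \<tau> + (s - \<tau>) *\<^sub>R (v - u)" by (simp add: \<gamma>_def algebra_simps)
      have "AE x in I01. norm (f x (\<gamma> s) - f x (\<gamma> \<tau>) - J (\<gamma> \<tau>) x *v (\<gamma> s - \<gamma> \<tau>)) \<le> e * norm (\<gamma> s - \<gamma> \<tau>)"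
        using \<delta>(2)[of "(s - \<tau>) *\<^sub>R (v - u)"] s unfolding g by simp
      then show ?thesis using c\<tau>
      proof eventually_elim
        case (elim x)
        let ?h = "\<gamma> s - \<gamma> \<tau>"
        have n: "norm ?h = \<bar>s - \<tau>\<bar> * ?n" unfolding g by simp
        have "norm (f x (\<gamma> s) - f x (\<gamma> \<tau>) - J u x *v ?h)
          = norm ((f x (\<gamma> s) - f x (\<gamma> \<tau>) - J (\<gamma> \<tau>) x *v ?h) + (J (\<gamma> \<tau>) x *v ?h - J u x *v ?h))"
          by (simp only: diff_add_cancel add_diff_eq)
        also have "\<dots> \<le> e * norm ?h + e * norm ?h"
          by (rule norm_triangle_mono[OF elim(1) elim(2)[rule_format]])
        finally show ?case unfolding n by simp
      qed
    qed
    show "\<exists>d>0. \<forall>a b. a \<le> \<tau> \<and> \<tau> \<le> b \<and> b - a < d \<longrightarrow> Q a b"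
    \<comment> \<open>The 1 in the denominator covers the case v = u.\<close>
    proof (intro exI[of _ "\<delta> / (1 + ?n)"] conjI allI impI)
      show "0 < \<delta> / (1 + ?n)" using \<delta>(1) by (simp add: add_pos_nonneg)
      fix a b assume ab: "a \<le> \<tau> \<and> \<tau> \<le> b \<and> b - a < \<delta> / (1 + ?n)"
      have lt: "\<bar>s - \<tau>\<bar> * ?n < \<delta>" if "s = a \<or> s = b" for s
      proof -
        have "\<bar>s - \<tau>\<bar> * ?n \<le> (b - a) * (1 + ?n)" using that ab by (intro mult_mono) auto
        also have "\<dots> < \<delta>" using ab by (simp add: pos_less_divide_eq add_pos_nonneg)
        finally show ?thesis .
      qed
      have "AE x in I01. norm (f x (\<gamma> a) - f x (\<gamma> \<tau>) - J u x *v (\<gamma> a - \<gamma> \<tau>)) \<le> 2 * e * (\<bar>a - \<tau>\<bar> * ?n)"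
        "AE x in I01. norm (f x (\<gamma> b) - f x (\<gamma> \<tau>) - J u x *v (\<gamma> b - \<gamma> \<tau>)) \<le> 2 * e * (\<bar>b - \<tau>\<bar> * ?n)"
        using pt lt by blast+
      then have "P a b" unfolding P_def
      proof eventually_elim
        case (elim x)
        have "f x (\<gamma> b) - f x (\<gamma> a) - J u x *v (\<gamma> b - \<gamma> a)
          = (f x (\<gamma> b) - f x (\<gamma> \<tau>) - J u x *v (\<gamma> b - \<gamma> \<tau>)) - (f x (\<gamma> a) - f x (\<gamma> \<tau>) - J u x *v (\<gamma> a - \<gamma> \<tau>))"
          by (simp add: matrix_vector_mult_diff_distrib)
        then have "norm (f x (\<gamma> b) - f x (\<gamma> a) - J u x *v (\<gamma> b - \<gamma> a))
          \<le> 2 * e * (\<bar>b - \<tau>\<bar> * ?n) + 2 * e * (\<bar>a - \<tau>\<bar> * ?n)"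
          using elim norm_triangle_ineq4 by (smt (verit))
        also have "\<dots> = 2 * e * (b - a) * ?n" using ab by (simp add: algebra_simps)
        finally show ?case .
      qed
      then show "Q a b" by (simp add: Q_def)
    qed
  qed simp
  then show ?thesis by (simp add: Q_def P_def \<gamma>_def)
qed

text \<open>Applied with a countable dense \<open>D\<close>, over which the exceptional null sets can be united.\<close>

lemma differentiable_from_dense:
  fixes F :: "real^'n \<Rightarrow> real^'n" and G :: "real^'n \<Rightarrow> real^'n^'n"
  assumes F: "continuous_on UNIV F" and D: "closure D = UNIV"
    and \<delta>: "\<And>R e. e > 0 \<Longrightarrow> \<delta> R e > 0"
    and G: "\<And>k l u v. u \<in> D \<Longrightarrow> v \<in> D \<Longrightarrow> norm u \<le> real k \<Longrightarrow> norm v \<le> real k \<Longrightarrow>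
       norm (v - u) < \<delta> (real k) (1 / real (Suc l)) \<Longrightarrow>
       norm (F v - F u - G u *v (v - u)) \<le> 1 / real (Suc l) * norm (v - u) \<and>
       (\<forall>h. norm (G v *v h - G u *v h) \<le> 1 / real (Suc l) * norm h)"
  shows "(F has_derivative (\<lambda>h. jacobian F (at u) *v h)) (at u)"
    and "norm u < real k \<Longrightarrow> norm v < real k \<Longrightarrow> norm (v - u) < \<delta> (real k) (1 / real (Suc l)) \<Longrightarrow>
       norm (jacobian F (at v) *v h - jacobian F (at u) *v h) \<le> 1 / real (Suc l) * norm h"
    and "u \<in> D \<Longrightarrow> jacobian F (at u) = G u"
proof -
  have "\<exists>s. (\<forall>k. s k \<in> D) \<and> s \<longlonglongrightarrow> u" for u using D closure_sequential[of u D] by auto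
  then have "\<forall>u. \<exists>s. (\<forall>k. s k \<in> D) \<and> s \<longlonglongrightarrow> u" by blast
  from choice[OF this] obtain s where s: "\<And>u k. s u k \<in> D" "\<And>u. s u \<longlonglongrightarrow> u" by blast
  \<comment> \<open>The approximating sequence is constant for points of D, so that the limit L
    constructed below agrees with G there, as the last claim demands.\<close>
  define t where "t = (\<lambda>u k. if u \<in> D then u else s u k)"
  have t: "t u k \<in> D" "t u \<longlonglongrightarrow> u" for u k using s by (cases "u \<in> D"; simp add: t_def)+
  \<comment> \<open>The strict bound on u leaves room for the approximants, which obey the
    non-strict bound eventually. The strict inequalities in the conclusion have this origin.\<close>
  have ev: "\<forall>\<^sub>F j in sequentially. norm (t u j) \<le> real k" if "norm u < real k" for u k
    using order_tendstoD(2)[OF tendsto_norm[OF t(2)] that] by eventually_elim simp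
  \<comment> \<open>G is uniformly continuous on bounded parts of D and therefore extends to all u;
    the extension turns out to be the derivative of F.\<close>
  have "Cauchy (\<lambda>j. G (t u j))" for u
  proof (rule metric_CauchyI)
    fix e :: real assume e: "e > 0"
    define K where "K = (real CARD('n))\<^sup>2"
    have K: "K > 0" by (simp add: K_def)
    obtain l where "inverse (real (Suc l)) < e / K"
      using reals_Archimedean[of "e / K"] e K by auto
    then have l: "K * (1 / real (Suc l)) < e"
      using K by (simp add: inverse_eq_divide pos_less_divide_eq mult.commute)
    obtain k where k: "norm u < real k" using reals_Archimedean2 by blast
    have "\<forall>\<^sub>F j in sequentially. dist (t u j) u < \<delta> (real k) (1 / real (Suc l)) / 2"
      by (rule tendstoD[OF t(2)]) (simp add: \<delta>)
    with ev[OF k] obtain M where M: "\<And>j. j \<ge> M \<Longrightarrow> norm (t u j) \<le> real k"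
      "\<And>j. j \<ge> M \<Longrightarrow> dist (t u j) u < \<delta> (real k) (1 / real (Suc l)) / 2"
      unfolding eventually_sequentially by (metis max.bounded_iff nle_le)
    show "\<exists>M. \<forall>m\<ge>M. \<forall>n\<ge>M. dist (G (t u m)) (G (t u n)) < e"
    proof (intro exI[of _ M] allI impI)
      fix m n assume mn: "M \<le> m" "M \<le> n"
      have "norm (t u m - t u n) < \<delta> (real k) (1 / real (Suc l))"
        using M(2)[OF mn(1)] M(2)[OF mn(2)] dist_triangle_half_l unfolding dist_norm[symmetric]
        by (metis dist_commute)
      then have "norm (G (t u m) - G (t u n)) \<le> K * (1 / real (Suc l))"
        unfolding K_def using G[OF t(1) t(1) M(1)[OF mn(2)] M(1)[OF mn(1)]]
        by (intro norm_matrix_le_bound) (auto simp: matrix_vector_mult_diff_rdistrib)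
      then show "dist (G (t u m)) (G (t u n)) < e" using l by (simp add: dist_norm)
    qed
  qed
  then have "\<exists>L. (\<lambda>j. G (t u j)) \<longlonglongrightarrow> L" for u using Cauchy_convergent convergent_def by blast
  then have "\<forall>u. \<exists>L. (\<lambda>j. G (t u j)) \<longlonglongrightarrow> L" by blast
  from choice[OF this] obtain L where L: "\<And>u. (\<lambda>j. G (t u j)) \<longlonglongrightarrow> L u" by blast
  have mv: "(\<lambda>j. A j *v x j) \<longlonglongrightarrow> B *v y" if "A \<longlonglongrightarrow> B" "x \<longlonglongrightarrow> y"
    for A and B :: "real^'n^'n" and x y
    by (rule bounded_bilinear.tendsto[OF bounded_bilinear_matrix_vector_mult that])
  have Ft: "(\<lambda>j. F (t u j)) \<longlonglongrightarrow> F u" for u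
    using continuous_on_tendsto_compose[OF F t(2)] by simp
  have evd: "\<forall>\<^sub>F j in sequentially. norm (t v j - t u j) < d" if "norm (v - u) < d" for u v d
    by (rule order_tendstoD(2)[OF tendsto_norm[OF tendsto_diff[OF t(2) t(2)]] that])
  have est1: "norm (F v - F u - L u *v (v - u)) \<le> 1 / real (Suc l) * norm (v - u)"
    if "norm u < real k" "norm v < real k" "norm (v - u) < \<delta> (real k) (1 / real (Suc l))" for u v k l
  proof (rule tendsto_le[OF sequentially_bot])
    show "(\<lambda>j. 1 / real (Suc l) * norm (t v j - t u j)) \<longlonglongrightarrow> 1 / real (Suc l) * norm (v - u)"
      by (intro tendsto_intros t)
    show "(\<lambda>j. norm (F (t v j) - F (t u j) - G (t u j) *v (t v j - t u j))) \<longlonglongrightarrow> norm (F v - F u - L u *v (v - u))"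
      by (intro tendsto_norm tendsto_diff Ft mv L t)
    show "\<forall>\<^sub>F j in sequentially. norm (F (t v j) - F (t u j) - G (t u j) *v (t v j - t u j)) \<le> 1 / real (Suc l) * norm (t v j - t u j)"
      using ev[OF that(1)] ev[OF that(2)] evd[OF that(3)]
      by eventually_elim (use G[OF t(1) t(1)] in blast)
  qed
  have est2: "norm (L v *v h - L u *v h) \<le> 1 / real (Suc l) * norm h"
    if "norm u < real k" "norm v < real k" "norm (v - u) < \<delta> (real k) (1 / real (Suc l))" for u v k l h
  proof (rule tendsto_le[OF sequentially_bot tendsto_const])
    show "(\<lambda>j. norm (G (t v j) *v h - G (t u j) *v h)) \<longlonglongrightarrow> norm (L v *v h - L u *v h)"
      by (intro tendsto_norm tendsto_diff mv L tendsto_const)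
    show "\<forall>\<^sub>F j in sequentially. norm (G (t v j) *v h - G (t u j) *v h) \<le> 1 / real (Suc l) * norm h"
      using ev[OF that(1)] ev[OF that(2)] evd[OF that(3)]
      by eventually_elim (use G[OF t(1) t(1)] in blast)
  qed
  have der: "(F has_derivative (\<lambda>h. L u *v h)) (at u)" for u
    unfolding has_derivative_at_alt
  proof (intro conjI allI impI)
    show "bounded_linear ((*v) (L u))" by simp
    fix e :: real assume e: "e > 0"
    obtain l where "inverse (real (Suc l)) < e" using reals_Archimedean[OF e] by auto
    then have l: "1 / real (Suc l) \<le> e" by (simp add: inverse_eq_divide)
    obtain k where k: "norm u + 1 < real k" using reals_Archimedean2 by blast
    show "\<exists>d>0. \<forall>y. norm (y - u) < d \<longrightarrow> norm (F y - F u - L u *v (y - u)) \<le> e * norm (y - u)"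
    proof (intro exI[of _ "min 1 (\<delta> (real k) (1 / real (Suc l)))"] conjI allI impI)
      show "0 < min 1 (\<delta> (real k) (1 / real (Suc l)))" by (simp add: \<delta>)
      fix y assume y: "norm (y - u) < min 1 (\<delta> (real k) (1 / real (Suc l)))"
      have "norm y \<le> norm u + norm (y - u)" by (metis norm_triangle_sub)
      then have "norm y < real k" "norm u < real k" using y k norm_ge_zero[of "y - u"] by auto
      then have "norm (F y - F u - L u *v (y - u)) \<le> 1 / real (Suc l) * norm (y - u)"
        using y by (intro est1) auto
      also have "\<dots> \<le> e * norm (y - u)" by (rule mult_right_mono[OF l]) simp
      finally show "norm (F y - F u - L u *v (y - u)) \<le> e * norm (y - u)" .
    qed
  qed
  have J: "jacobian F (at u) = L u" for u
    unfolding jacobian_def frechet_derivative_at[OF der, symmetric] by (simp add: matrix_of_matrix_vector_mul)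
  show "(F has_derivative (\<lambda>h. jacobian F (at u) *v h)) (at u)" unfolding J by (rule der)
  show "norm (jacobian F (at v) *v h - jacobian F (at u) *v h) \<le> 1 / real (Suc l) * norm h"
    if "norm u < real k" "norm v < real k" "norm (v - u) < \<delta> (real k) (1 / real (Suc l))"
    unfolding J by (rule est2[OF that])
  show "jacobian F (at u) = G u" if "u \<in> D"
    using L[of u] that unfolding J t_def by (simp add: LIMSEQ_const_iff)
qed

text \<open>The estimates for the abstract derivative J are collected over a countable dense set of
  arguments and countably many radii and accuracies, off one null set;
  \<open>differentiable_from_dense\<close> then carries them to all arguments and to the true
  Jacobian matrices.\<close>

lemma C1_into_Linf_regular:
  fixes f :: "real \<Rightarrow> real^'n \<Rightarrow> real^'n"
  assumes C1: "C1_into_Linf f" and rep: "continuous_representative f"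
  shows "AE x in I01. \<forall>u. (f x has_derivative (\<lambda>h. jacobian (f x) (at u) *v h)) (at u)"
    and "\<And>R e. e > 0 \<Longrightarrow> \<exists>d>0. AE x in I01. \<forall>u v h. norm u \<le> R \<longrightarrow> norm v \<le> R \<longrightarrow> norm (v - u) < d \<longrightarrow>
        norm (jacobian (f x) (at v) *v h - jacobian (f x) (at u) *v h) \<le> e * norm h"
    and "\<exists>C\<ge>0. AE x in I01. \<forall>h. norm (jacobian (f x) (at 0) *v h) \<le> C * norm h"
proof -
  obtain J :: "real^'n \<Rightarrow> real \<Rightarrow> real^'n^'n" where
    b: "\<And>u. \<exists>C\<ge>0. AE x in I01. \<forall>h. norm (J u x *v h) \<le> C * norm h" and
    d: "\<And>u e. e > 0 \<Longrightarrow> \<exists>d>0. \<forall>h. norm h < d \<longrightarrow>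
      (AE x in I01. norm (f x (u + h) - f x u - J u x *v h) \<le> e * norm h)" and
    c: "\<And>u e. e > 0 \<Longrightarrow> \<exists>d>0. \<forall>v. norm (v - u) < d \<longrightarrow>
      (AE x in I01. \<forall>h. norm (J v x *v h - J u x *v h) \<le> e * norm h)"
    by (rule C1_into_LinfE[OF C1]) (rule that)
  \<comment> \<open>The half offsets the factor 2 of \<open>C1_into_Linf_mean_value\<close>, so that
    one \<open>\<delta>\<close> serves both the remainder and the Jacobian estimate.\<close>
  define P where "P = (\<lambda>R e d. d > 0 \<and> (\<forall>u v. norm u \<le> R \<and> norm v \<le> R \<and> norm (v - u) < d \<longrightarrow>
      (AE x in I01. \<forall>h. norm (J v x *v h - J u x *v h) \<le> e / 2 * norm h)))"
  define \<delta> where "\<delta> = (\<lambda>R e. SOME d. P R e d)"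
  have P: "P R e (\<delta> R e)" if "e > 0" for R e :: real
    unfolding \<delta>_def
  proof (rule someI_ex)
    show "\<exists>d. P R e d" using C1_into_Linf_uniform[OF c, of "e/2" R] that unfolding P_def by simp
  qed
  have \<delta>: "\<And>R e. e > 0 \<Longrightarrow> \<delta> R e > 0" "\<And>R e u v. e > 0 \<Longrightarrow> norm u \<le> R \<Longrightarrow> norm v \<le> R \<Longrightarrow> norm (v - u) < \<delta> R e \<Longrightarrow>
      (AE x in I01. \<forall>h. norm (J v x *v h - J u x *v h) \<le> e / 2 * norm h)"
    using P unfolding P_def by blast+
  have mv: "AE x in I01. norm (f x v - f x u - J u x *v (v - u)) \<le> e * norm (v - u)"
    if e: "e > 0" and uv: "norm u \<le> R" "norm v \<le> R" "norm (v - u) < \<delta> R e" for e u v R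
  proof -
    have "AE x in I01. norm (f x v - f x u - J u x *v (v - u)) \<le> 2 * (e / 2) * norm (v - u)"
    proof (rule C1_into_Linf_mean_value[OF d])
      fix w assume w: "w \<in> closed_segment u v"
      have "closed_segment u v \<subseteq> cball 0 R" using uv by (intro closed_segment_subset) auto
      then have "norm w \<le> R" using w by auto
      moreover have "norm (w - u) < \<delta> R e" using segment_bound1[OF w] uv(3) by (metis le_less_trans)
      ultimately show "AE x in I01. \<forall>h. norm (J w x *v h - J u x *v h) \<le> e / 2 * norm h"
        using \<delta>(2)[OF e uv(1)] by blast
    qed (use e in auto)
    then show ?thesis by simp
  qed
  obtain D0 :: "(real^'n) set" where D0: "countable D0" "\<And>X. open X \<Longrightarrow> X \<noteq> {} \<Longrightarrow> \<exists>d\<in>D0. d \<in> X"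
    using countable_dense_exists by blast
  \<comment> \<open>The origin is included so that the Jacobian there equals \<open>J 0\<close>, for
    which an essential bound is known.\<close>
  define D where "D = insert 0 D0"
  have D: "countable D" "0 \<in> D" using D0 by (auto simp: D_def)
  have cl: "closure D = UNIV"
  proof -
    have "- closure D = {}" using D0(2)[of "- closure D"] closure_subset[of D] by (force simp: D_def)
    then show ?thesis by auto
  qed
  have "AE x in I01. \<forall>u\<in>D. \<forall>v\<in>D. \<forall>k l. norm u \<le> real k \<longrightarrow> norm v \<le> real k \<longrightarrow>
       norm (v - u) < \<delta> (real k) (1 / real (Suc l)) \<longrightarrow>
       norm (f x v - f x u - J u x *v (v - u)) \<le> 1 / real (Suc l) * norm (v - u) \<and>
       (\<forall>h. norm (J v x *v h - J u x *v h) \<le> 1 / real (Suc l) * norm h)"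
  proof (subst AE_ball_countable[OF D(1)], rule ballI, subst AE_ball_countable[OF D(1)], rule ballI,
      subst AE_all_countable, rule allI, subst AE_all_countable, rule allI)
    fix u v :: "real^'n" and k l :: nat
    let ?e = "1 / real (Suc l)"
    show "AE x in I01. norm u \<le> real k \<longrightarrow> norm v \<le> real k \<longrightarrow> norm (v - u) < \<delta> (real k) ?e \<longrightarrow>
       norm (f x v - f x u - J u x *v (v - u)) \<le> ?e * norm (v - u) \<and>
       (\<forall>h. norm (J v x *v h - J u x *v h) \<le> ?e * norm h)"
    proof (cases "norm u \<le> real k \<and> norm v \<le> real k \<and> norm (v - u) < \<delta> (real k) ?e")
      case True
      then have "AE x in I01. norm (f x v - f x u - J u x *v (v - u)) \<le> ?e * norm (v - u)"
        "AE x in I01. \<forall>h. norm (J v x *v h - J u x *v h) \<le> ?e / 2 * norm h"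
        using mv[of ?e u "real k" v] \<delta>(2)[of ?e u "real k" v] by auto
      then show ?thesis
      proof eventually_elim
        case (elim x)
        have "?e / 2 \<le> ?e"
        proof -
          have "t / 2 \<le> t" if "0 \<le> t" for t :: real using that by simp
          note this[of ?e]
          moreover have "0 \<le> ?e" by simp
          ultimately show ?thesis by blast
        qed
        then have "?e / 2 * norm h \<le> ?e * norm h" for h :: "real^'n" by (rule mult_right_mono) simp
        then show ?case using elim by (meson order_trans)
      qed
    qed auto
  qed
  moreover have "AE x in I01. continuous_on UNIV (f x)" using rep by (simp add: continuous_representative_def)
  ultimately have good: "AE x in I01. (\<forall>u. (f x has_derivative (\<lambda>h. jacobian (f x) (at u) *v h)) (at u)) \<and>
      (\<forall>k l u v h. norm u < real k \<longrightarrow> norm v < real k \<longrightarrow> norm (v - u) < \<delta> (real k) (1 / real (Suc l)) \<longrightarrow>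
        norm (jacobian (f x) (at v) *v h - jacobian (f x) (at u) *v h) \<le> 1 / real (Suc l) * norm h) \<and>
      jacobian (f x) (at 0) = J 0 x"
  proof eventually_elim
    case (elim x)
    note * = differentiable_from_dense[where F="f x" and D=D and \<delta>=\<delta> and G="\<lambda>u. J u x", OF elim(2) cl \<delta>(1)]
    show ?case
    proof (intro conjI allI impI)
      show "(f x has_derivative (\<lambda>h. jacobian (f x) (at u) *v h)) (at u)" for u
        by (rule *(1)) (use elim(1) in blast)+
      show "norm (jacobian (f x) (at v) *v h - jacobian (f x) (at u) *v h) \<le> 1 / real (Suc l) * norm h"
        if "norm u < real k" "norm v < real k" "norm (v - u) < \<delta> (real k) (1 / real (Suc l))" for k l u v h
        by (rule *(2)[OF _ _ that]) (use elim(1) in blast)+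
      show "jacobian (f x) (at 0) = J 0 x"
        by (rule *(3)[OF _ _ D(2)]) (use elim(1) in blast)+
    qed
  qed
  show "AE x in I01. \<forall>u. (f x has_derivative (\<lambda>h. jacobian (f x) (at u) *v h)) (at u)"
    using good by eventually_elim blast
  show "\<exists>C\<ge>0. AE x in I01. \<forall>h. norm (jacobian (f x) (at 0) *v h) \<le> C * norm h"
  proof -
    obtain C where C: "C \<ge> 0" "AE x in I01. \<forall>h. norm (J 0 x *v h) \<le> C * norm h" using b by blast
    have "AE x in I01. \<forall>h. norm (jacobian (f x) (at 0) *v h) \<le> C * norm h"
      using good C(2) by eventually_elim simp
    then show ?thesis using C(1) by blast
  qed
  fix R e :: real assume e: "e > 0"
  obtain l where "inverse (real (Suc l)) < e" using reals_Archimedean[OF e] by auto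
  then have l: "1 / real (Suc l) \<le> e" by (simp add: inverse_eq_divide)
  obtain k where k: "R < real k" using reals_Archimedean2 by blast
  show "\<exists>d>0. AE x in I01. \<forall>u v h. norm u \<le> R \<longrightarrow> norm v \<le> R \<longrightarrow> norm (v - u) < d \<longrightarrow>
        norm (jacobian (f x) (at v) *v h - jacobian (f x) (at u) *v h) \<le> e * norm h"
  proof (intro exI[of _ "\<delta> (real k) (1 / real (Suc l))"] conjI)
    show "0 < \<delta> (real k) (1 / real (Suc l))" by (simp add: \<delta>)
    show "AE x in I01. \<forall>u v h. norm u \<le> R \<longrightarrow> norm v \<le> R \<longrightarrow> norm (v - u) < \<delta> (real k) (1 / real (Suc l)) \<longrightarrow>
        norm (jacobian (f x) (at v) *v h - jacobian (f x) (at u) *v h) \<le> e * norm h"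
      using good
    proof eventually_elim
      case (elim x)
      show ?case
      proof (intro allI impI)
        fix u v h :: "real^'n"
        assume "norm u \<le> R" "norm v \<le> R" "norm (v - u) < \<delta> (real k) (1 / real (Suc l))"
        then have "norm (jacobian (f x) (at v) *v h - jacobian (f x) (at u) *v h) \<le> 1 / real (Suc l) * norm h"
          using elim k by (meson le_less_trans)
        also have "\<dots> \<le> e * norm h" by (rule mult_right_mono[OF l]) simp
        finally show "norm (jacobian (f x) (at v) *v h - jacobian (f x) (at u) *v h) \<le> e * norm h" .
      qed
    qed
  qed
qed

section \<open>The shooting method\<close>

definition ess_bdd :: "(real \<Rightarrow> 'a::euclidean_space) \<Rightarrow> bool"
  where "ess_bdd h \<longleftrightarrow> h \<in> borel_measurable I01 \<and> (\<exists>C. AE x in I01. norm (h x) \<le> C)"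

lemma ess_bddI: "h \<in> borel_measurable I01 \<Longrightarrow> AE x in I01. norm (h x) \<le> C \<Longrightarrow> ess_bdd h"
  by (auto simp: ess_bdd_def)

lemma ess_bdd_integrable: "ess_bdd h \<Longrightarrow> integrable I01 h"
  by (auto simp: ess_bdd_def intro: integrable_bounded_I01)

lemma ess_bdd_measurable: "ess_bdd h \<Longrightarrow> h \<in> borel_measurable I01"
  by (simp add: ess_bdd_def)

lemma ess_bdd_const: "ess_bdd (\<lambda>_. c)"
  by (auto simp: ess_bdd_def)

lemma ess_bdd_add: "ess_bdd f \<Longrightarrow> ess_bdd g \<Longrightarrow> ess_bdd (\<lambda>x. f x + g x)"
  unfolding ess_bdd_def
proof (elim conjE exE)
  fix C D assume "f \<in> borel_measurable I01" "g \<in> borel_measurable I01"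
    and C: "AE x in I01. norm (f x) \<le> C" and D: "AE x in I01. norm (g x) \<le> D"
  moreover have "AE x in I01. norm (f x + g x) \<le> C + D"
    using C D by eventually_elim (rule norm_triangle_mono)
  ultimately show "(\<lambda>x. f x + g x) \<in> borel_measurable I01 \<and> (\<exists>C. AE x in I01. norm (f x + g x) \<le> C)" by auto
qed

lemma ess_bdd_minus: "ess_bdd f \<Longrightarrow> ess_bdd (\<lambda>x. - f x)"
  unfolding ess_bdd_def by auto

lemma ess_bdd_diff: "ess_bdd f \<Longrightarrow> ess_bdd g \<Longrightarrow> ess_bdd (\<lambda>x. f x - g x)"
  using ess_bdd_add[OF _ ess_bdd_minus, of f g] by simp

lemma ess_bdd_norm: "ess_bdd f \<Longrightarrow> ess_bdd (\<lambda>x. norm (f x))"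
  unfolding ess_bdd_def by auto

lemma ess_bdd_scaleR: "ess_bdd f \<Longrightarrow> ess_bdd (\<lambda>x. c *\<^sub>R f x)"
  unfolding ess_bdd_def
proof (elim conjE exE)
  fix C assume "f \<in> borel_measurable I01" and C: "AE x in I01. norm (f x) \<le> C"
  moreover have "AE x in I01. norm (c *\<^sub>R f x) \<le> \<bar>c\<bar> * C"
    using C by eventually_elim (simp add: mult_left_mono)
  ultimately show "(\<lambda>x. c *\<^sub>R f x) \<in> borel_measurable I01 \<and> (\<exists>C. AE x in I01. norm (c *\<^sub>R f x) \<le> C)" by auto
qed

lemma ess_bdd_sum: "finite A \<Longrightarrow> (\<And>i. i \<in> A \<Longrightarrow> ess_bdd (f i)) \<Longrightarrow> ess_bdd (\<lambda>x. \<Sum>i\<in>A. f i x)"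
  by (induction A rule: finite_induct) (auto intro: ess_bdd_const ess_bdd_add)

lemma ess_bdd_prim: "ess_bdd h \<Longrightarrow> ess_bdd (prim h)"
  using ess_bdd_integrable[of h]
  by (intro ess_bddI[of _ "\<integral>y. norm (h y) \<partial>I01"] measurable_prim) (auto intro!: AE_I2 norm_prim_le_integral)

lemma ess_bdd_prim_bounded: "ess_bdd h \<Longrightarrow> \<exists>C. \<forall>x. norm (prim h x) \<le> C"
  using ess_bdd_integrable[of h] norm_prim_le_integral[of h] by blast

definition mat_bdd :: "(real \<Rightarrow> real^'n^'n) \<Rightarrow> real \<Rightarrow> bool"
  where "mat_bdd N r \<longleftrightarrow> N \<in> borel_measurable I01 \<and> (AE x in I01. \<forall>v. norm (N x *v v) \<le> r * norm v)"

lemma ess_bdd_mult: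
  assumes "mat_bdd N r" "ess_bdd h" "r \<ge> 0"
  shows "ess_bdd (\<lambda>x. N x *v h x)"
proof -
  obtain C where "h \<in> borel_measurable I01" "AE x in I01. norm (h x) \<le> C" using assms by (auto simp: ess_bdd_def)
  with assms bounded_matrix_mult[of N r h C] show ?thesis unfolding mat_bdd_def by (auto intro!: ess_bddI)
qed

lemma prim_ess_bdd_diff: "ess_bdd f \<Longrightarrow> ess_bdd g \<Longrightarrow> prim (\<lambda>y. f y - g y) x = prim f x - prim g x"
  by (intro prim_diff ess_bdd_integrable)

lemma prim_ess_bdd_add: "ess_bdd f \<Longrightarrow> ess_bdd g \<Longrightarrow> prim (\<lambda>y. f y + g y) x = prim f x + prim g x"
  by (intro prim_add ess_bdd_integrable)

lemma prim_sum: "finite A \<Longrightarrow> (\<And>i. i \<in> A \<Longrightarrow> ess_bdd (f i)) \<Longrightarrow> prim (\<lambda>x. \<Sum>i\<in>A. f i x) x = (\<Sum>i\<in>A. prim (f i) x)"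
  by (induction A rule: finite_induct) (auto simp: prim_ess_bdd_add ess_bdd_sum)

section \<open>Bounds, stability and solvability for the Volterra equation\<close>

lemma norm_prim_mat_bdd_le:
  assumes "mat_bdd N r" "r \<ge> 0" "ess_bdd h" "AE y in I01. norm (h y) \<le> C"
  shows "norm (prim (\<lambda>y. N y *v h y) x) \<le> r * C"
proof (rule norm_prim_le_const)
  show "(\<lambda>y. N y *v h y) \<in> borel_measurable I01" using ess_bdd_mult[OF assms(1,3,2)] by (rule ess_bdd_measurable)
  have "AE y in I01. \<forall>v. norm (N y *v v) \<le> r * norm v" using assms(1) by (simp add: mat_bdd_def)
  with assms(4) show "AE y in I01. norm (N y *v h y) \<le> r * C"
    by eventually_elim (meson assms(2) mult_left_mono order_trans)
qed

text \<open>The term with \<beta> leads to a double primitive of \<phi>, absorbed by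
  \<open>prim_prim_le\<close>, the term with \<alpha> to a single one. The resulting factor 2 r
  enters the Gronwall and contraction constants below.\<close>

lemma Volterra_bound:
  fixes N :: "real \<Rightarrow> real^'n^'n"
  assumes N: "mat_bdd N r" "r \<ge> 0" and \<alpha>: "ess_bdd \<alpha>" and \<beta>: "ess_bdd \<beta>" and \<phi>: "ess_bdd \<phi>"
    and le: "AE y in I01. norm (\<alpha> y) \<le> \<phi> y" "AE y in I01. norm (\<beta> y) \<le> \<phi> y"
  shows "norm (prim (\<lambda>y. N y *v (prim \<beta> y - \<alpha> y)) x) \<le> 2 * r * prim \<phi> x"
proof -
  note i = ess_bdd_integrable[OF \<phi>]
  note ip = ess_bdd_integrable[OF ess_bdd_prim[OF \<phi>]]
  have nn: "AE y in I01. 0 \<le> \<phi> y" using le(1) by eventually_elim (meson norm_ge_zero order_trans)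
  have Nb: "AE y in I01. \<forall>v. norm (N y *v v) \<le> r * norm v" using N by (simp add: mat_bdd_def)
  have "norm (prim (\<lambda>y. N y *v (prim \<beta> y - \<alpha> y)) x) \<le> prim (\<lambda>y. r * (prim \<phi> y + \<phi> y)) x"
  proof (rule norm_prim_le)
    show "integrable I01 (\<lambda>y. r * (prim \<phi> y + \<phi> y))" using i ip by simp
    show "(\<lambda>y. N y *v (prim \<beta> y - \<alpha> y)) \<in> borel_measurable I01"
      by (rule ess_bdd_measurable[OF ess_bdd_mult[OF N(1) _ N(2)]]) (intro ess_bdd_diff ess_bdd_prim \<alpha> \<beta>)
    show "AE y in I01. norm (N y *v (prim \<beta> y - \<alpha> y)) \<le> r * (prim \<phi> y + \<phi> y)"
      using Nb le(1)
    proof eventually_elim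
      case (elim y)
      have "norm (prim \<beta> y - \<alpha> y) \<le> norm (prim \<beta> y) + norm (\<alpha> y)" by (rule norm_triangle_ineq4)
      also have "norm (prim \<beta> y) \<le> prim \<phi> y" by (rule norm_prim_le[OF i ess_bdd_measurable[OF \<beta>] le(2)])
      finally have "norm (prim \<beta> y - \<alpha> y) \<le> prim \<phi> y + \<phi> y" using elim(2) by simp
      then show ?case using elim(1) N(2) by (meson mult_left_mono order_trans)
    qed
  qed
  also have "\<dots> = r * (prim (prim \<phi>) x + prim \<phi> x)"
    using i ip by (simp add: prim_mult prim_add)
  also have "\<dots> \<le> r * (prim \<phi> x + prim \<phi> x)"
    using prim_prim_le[OF i ip nn, of x] N(2) by (intro mult_left_mono) auto
  finally show ?thesis by simp
qed

lemma ess_bdd_Lipschitz_superposition: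
  assumes u: "ess_bdd u" and m: "(\<lambda>x. f x (u x)) \<in> borel_measurable I01"
    and 0: "AE x in I01. norm (f x 0) \<le> B"
    and lip: "AE x in I01. \<forall>v w. norm (f x v - f x w) \<le> L * norm (v - w)" and L: "L \<ge> 0"
  shows "ess_bdd (\<lambda>x. f x (u x))"
proof -
  obtain C where C: "AE x in I01. norm (u x) \<le> C" using u by (auto simp: ess_bdd_def)
  have "AE x in I01. norm (f x (u x)) \<le> B + L * C"
    using 0 lip C
  proof eventually_elim
    case (elim x)
    have "norm (f x (u x)) \<le> norm (f x 0) + norm (f x (u x) - f x 0)" by (rule norm_triangle_sub)
    moreover have "norm (f x (u x) - f x 0) \<le> L * norm (u x - 0)" using elim(2) by blast
    moreover have "L * norm (u x - 0) \<le> L * C" using elim(3) L by (intro mult_left_mono) auto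
    ultimately show ?case using elim(1) by linarith
  qed
  then show ?thesis by (rule ess_bddI[OF m])
qed

text \<open>The difference of two approximate solutions with residuals R and S satisfies a Gronwall
  inequality with constant 2 r L. The functions f1, f2, g1, g2 are already superposed, so the
  estimate serves the nonlinear and the linearized equation alike; a solution belonging to another
  matrix is covered by moving the discrepancy into its residual.\<close>

lemma shoot_diff_bound:
  fixes N :: "real \<Rightarrow> real^'n^'n"
  assumes N: "mat_bdd N r" "r \<ge> 1" and L: "L > 0"
    and ess_bdd: "ess_bdd f1" "ess_bdd f2" "ess_bdd g1" "ess_bdd g2"
    and U: "\<And>x. U x = prim (\<lambda>y. N y *v (p - f1 y + prim g1 y)) x + R x"
    and V: "\<And>x. V x = prim (\<lambda>y. N y *v (q - f2 y + prim g2 y)) x + S x"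
    and m: "U \<in> borel_measurable I01" "V \<in> borel_measurable I01"
    and b: "\<And>x. norm (U x) \<le> B" "\<And>x. norm (V x) \<le> B"
    and \<rho>: "\<And>x. norm (R x - S x) \<le> \<rho>"
    and le: "AE x in I01. norm (f1 x - f2 x) \<le> L * norm (U x - V x)"
      "AE x in I01. norm (g1 x - g2 x) \<le> L * norm (U x - V x)"
  shows "norm (U x - V x) \<le> 2 * exp (4 * r * L) * r * (norm (p - q) + \<rho>)"
proof -
  let ?D = "\<lambda>x. norm (U x - V x)"
  have r: "r \<ge> 0" using N by simp
  have \<rho>0: "\<rho> \<ge> 0" using \<rho>[of 0] norm_ge_zero order_trans by blast
  have bD: "\<bar>?D x\<bar> \<le> 2 * B" for x
    using norm_triangle_ineq4[of "U x" "V x"] b[of x] by simp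
  have mD: "?D \<in> borel_measurable I01" using m by simp
  have Dbm: "ess_bdd (\<lambda>x. L * ?D x)"
    using ess_bdd_scaleR[of ?D L] ess_bddI[OF mD, of "2*B"] bD by simp
  have G: "?D x \<le> (r * norm (p - q) + \<rho>) + (2 * r * L) * prim ?D x" for x
  proof -
    let ?h = "\<lambda>y. prim (\<lambda>z. g1 z - g2 z) y - (f1 y - f2 y)"
    have hbm: "ess_bdd ?h" by (intro ess_bdd_diff ess_bdd_prim ess_bdd)
    have "prim (\<lambda>y. N y *v (p - f1 y + prim g1 y)) x - prim (\<lambda>y. N y *v (q - f2 y + prim g2 y)) x
      = prim (\<lambda>y. N y *v (p - f1 y + prim g1 y) - N y *v (q - f2 y + prim g2 y)) x"
      by (intro prim_ess_bdd_diff[symmetric] ess_bdd_mult[OF N(1) _ r] ess_bdd_add ess_bdd_diff ess_bdd_const ess_bdd_prim ess_bdd)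
    also have "(\<lambda>y. N y *v (p - f1 y + prim g1 y) - N y *v (q - f2 y + prim g2 y)) = (\<lambda>y. N y *v (p - q) + N y *v ?h y)"
      by (simp add: prim_ess_bdd_diff ess_bdd algebra_simps flip: matrix_vector_mult_diff_distrib matrix_vector_right_distrib)
    also have "prim \<dots> x = prim (\<lambda>y. N y *v (p - q)) x + prim (\<lambda>y. N y *v ?h y) x"
      by (intro prim_ess_bdd_add ess_bdd_mult[OF N(1) _ r] ess_bdd_const hbm)
    finally have "U x - V x = prim (\<lambda>y. N y *v (p - q)) x + prim (\<lambda>y. N y *v ?h y) x + (R x - S x)"
      using U[of x] V[of x] by simp
    then have "?D x \<le> norm (prim (\<lambda>y. N y *v (p - q)) x) + norm (prim (\<lambda>y. N y *v ?h y) x) + norm (R x - S x)"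
      using norm_triangle_ineq[of "prim (\<lambda>y. N y *v (p - q)) x + prim (\<lambda>y. N y *v ?h y) x" "R x - S x"]
        norm_triangle_ineq[of "prim (\<lambda>y. N y *v (p - q)) x" "prim (\<lambda>y. N y *v ?h y) x"] by simp
    also have "norm (prim (\<lambda>y. N y *v (p - q)) x) \<le> r * norm (p - q)"
      by (rule norm_prim_mat_bdd_le[OF N(1) r ess_bdd_const]) simp
    also have "norm (prim (\<lambda>y. N y *v ?h y) x) \<le> 2 * r * prim (\<lambda>x. L * ?D x) x"
      by (rule Volterra_bound[OF N(1) r _ _ Dbm le]) (intro ess_bdd_diff ess_bdd)+
    also have "prim (\<lambda>x. L * ?D x) x = L * prim ?D x" by (rule prim_mult)
    finally show ?thesis using \<rho>[of x] by simp
  qed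
  have "?D x \<le> 2 * exp (2 * (2 * r * L)) * (r * norm (p - q) + \<rho>)"
    by (rule Volterra_Gronwall[OF mD bD _ _ _ G]) (use N L r \<rho>0 in auto)
  also have "\<dots> \<le> 2 * exp (2 * (2 * r * L)) * (r * (norm (p - q) + \<rho>))"
    using mult_right_mono[OF N(2) \<rho>0] by (intro mult_left_mono) (auto simp: algebra_simps)
  finally show ?thesis by (simp add: mult_ac)
qed

text \<open>Picard iteration in the weighted norm \<open>sup \<bar>u x\<bar> / weight l x\<close>, in which the Volterra operator
  is a contraction for large \<open>l\<close>.\<close>

lemma shoot_exists:
  fixes N :: "real \<Rightarrow> real^'n^'n" and f g :: "real \<Rightarrow> real^'n \<Rightarrow> real^'n"
  assumes N: "mat_bdd N r" "r \<ge> 1" and L: "L > 0"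
    and m: "\<And>u. u \<in> borel_measurable I01 \<Longrightarrow> (\<lambda>x. f x (u x)) \<in> borel_measurable I01"
      "\<And>u. u \<in> borel_measurable I01 \<Longrightarrow> (\<lambda>x. g x (u x)) \<in> borel_measurable I01"
    and 0: "AE x in I01. norm (f x 0) \<le> B" "AE x in I01. norm (g x 0) \<le> B"
    and lip: "AE x in I01. \<forall>v w. norm (f x v - f x w) \<le> L * norm (v - w)"
      "AE x in I01. \<forall>v w. norm (g x v - g x w) \<le> L * norm (v - w)"
  obtains U where "\<And>x. U x = shoot N f g p U x" "continuous_on UNIV U" "\<exists>b. \<forall>x. norm (U x) \<le> b"
proof -
  have r: "r \<ge> 0" using N by simp
  \<comment> \<open>The contraction factor is the product of 2 r from \<open>Volterra_bound\<close>,
    the Lipschitz constant L and 1 / l from the weight, that is, 1/2.\<close>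
  define l where "l = 4 * r * L"
  have l: "l > 0" using N L by (simp add: l_def)
  let ?w = "weight l"
  have w1: "1 \<le> ?w x" for x using l by (simp add: weight_bounds)
  have w0: "0 < ?w x" for x by (rule weight_bounds)
  have bmF: "ess_bdd (\<lambda>x. f x (u x))" "ess_bdd (\<lambda>x. g x (u x))" if "ess_bdd u" for u
    using ess_bdd_Lipschitz_superposition[OF that m(1) 0(1) lip(1)]
      ess_bdd_Lipschitz_superposition[OF that m(2) 0(2) lip(2)] ess_bdd_measurable[OF that] L by auto
  define H where "H = (\<lambda>u y. p - f y (u y) + prim (\<lambda>z. g z (u z)) y)"
  have bmH: "ess_bdd (H u)" if "ess_bdd u" for u unfolding H_def by (intro ess_bdd_add ess_bdd_diff ess_bdd_const ess_bdd_prim bmF that)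
  have slope: "shoot_slope N f g p u = (\<lambda>y. N y *v H u y)" for u by (auto simp: shoot_slope_def H_def)
  have bmS: "ess_bdd (shoot_slope N f g p u)" if "ess_bdd u" for u
    unfolding slope by (rule ess_bdd_mult[OF N(1) bmH[OF that] r])
  have bmW: "ess_bdd (\<lambda>x. ?w x *\<^sub>R apply_bcontfun v x)" for v :: "real \<Rightarrow>\<^sub>C (real^'n)"
  proof (rule ess_bddI[of _ "exp l * norm v"])
    show "(\<lambda>x. ?w x *\<^sub>R apply_bcontfun v x) \<in> borel_measurable I01"
      by (intro continuous_measurable_I01 continuous_intros continuous_weight continuous_on_apply_bcontfun)
    show "AE x in I01. norm (?w x *\<^sub>R apply_bcontfun v x) \<le> exp l * norm v"
      using l w0 by (intro AE_I2) (auto intro!: mult_mono norm_bounded simp: weight_bounds abs_of_pos less_imp_le)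
  qed
  \<comment> \<open>Conjugation with the weight turns the weighted norm into the plain sup norm of
    bounded continuous functions, whose type is a complete metric space.\<close>
  define T where "T = (\<lambda>v :: real \<Rightarrow>\<^sub>C (real^'n). Bcontfun (\<lambda>x. (1 / ?w x) *\<^sub>R shoot N f g p (\<lambda>x. ?w x *\<^sub>R apply_bcontfun v x) x))"
  have T: "apply_bcontfun (T v) x = (1 / ?w x) *\<^sub>R shoot N f g p (\<lambda>x. ?w x *\<^sub>R apply_bcontfun v x) x" for v x
  proof -
    let ?u = "\<lambda>x. ?w x *\<^sub>R apply_bcontfun v x"
    obtain C where C: "\<And>x. norm (shoot N f g p ?u x) \<le> C" using ess_bdd_prim_bounded[OF bmS[OF bmW]] by blast
    have C0: "0 \<le> C" using C[of 0] norm_ge_zero order_trans by blast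
    have "(\<lambda>x. (1 / ?w x) *\<^sub>R shoot N f g p ?u x) \<in> bcontfun"
    proof (rule bcontfun_normI)
      show "continuous_on UNIV (\<lambda>x. (1 / ?w x) *\<^sub>R shoot N f g p ?u x)"
        by (intro continuous_intros continuous_weight continuous_prim ess_bdd_integrable bmS bmW)
          (use w0 in \<open>auto simp: less_imp_neq[symmetric]\<close>)
      show "norm ((1 / ?w x) *\<^sub>R shoot N f g p ?u x) \<le> C" for x
      proof -
        have "norm ((1 / ?w x) *\<^sub>R shoot N f g p ?u x) = norm (shoot N f g p ?u x) / ?w x"
          using w0[of x] by simp
        also have "\<dots> \<le> C / 1" using C[of x] w1[of x] C0 by (intro frac_le) auto
        finally show ?thesis by simp
      qed
    qed
    then show ?thesis by (simp add: T_def Bcontfun_inverse)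
  qed
  have "\<exists>!v. T v = v"
  proof (rule banach_fix_type[of "1/2"], simp, simp, intro allI)
    fix v v' :: "real \<Rightarrow>\<^sub>C (real^'n)"
    let ?u = "\<lambda>x. ?w x *\<^sub>R apply_bcontfun v x" and ?u' = "\<lambda>x. ?w x *\<^sub>R apply_bcontfun v' x"
    show "dist (T v) (T v') \<le> 1 / 2 * dist v v'"
    proof (rule dist_bound)
      fix x
      let ?\<alpha> = "\<lambda>y. f y (?u y) - f y (?u' y)" and ?\<beta> = "\<lambda>y. g y (?u y) - g y (?u' y)"
      let ?\<phi> = "\<lambda>y. L * norm (?u y - ?u' y)"
      have uu: "ess_bdd (\<lambda>y. norm (?u y - ?u' y))" by (intro ess_bdd_norm ess_bdd_diff bmW)
      have ess_bdd\<phi>: "ess_bdd ?\<phi>" using ess_bdd_scaleR[OF uu, of L] by simp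
      have "shoot N f g p ?u x - shoot N f g p ?u' x = prim (\<lambda>y. N y *v H ?u y - N y *v H ?u' y) x"
        unfolding slope by (intro prim_ess_bdd_diff[symmetric] ess_bdd_mult[OF N(1) _ r] bmH bmW)
      also have "(\<lambda>y. N y *v H ?u y - N y *v H ?u' y) = (\<lambda>y. N y *v (prim ?\<beta> y - ?\<alpha> y))"
        using bmF[OF bmW, of v] bmF[OF bmW, of v']
        by (simp add: H_def prim_ess_bdd_diff algebra_simps flip: matrix_vector_mult_diff_distrib)
      finally have "norm (shoot N f g p ?u x - shoot N f g p ?u' x) = norm (prim (\<lambda>y. N y *v (prim ?\<beta> y - ?\<alpha> y)) x)"
        by simp
      also have "\<dots> \<le> 2 * r * prim ?\<phi> x"
      proof (rule Volterra_bound[OF N(1) r _ _ ess_bdd\<phi>])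
        show "AE y in I01. norm (?\<alpha> y) \<le> ?\<phi> y" using lip(1) by eventually_elim blast
        show "AE y in I01. norm (?\<beta> y) \<le> ?\<phi> y" using lip(2) by eventually_elim blast
      qed (intro ess_bdd_diff bmF bmW)+
      also have "prim ?\<phi> x \<le> (L * dist v v') * ?w x / l"
      proof (rule prim_weighted_le[OF l])
        show "?\<phi> \<in> borel_measurable I01" by (rule ess_bdd_measurable[OF ess_bdd\<phi>])
        have "\<bar>?\<phi> y\<bar> \<le> L * dist v v' * ?w y" for y
        proof -
          have "norm (?u y - ?u' y) = ?w y * dist (apply_bcontfun v y) (apply_bcontfun v' y)"
            using w0[of y] by (simp add: dist_norm flip: scaleR_diff_right)
          also have "\<dots> \<le> ?w y * dist v v'" using w0[of y] by (intro mult_left_mono dist_bounded) auto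
          finally show ?thesis using L by (simp add: mult_ac)
        qed
        then show "AE y in I01. \<bar>?\<phi> y\<bar> \<le> L * dist v v' * ?w y" by simp
      qed (use L in auto)
      finally have "norm (shoot N f g p ?u x - shoot N f g p ?u' x) \<le> 2 * r * ((L * dist v v') * ?w x / l)"
        using r by (simp add: mult_left_mono)
      also have "\<dots> = (1 / 2 * dist v v') * ?w x" using N L by (simp add: l_def)
      finally have "norm (shoot N f g p ?u x - shoot N f g p ?u' x) / ?w x \<le> 1 / 2 * dist v v'"
        using w0[of x] by (simp add: pos_divide_le_eq)
      moreover have "dist (apply_bcontfun (T v) x) (apply_bcontfun (T v') x) = norm (shoot N f g p ?u x - shoot N f g p ?u' x) / ?w x"
        using w0[of x] by (simp add: T dist_norm flip: scaleR_diff_right)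
      ultimately show "dist (apply_bcontfun (T v) x) (apply_bcontfun (T v') x) \<le> 1 / 2 * dist v v'" by simp
    qed
  qed
  then obtain v where v: "T v = v" by blast
  define U where "U = (\<lambda>x. ?w x *\<^sub>R apply_bcontfun v x)"
  have "U x = shoot N f g p U x" for x
    using T[of v x] w0[of x] unfolding v by (simp add: U_def)
  moreover have "continuous_on UNIV U" unfolding U_def by (intro continuous_intros continuous_weight continuous_on_apply_bcontfun)
  moreover have "\<exists>b. \<forall>x. norm (U x) \<le> b"
    using ess_bdd_prim_bounded[OF bmS[OF bmW[of v]]] calculation(1) unfolding U_def by metis
  ultimately show thesis by (rule that)
qed

text \<open>In the application \<open>a\<close> and \<open>b\<close> are the Jacobian matrices of
  \<open>f\<close> and \<open>g\<close> along \<open>U0\<close>, \<open>lam\<close> bounds them, and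
  \<open>r\<close> bounds \<open>N0\<close> and the perturbed inverses. \<open>modulus\<close> is
  differentiability along \<open>U0\<close>, uniform in x and in the two-point form that a
  contraction argument needs. Nondegeneracy is phrased for the initial flux q, the unknown of the
  shooting equation.\<close>

locale shooting =
  fixes f g :: "real \<Rightarrow> real^'n \<Rightarrow> real^'n" and a b N0 :: "real \<Rightarrow> real^'n^'n"
    and U0 :: "real \<Rightarrow> real^'n" and p0 :: "real^'n" and r lam :: real
  assumes r: "r \<ge> 1" and lam: "lam \<ge> 0"
    and f_meas: "\<And>u. u \<in> borel_measurable I01 \<Longrightarrow> (\<lambda>x. f x (u x)) \<in> borel_measurable I01"
    and g_meas: "\<And>u. u \<in> borel_measurable I01 \<Longrightarrow> (\<lambda>x. g x (u x)) \<in> borel_measurable I01"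
    and U0_meas: "U0 \<in> borel_measurable I01" and U0_bound: "\<exists>B. \<forall>x. norm (U0 x) \<le> B"
    and ab: "mat_bdd a lam" "mat_bdd b lam" and N0: "mat_bdd N0 r"
    and fgU0: "ess_bdd (\<lambda>x. f x (U0 x))" "ess_bdd (\<lambda>x. g x (U0 x))"
    and modulus: "\<And>e. e > 0 \<Longrightarrow> \<exists>\<delta>>0. AE x in I01. \<forall>v w. norm (v - U0 x) \<le> \<delta> \<longrightarrow> norm (w - U0 x) \<le> \<delta> \<longrightarrow>
        norm (f x v - f x w - a x *v (v - w)) \<le> e * norm (v - w) \<and>
        norm (g x v - g x w - b x *v (v - w)) \<le> e * norm (v - w)"
    and U0: "\<And>x. U0 x = shoot N0 f g p0 U0 x" "U0 1 = 0"
    and nondegenerate: "\<And>q X. (\<And>x. X x = shoot N0 (\<lambda>x v. a x *v v) (\<lambda>x v. b x *v v) q X x) \<Longrightarrow>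
        X \<in> borel_measurable I01 \<Longrightarrow> \<exists>B. \<forall>x. norm (X x) \<le> B \<Longrightarrow> X 1 = 0 \<Longrightarrow> q = 0"
begin

section \<open>Fundamental solutions of the linearized homogenized problem\<close>

lemma r0: "r \<ge> 0" using r by simp

definition fundamental_solution :: "'n \<Rightarrow> (real \<Rightarrow> real^'n) \<Rightarrow> bool"
  where "fundamental_solution i X \<longleftrightarrow>
    (\<forall>x. X x = shoot N0 (\<lambda>x v. a x *v v) (\<lambda>x v. b x *v v) (axis i 1) X x) \<and>
    continuous_on UNIV X \<and> (\<exists>B. \<forall>x. norm (X x) \<le> B)"

definition X :: "'n \<Rightarrow> real \<Rightarrow> real^'n" where "X i = (SOME X. fundamental_solution i X)"

lemma mult_meas:
  fixes c :: "real \<Rightarrow> real^'n^'n"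
  assumes "mat_bdd c s" "u \<in> borel_measurable I01"
  shows "(\<lambda>x. c x *v u x) \<in> borel_measurable I01"
proof -
  have cont: "continuous_on UNIV (\<lambda>z :: (real^'n^'n) \<times> (real^'n). fst z *v snd z)"
    by (intro bounded_bilinear.continuous_on[OF bounded_bilinear_matrix_vector_mult] continuous_intros)
  show ?thesis
    using borel_measurable_continuous_Pair[where H="(*v)", OF _ assms(2) cont] assms(1) by (simp add: mat_bdd_def)
qed

lemma mult_Lipschitz:
  assumes "mat_bdd c lam"
  shows "AE x in I01. \<forall>v w. norm (c x *v v - c x *v w) \<le> (lam + 1) * norm (v - w)"
proof -
  have "AE x in I01. \<forall>v. norm (c x *v v) \<le> lam * norm v" using assms by (simp add: mat_bdd_def)
  then show ?thesis
  proof eventually_elim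
    case (elim x)
    show ?case
    proof (intro allI)
      fix v w
      have "norm (c x *v (v - w)) \<le> lam * norm (v - w)" using elim by blast
      also have "\<dots> \<le> (lam + 1) * norm (v - w)" by (intro mult_right_mono) auto
      finally show "norm (c x *v v - c x *v w) \<le> (lam + 1) * norm (v - w)"
        by (simp add: matrix_vector_mult_diff_distrib)
    qed
  qed
qed

lemma fundamental_solution_X: "fundamental_solution i (X i)"
proof -
  obtain Y where "\<And>x. Y x = shoot N0 (\<lambda>x v. a x *v v) (\<lambda>x v. b x *v v) (axis i 1) Y x"
    "continuous_on UNIV Y" "\<exists>B. \<forall>x. norm (Y x) \<le> B"
  proof (rule shoot_exists[OF N0 r])
    show "0 < lam + 1" using lam by simp
    show "(\<lambda>x. a x *v u x) \<in> borel_measurable I01" "(\<lambda>x. b x *v u x) \<in> borel_measurable I01"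
      if "u \<in> borel_measurable I01" for u
      using mult_meas[OF _ that] ab by blast+
    show "AE x in I01. norm (a x *v 0) \<le> 0" "AE x in I01. norm (b x *v 0) \<le> 0" by auto
    show "AE x in I01. \<forall>v w. norm (a x *v v - a x *v w) \<le> (lam + 1) * norm (v - w)"
      "AE x in I01. \<forall>v w. norm (b x *v v - b x *v w) \<le> (lam + 1) * norm (v - w)"
      using mult_Lipschitz ab by blast+
  qed (rule that)
  then have "fundamental_solution i Y" unfolding fundamental_solution_def by blast
  then show ?thesis unfolding X_def by (rule someI[of "fundamental_solution i"])
qed

lemma ess_bdd_X: "ess_bdd (X i)"
  using fundamental_solution_X[of i] unfolding fundamental_solution_def
  by (auto intro!: ess_bddI continuous_measurable_I01)

text \<open>The function to which \<open>N0\<close> is applied in the equation of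
  \<open>X i\<close>. Only through these n functions does the oscillation of a perturbed matrix act
  on the linearized problem.\<close>

definition H :: "'n \<Rightarrow> real \<Rightarrow> real^'n"
  where "H i y = axis i 1 - a y *v X i y + prim (\<lambda>z. b z *v X i z) y"

lemma ess_bdd_aX: "ess_bdd (\<lambda>z. a z *v X i z)" "ess_bdd (\<lambda>z. b z *v X i z)"
  using ess_bdd_mult[OF ab(1) ess_bdd_X lam] ess_bdd_mult[OF ab(2) ess_bdd_X lam] by auto

lemma ess_bdd_H: "ess_bdd (H i)"
  unfolding H_def[abs_def] by (intro ess_bdd_add ess_bdd_diff ess_bdd_const ess_bdd_prim ess_bdd_aX)

lemma X_eq: "X i x = prim (\<lambda>y. N0 y *v H i y) x"
  using fundamental_solution_X[of i]
  unfolding fundamental_solution_def shoot_slope_def[abs_def] H_def[abs_def] by blast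

text \<open>The solution of the linearized homogenized problem with initial flux q; it plays the
  role of the derivative of the homogenized solution with respect to its initial flux.\<close>

definition \<xi> :: "real^'n \<Rightarrow> real \<Rightarrow> real^'n" where "\<xi> q x = (\<Sum>i\<in>UNIV. (q $ i) *\<^sub>R X i x)"

definition Hq :: "real^'n \<Rightarrow> real \<Rightarrow> real^'n" where "Hq q x = (\<Sum>i\<in>UNIV. (q $ i) *\<^sub>R H i x)"

lemma matrix_mult_sum: "M *v (\<Sum>i\<in>A. c i *\<^sub>R v i) = (\<Sum>i\<in>A. c i *\<^sub>R (M *v v i))" for M :: "real^'n^'n"
  by (simp add: linear_sum[OF matrix_vector_mul_linear] matrix_vector_mult_scaleR)

lemma ess_bdd_\<xi>: "ess_bdd (\<xi> q)" unfolding \<xi>_def[abs_def] by (intro ess_bdd_sum ess_bdd_scaleR ess_bdd_X) simp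

lemma ess_bdd_Hq: "ess_bdd (Hq q)" unfolding Hq_def[abs_def] by (intro ess_bdd_sum ess_bdd_scaleR ess_bdd_H) simp

lemma \<xi>_bounded: "\<exists>B. \<forall>x. norm (\<xi> q x) \<le> B"
proof -
  have "\<exists>B. \<forall>x. norm (X i x) \<le> B" for i
    using fundamental_solution_X[of i] unfolding fundamental_solution_def by blast
  then have "\<forall>i. \<exists>B. \<forall>x. norm (X i x) \<le> B" by blast
  from choice[OF this] obtain B where B: "\<And>i x. norm (X i x) \<le> B i" by blast
  have "norm (\<xi> q x) \<le> (\<Sum>i\<in>UNIV. \<bar>q $ i\<bar> * B i)" for x
    unfolding \<xi>_def by (rule order_trans[OF norm_sum]) (auto intro!: sum_mono mult_left_mono B)
  then show ?thesis by blast
qed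

lemma Hq_eq: "Hq q y = q - a y *v \<xi> q y + prim (\<lambda>z. b z *v \<xi> q z) y"
proof -
  have "prim (\<lambda>z. b z *v \<xi> q z) y = (\<Sum>i\<in>UNIV. (q $ i) *\<^sub>R prim (\<lambda>z. b z *v X i z) y)"
    unfolding \<xi>_def matrix_mult_sum
    by (subst prim_sum) (auto intro: ess_bdd_scaleR ess_bdd_aX simp: prim_scaleR)
  moreover have "q = (\<Sum>i\<in>UNIV. (q $ i) *\<^sub>R axis i 1)"
    using basis_expansion[of q] by (simp add: scalar_mult_eq_scaleR)
  moreover have "a y *v \<xi> q y = (\<Sum>i\<in>UNIV. (q $ i) *\<^sub>R (a y *v X i y))"
    unfolding \<xi>_def matrix_mult_sum ..
  ultimately show ?thesis
    unfolding Hq_def H_def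
    by (simp add: scaleR_add_right scaleR_diff_right sum.distrib sum_subtractf)
qed

lemma \<xi>_eq: "\<xi> q x = prim (\<lambda>y. N0 y *v Hq q y) x"
proof -
  have "prim (\<lambda>y. N0 y *v Hq q y) x = (\<Sum>i\<in>UNIV. (q $ i) *\<^sub>R prim (\<lambda>y. N0 y *v H i y) x)"
    unfolding Hq_def matrix_mult_sum
    by (subst prim_sum) (auto intro: ess_bdd_scaleR ess_bdd_mult[OF N0 ess_bdd_H r0] simp: prim_scaleR)
  then show ?thesis by (simp add: \<xi>_def X_eq)
qed

lemma linear_\<xi>: "linear (\<lambda>q. \<xi> q x)"
  unfolding \<xi>_def by (intro linearI) (simp_all add: scaleR_add_left sum.distrib scaleR_sum_right)

text \<open>A flux q in the kernel would give a solution of the linearized problem vanishing at both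
  ends; here nondegeneracy enters.\<close>

lemma inj_\<xi>: "inj (\<lambda>q. \<xi> q 1)"
proof (subst linear_injective_0[OF linear_\<xi>], intro allI impI)
  fix q assume "\<xi> q 1 = 0"
  moreover have "\<xi> q x = shoot N0 (\<lambda>x v. a x *v v) (\<lambda>x v. b x *v v) q (\<xi> q) x" for x
    unfolding shoot_slope_def[abs_def] Hq_eq[symmetric] by (rule \<xi>_eq)
  ultimately show "q = 0"
    by (intro nondegenerate[of "\<xi> q" q] \<xi>_bounded ess_bdd_measurable[OF ess_bdd_\<xi>])
qed

text \<open>The effect of replacing \<open>N0\<close> by N in a primitive. In the application it is
  small for each fixed h, but not uniformly over bounded h, so later hypotheses mention specific h
  only.\<close>

definition osc :: "(real \<Rightarrow> real^'n^'n) \<Rightarrow> (real \<Rightarrow> real^'n) \<Rightarrow> real \<Rightarrow> real^'n"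
  where "osc N h x = prim (\<lambda>y. N y *v h y - N0 y *v h y) x"

lemma osc_eq:
  assumes "mat_bdd N r" "ess_bdd h"
  shows "osc N h x = prim (\<lambda>y. N y *v h y) x - prim (\<lambda>y. N0 y *v h y) x"
  unfolding osc_def by (intro prim_ess_bdd_diff ess_bdd_mult[OF _ assms(2) r0] assms(1) N0)

text \<open>\<open>Hq q\<close> is a combination of the n functions \<open>H i\<close>, so smallness
  on these is uniform in bounded q: the gain from finite dimension.\<close>

lemma osc_Hq:
  assumes N: "mat_bdd N r" and s: "\<And>i. norm (osc N (H i) x) \<le> s"
  shows "norm (osc N (Hq q) x) \<le> real CARD('n) * s * norm q"
proof -
  have "prim (\<lambda>y. M y *v Hq q y) x = (\<Sum>i\<in>UNIV. (q $ i) *\<^sub>R prim (\<lambda>y. M y *v H i y) x)" if "mat_bdd M r" for M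
    unfolding Hq_def matrix_mult_sum
    by (subst prim_sum) (auto intro: ess_bdd_scaleR ess_bdd_mult[OF that ess_bdd_H r0] simp: prim_scaleR)
  then have "osc N (Hq q) x = (\<Sum>i\<in>UNIV. (q $ i) *\<^sub>R osc N (H i) x)"
    using N N0 by (simp add: osc_eq ess_bdd_Hq ess_bdd_H sum_subtractf scaleR_diff_right)
  also have "norm \<dots> \<le> (\<Sum>i\<in>(UNIV::'n set). norm q * s)"
    by (rule order_trans[OF norm_sum], rule sum_mono)
      (use s in \<open>auto intro!: mult_mono component_le_norm_cart\<close>)
  finally show ?thesis by (simp add: mult_ac)
qed

text \<open>The Gronwall factor of \<open>shoot_diff_bound\<close> for the Lipschitz constant
  \<open>lam + 1\<close>, in which the 1 makes room for linearization errors e \<le> 1.\<close>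

definition C1 :: real where "C1 = 2 * exp (4 * r * (lam + 1)) * r"

lemma C1: "C1 \<ge> 1"
proof -
  have "1 * 1 \<le> exp (4 * r * (lam + 1)) * r" using r lam by (intro mult_mono) auto
  then show ?thesis by (simp add: C1_def)
qed

lemma shoot_difference:
  fixes N :: "real \<Rightarrow> real^'n^'n" and F G :: "real \<Rightarrow> real^'n \<Rightarrow> real^'n"
  assumes N: "mat_bdd N r"
    and U: "\<And>x. U x = shoot N F G p U x + R x" and V: "\<And>x. V x = shoot N F G q V x + S x"
    and m: "U \<in> borel_measurable I01" "V \<in> borel_measurable I01"
    and B: "\<exists>B. \<forall>x. norm (U x) \<le> B" "\<exists>B. \<forall>x. norm (V x) \<le> B"
    and ess_bdd: "ess_bdd (\<lambda>x. F x (U x))" "ess_bdd (\<lambda>x. F x (V x))" "ess_bdd (\<lambda>x. G x (U x))" "ess_bdd (\<lambda>x. G x (V x))"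
    and \<rho>: "\<And>x. norm (R x - S x) \<le> \<rho>"
    and le: "AE x in I01. norm (F x (U x) - F x (V x)) \<le> (lam + 1) * norm (U x - V x)"
      "AE x in I01. norm (G x (U x) - G x (V x)) \<le> (lam + 1) * norm (U x - V x)"
  shows "norm (U x - V x) \<le> C1 * (norm (p - q) + \<rho>)"
proof -
  obtain B1 B2 where "\<And>x. norm (U x) \<le> B1" "\<And>x. norm (V x) \<le> B2" using B by blast
  then have b: "norm (U x) \<le> max B1 B2" "norm (V x) \<le> max B1 B2" for x by (auto simp: le_max_iff_disj)
  show ?thesis
    unfolding C1_def
    by (rule shoot_diff_bound[OF N r _ ess_bdd U[unfolded shoot_slope_def[abs_def]] V[unfolded shoot_slope_def[abs_def]] m b \<rho> le])
      (use lam in simp)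
qed

lemma AE_approx_Lipschitz:
  assumes c: "mat_bdd c lam" and e: "e \<le> 1"
    and le: "AE x in I01. norm (F x (U x) - F x (V x) - c x *v (U x - V x)) \<le> e * norm (U x - V x)"
  shows "AE x in I01. norm (F x (U x) - F x (V x)) \<le> (lam + 1) * norm (U x - V x)"
proof -
  have "AE x in I01. \<forall>v. norm (c x *v v) \<le> lam * norm v" using c by (simp add: mat_bdd_def)
  then show ?thesis using le
  proof eventually_elim
    case (elim x)
    have "norm (F x (U x) - F x (V x)) \<le> norm (c x *v (U x - V x)) + norm (F x (U x) - F x (V x) - c x *v (U x - V x))"
      by (rule norm_triangle_sub)
    also have "\<dots> \<le> lam * norm (U x - V x) + e * norm (U x - V x)"
      using elim by (intro add_mono) auto
    also have "\<dots> \<le> lam * norm (U x - V x) + 1 * norm (U x - V x)"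
      using e by (intro add_left_mono mult_right_mono) auto
    finally show ?case by (simp add: algebra_simps)
  qed
qed

text \<open>The dependence of the shooting map on the parameter \<open>p\<close> is approximated by that of the
  linearized homogenized problem.\<close>

lemma shoot_linearization:
  fixes N :: "real \<Rightarrow> real^'n^'n"
  assumes N: "mat_bdd N r"
    and U: "\<And>x. U x = shoot N f g p U x + R x" and V: "\<And>x. V x = shoot N f g q V x + S x"
    and m: "U \<in> borel_measurable I01" "V \<in> borel_measurable I01"
    and B: "\<exists>B. \<forall>x. norm (U x) \<le> B" "\<exists>B. \<forall>x. norm (V x) \<le> B"
    and ess_bdd: "ess_bdd (\<lambda>x. f x (U x))" "ess_bdd (\<lambda>x. f x (V x))" "ess_bdd (\<lambda>x. g x (U x))" "ess_bdd (\<lambda>x. g x (V x))"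
    and \<rho>: "\<And>x. norm (R x - S x) \<le> \<rho>"
    and e: "0 \<le> e" "e \<le> 1"
    and le: "AE x in I01. norm (f x (U x) - f x (V x) - a x *v (U x - V x)) \<le> e * norm (U x - V x)"
      "AE x in I01. norm (g x (U x) - g x (V x) - b x *v (U x - V x)) \<le> e * norm (U x - V x)"
    and osc: "\<And>x. norm (osc N (Hq (p - q)) x) \<le> \<sigma>"
  shows "norm (U x - V x) \<le> C1 * (norm (p - q) + \<rho>)"
    and "norm (U x - V x - \<xi> (p - q) x) \<le> C1 * (\<sigma> + 2 * r * e * (C1 * (norm (p - q) + \<rho>)) + \<rho>)"
proof -
  let ?D = "\<lambda>x. U x - V x" and ?q = "p - q"
  have D1: "norm (?D x) \<le> C1 * (norm ?q + \<rho>)" for x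
    by (rule shoot_difference[OF N U V m B ess_bdd \<rho> AE_approx_Lipschitz[OF ab(1) e(2) le(1)] AE_approx_Lipschitz[OF ab(2) e(2) le(2)]])
  then show "norm (U x - V x) \<le> C1 * (norm ?q + \<rho>)" .
  define M where "M = C1 * (norm ?q + \<rho>)"
  have M: "norm (?D x) \<le> M" for x using D1 by (simp add: M_def)
  have mD: "?D \<in> borel_measurable I01" using m by simp
  have bmD: "ess_bdd ?D" by (rule ess_bddI[OF mD, of M]) (use M in auto)
  have bmaD: "ess_bdd (\<lambda>y. a y *v ?D y)" "ess_bdd (\<lambda>y. b y *v ?D y)"
    using ess_bdd_mult[OF ab(1) bmD lam] ess_bdd_mult[OF ab(2) bmD lam] by auto
  let ?\<alpha> = "\<lambda>y. f y (U y) - f y (V y) - a y *v ?D y" and ?\<beta> = "\<lambda>y. g y (U y) - g y (V y) - b y *v ?D y"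
  have ess_bdd\<alpha>\<beta>: "ess_bdd ?\<alpha>" "ess_bdd ?\<beta>" by (intro ess_bdd_diff ess_bdd bmaD)+
  define T where "T = (\<lambda>x. prim (\<lambda>y. N y *v (prim ?\<beta> y - ?\<alpha> y)) x + (R x - S x))"
  \<comment> \<open>The difference U - V solves the linear equation with matrix N up to T, which
    collects the linearization errors and the difference of the residuals.\<close>
  have DT: "?D x = prim (\<lambda>y. N y *v (?q - a y *v ?D y + prim (\<lambda>z. b z *v ?D z) y)) x + T x" for x
  proof -
    let ?F = "\<lambda>U p y. p - f y (U y) + prim (\<lambda>z. g z (U z)) y"
    have "shoot N f g p U x - shoot N f g q V x = prim (\<lambda>y. N y *v ?F U p y - N y *v ?F V q y) x"
      unfolding shoot_slope_def[abs_def]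
      by (intro prim_ess_bdd_diff[symmetric] ess_bdd_mult[OF N _ r0] ess_bdd_add ess_bdd_diff ess_bdd_const ess_bdd_prim ess_bdd)
    also have "(\<lambda>y. N y *v ?F U p y - N y *v ?F V q y)
      = (\<lambda>y. N y *v (?q - a y *v ?D y + prim (\<lambda>z. b z *v ?D z) y) + N y *v (prim ?\<beta> y - ?\<alpha> y))"
    proof
      fix y
      have "prim ?\<beta> y = prim (\<lambda>z. g z (U z)) y - prim (\<lambda>z. g z (V z)) y - prim (\<lambda>z. b z *v ?D z) y"
        by (simp add: prim_ess_bdd_diff ess_bdd bmaD ess_bdd_diff)
      then have "?F U p y - ?F V q y = (?q - a y *v ?D y + prim (\<lambda>z. b z *v ?D z) y) + (prim ?\<beta> y - ?\<alpha> y)"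
        by simp
      then show "N y *v ?F U p y - N y *v ?F V q y
        = N y *v (?q - a y *v ?D y + prim (\<lambda>z. b z *v ?D z) y) + N y *v (prim ?\<beta> y - ?\<alpha> y)"
        by (simp only: matrix_vector_mult_diff_distrib[symmetric] matrix_vector_right_distrib[symmetric])
    qed
    also have "prim \<dots> x = prim (\<lambda>y. N y *v (?q - a y *v ?D y + prim (\<lambda>z. b z *v ?D z) y)) x
        + prim (\<lambda>y. N y *v (prim ?\<beta> y - ?\<alpha> y)) x"
      by (intro prim_ess_bdd_add ess_bdd_mult[OF N _ r0] ess_bdd_add ess_bdd_diff ess_bdd_const ess_bdd_prim bmaD ess_bdd)
    finally show ?thesis using U[of x] V[of x] by (simp add: T_def)
  qed
  have T: "norm (T x) \<le> 2 * r * e * M + \<rho>" for x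
  proof -
    have "norm (prim (\<lambda>y. N y *v (prim ?\<beta> y - ?\<alpha> y)) x) \<le> 2 * r * prim (\<lambda>_. e * M) x"
    proof (rule Volterra_bound[OF N r0 ess_bdd\<alpha>\<beta> ess_bdd_const])
      have *: "e * norm (?D y) \<le> e * M" for y using M e by (intro mult_left_mono)
      show "AE y in I01. norm (?\<alpha> y) \<le> e * M" using le(1) by eventually_elim (use * order_trans in blast)
      show "AE y in I01. norm (?\<beta> y) \<le> e * M" using le(2) by eventually_elim (use * order_trans in blast)
    qed
    also have "prim (\<lambda>_. e * M) x \<le> e * M"
    proof -
      have "0 \<le> M" using M[of 0] norm_ge_zero order_trans by blast
      then show ?thesis using norm_prim_le_const[of "\<lambda>_. e * M" "e * M" x] e by simp
    qed
    finally have "norm (prim (\<lambda>y. N y *v (prim ?\<beta> y - ?\<alpha> y)) x) \<le> 2 * r * (e * M)"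
      using r0 by (simp add: mult_left_mono)
    from norm_triangle_mono[OF this \<rho>[of x]] show ?thesis unfolding T_def by (simp add: mult_ac)
  qed
  \<comment> \<open>\<open>\<xi>\<close> solves the linear equation with \<open>N0\<close>;
    rewritten with N it acquires the residual \<open>- osc N (Hq ?q)\<close>. Now both functions
    obey the same equation with the same flux, and only residuals remain in
    \<open>shoot_diff_bound\<close>.\<close>
  have \<xi>N: "\<xi> ?q x = prim (\<lambda>y. N y *v (?q - a y *v \<xi> ?q y + prim (\<lambda>z. b z *v \<xi> ?q z) y)) x + - osc N (Hq ?q) x" for x
    unfolding osc_eq[OF N ess_bdd_Hq] Hq_eq[symmetric] by (simp add: \<xi>_eq)
  obtain B' where B': "\<And>x. norm (\<xi> ?q x) \<le> B'" using \<xi>_bounded by blast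
  have b: "norm (?D x) \<le> max M B'" "norm (\<xi> ?q x) \<le> max M B'" for x using M[of x] B'[of x] by auto
  have bma\<xi>: "ess_bdd (\<lambda>y. a y *v \<xi> ?q y)" "ess_bdd (\<lambda>y. b y *v \<xi> ?q y)"
    using ess_bdd_mult[OF ab(1) ess_bdd_\<xi> lam] ess_bdd_mult[OF ab(2) ess_bdd_\<xi> lam] by auto
  have "norm (?D x - \<xi> ?q x) \<le> 2 * exp (4 * r * (lam + 1)) * r * (norm (?q - ?q) + (\<sigma> + 2 * r * e * M + \<rho>))"
  proof (rule shoot_diff_bound[OF N r _ bmaD(1) bma\<xi>(1) bmaD(2) bma\<xi>(2) DT \<xi>N mD ess_bdd_measurable[OF ess_bdd_\<xi>] b])
    show "norm (T x - - osc N (Hq ?q) x) \<le> \<sigma> + 2 * r * e * M + \<rho>" for x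
      using norm_triangle_ineq[of "T x" "osc N (Hq ?q) x"] T[of x] osc[of x] by simp
    show "AE x in I01. norm (a x *v ?D x - a x *v \<xi> ?q x) \<le> (lam + 1) * norm (?D x - \<xi> ?q x)"
      using mult_Lipschitz[OF ab(1)] by eventually_elim blast
    show "AE x in I01. norm (b x *v ?D x - b x *v \<xi> ?q x) \<le> (lam + 1) * norm (?D x - \<xi> ?q x)"
      using mult_Lipschitz[OF ab(2)] by eventually_elim blast
  qed (use lam in simp)
  then show "norm (U x - V x - \<xi> ?q x) \<le> C1 * (\<sigma> + 2 * r * e * (C1 * (norm ?q + \<rho>)) + \<rho>)"
    by (simp add: C1_def M_def)
qed

section \<open>Solutions near \<open>U0\<close> and the shooting equation\<close>

definition solution :: "(real \<Rightarrow> real^'n^'n) \<Rightarrow> real^'n \<Rightarrow> (real \<Rightarrow> real^'n) \<Rightarrow> bool"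
  where "solution N p U \<longleftrightarrow> (\<forall>x. U x = shoot N f g p U x) \<and> U 1 = 0 \<and>
    U \<in> borel_measurable I01 \<and> (\<exists>B. \<forall>x. norm (U x) \<le> B)"

definition close :: "real \<Rightarrow> (real \<Rightarrow> real^'n) \<Rightarrow> bool"
  where "close \<delta> U \<longleftrightarrow> (AE x in I01. norm (U x - U0 x) \<le> \<delta>)"

definition modulus_at :: "real \<Rightarrow> real \<Rightarrow> bool"
  where "modulus_at e \<delta> \<longleftrightarrow> (AE x in I01. \<forall>v w. norm (v - U0 x) \<le> \<delta> \<longrightarrow> norm (w - U0 x) \<le> \<delta> \<longrightarrow>
        norm (f x v - f x w - a x *v (v - w)) \<le> e * norm (v - w) \<and>
        norm (g x v - g x w - b x *v (v - w)) \<le> e * norm (v - w))"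

lemma modulus_atD:
  assumes "modulus_at e \<delta>" "close \<delta> U" "close \<delta> V"
  shows "AE x in I01. norm (f x (U x) - f x (V x) - a x *v (U x - V x)) \<le> e * norm (U x - V x)"
    and "AE x in I01. norm (g x (U x) - g x (V x) - b x *v (U x - V x)) \<le> e * norm (U x - V x)"
  using assms unfolding modulus_at_def close_def by (eventually_elim, blast)+

lemma close_U0: "\<delta> \<ge> 0 \<Longrightarrow> close \<delta> U0"
  by (simp add: close_def)

lemma ess_bdd_close:
  assumes mod: "modulus_at e \<delta>" and e: "e \<le> 1" and \<delta>: "\<delta> \<ge> 0" and U: "close \<delta> U" "U \<in> borel_measurable I01"
  shows "ess_bdd (\<lambda>x. f x (U x))" "ess_bdd (\<lambda>x. g x (U x))"
proof -
  have step: "ess_bdd (\<lambda>x. F x (U x))" if Fb: "ess_bdd (\<lambda>x. F x (U0 x))" and "(\<lambda>x. F x (U x)) \<in> borel_measurable I01"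
    "AE x in I01. norm (F x (U x) - F x (U0 x)) \<le> (lam + 1) * norm (U x - U0 x)" for F :: "real \<Rightarrow> real^'n \<Rightarrow> real^'n"
  proof -
    obtain C where C: "AE x in I01. norm (F x (U0 x)) \<le> C" using Fb by (auto simp: ess_bdd_def)
    have "AE x in I01. norm (F x (U x)) \<le> C + (lam + 1) * \<delta>"
      using C that(3) U(1) unfolding close_def
    proof eventually_elim
      case (elim x)
      have "norm (F x (U x)) \<le> norm (F x (U0 x)) + norm (F x (U x) - F x (U0 x))" by (rule norm_triangle_sub)
      moreover have "(lam + 1) * norm (U x - U0 x) \<le> (lam + 1) * \<delta>" using elim(3) lam by (intro mult_left_mono) auto
      ultimately show ?case using elim(1,2) by linarith
    qed
    then show ?thesis by (rule ess_bddI[OF that(2)])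
  qed
  note le = modulus_atD[OF mod U(1) close_U0[OF \<delta>]]
  show "ess_bdd (\<lambda>x. f x (U x))"
    by (rule step[OF fgU0(1) f_meas[OF U(2)] AE_approx_Lipschitz[OF ab(1) e le(1)]])
  show "ess_bdd (\<lambda>x. g x (U x))"
    by (rule step[OF fgU0(2) g_meas[OF U(2)] AE_approx_Lipschitz[OF ab(2) e le(2)]])
qed

text \<open>The counterpart of \<open>H\<close> for \<open>U0\<close> itself; in the application it
  is the homogenized matrix times the derivative of \<open>U0\<close>.\<close>

definition h0 :: "real \<Rightarrow> real^'n" where "h0 y = p0 - f y (U0 y) + prim (\<lambda>z. g z (U0 z)) y"

lemma ess_bdd_h0: "ess_bdd h0"
  unfolding h0_def[abs_def] by (intro ess_bdd_add ess_bdd_diff ess_bdd_const ess_bdd_prim fgU0)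

text \<open>Presents \<open>U0\<close> as an approximate solution for the perturbed matrix, so that
  it can be compared with exact ones at the cost of \<open>osc N h0\<close>.\<close>

lemma U0_perturbed:
  assumes "mat_bdd N r"
  shows "U0 x = shoot N f g p0 U0 x + - osc N h0 x"
  unfolding osc_eq[OF assms ess_bdd_h0] using U0(1)[of x] by (simp add: shoot_slope_def[abs_def] h0_def[abs_def])

text \<open>Makes the nonlinearities globally Lipschitz without changing them near \<open>U0\<close>.\<close>

definition trunc :: "(real \<Rightarrow> real^'n \<Rightarrow> real^'n) \<Rightarrow> real \<Rightarrow> real \<Rightarrow> real^'n \<Rightarrow> real^'n"
  where "trunc F \<delta> x v = F x (U0 x + closest_point (cball 0 \<delta>) (v - U0 x))"

lemma trunc_eq: "norm (v - U0 x) \<le> \<delta> \<Longrightarrow> trunc F \<delta> x v = F x v"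
  by (simp add: trunc_def closest_point_self)

lemma trunc_measurable:
  assumes F: "\<And>u. u \<in> borel_measurable I01 \<Longrightarrow> (\<lambda>x. F x (u x)) \<in> borel_measurable I01" and \<delta>: "\<delta> \<ge> 0"
    and u: "u \<in> borel_measurable I01"
  shows "(\<lambda>x. trunc F \<delta> x (u x)) \<in> borel_measurable I01"
proof -
  have "continuous_on UNIV (closest_point (cball (0::real^'n) \<delta>))"
    using \<delta> by (intro continuous_on_closest_point) auto
  then have "closest_point (cball (0::real^'n) \<delta>) \<in> borel_measurable borel"
    by (rule borel_measurable_continuous_onI)
  then have "(\<lambda>x. closest_point (cball 0 \<delta>) (u x - U0 x)) \<in> borel_measurable I01"
    by (rule measurable_compose[rotated]) (use u U0_meas in simp)
  then show ?thesis unfolding trunc_def using U0_meas by (intro F) simp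
qed

text \<open>The projection onto a ball is nonexpansive, so the Lipschitz bound valid near
  \<open>U0\<close> becomes global.\<close>

lemma trunc_Lipschitz:
  assumes c: "mat_bdd c lam" and e: "0 \<le> e" "e \<le> 1" and \<delta>: "\<delta> \<ge> 0"
    and le: "AE x in I01. \<forall>v w. norm (v - U0 x) \<le> \<delta> \<longrightarrow> norm (w - U0 x) \<le> \<delta> \<longrightarrow>
        norm (F x v - F x w - c x *v (v - w)) \<le> e * norm (v - w)"
  shows "AE x in I01. \<forall>v w. norm (trunc F \<delta> x v - trunc F \<delta> x w) \<le> (lam + 1) * norm (v - w)"
proof -
  have "AE x in I01. \<forall>v. norm (c x *v v) \<le> lam * norm v" using c by (simp add: mat_bdd_def)
  then show ?thesis using le
  proof eventually_elim
    case (elim x)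
    show ?case
    proof (intro allI)
      fix v w
      let ?c = "closest_point (cball (0::real^'n) \<delta>)"
      define v' where "v' = U0 x + ?c (v - U0 x)"
      define w' where "w' = U0 x + ?c (w - U0 x)"
      have B: "closed (cball (0::real^'n) \<delta>)" "convex (cball (0::real^'n) \<delta>)" "cball (0::real^'n) \<delta> \<noteq> {}" using \<delta> by auto
      have "norm (v' - U0 x) \<le> \<delta>" "norm (w' - U0 x) \<le> \<delta>"
        using closest_point_in_set[OF B(1,3), of "v - U0 x"] closest_point_in_set[OF B(1,3), of "w - U0 x"]
        by (auto simp: v'_def w'_def)
      then have 1: "norm (F x v' - F x w' - c x *v (v' - w')) \<le> e * norm (v' - w')" using elim(2) by blast
      have "norm (F x v' - F x w') \<le> norm (c x *v (v' - w')) + norm (F x v' - F x w' - c x *v (v' - w'))"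
        by (rule norm_triangle_sub)
      also have "\<dots> \<le> lam * norm (v' - w') + e * norm (v' - w')" using elim(1) 1 by (intro add_mono) auto
      also have "\<dots> = (lam + e) * norm (v' - w')" by (simp add: algebra_simps)
      also have "\<dots> \<le> (lam + 1) * norm (v - w)"
      proof (intro mult_mono)
        show "norm (v' - w') \<le> norm (v - w)"
          using closest_point_lipschitz[OF B(2,1,3), of "v - U0 x" "w - U0 x"] by (simp add: v'_def w'_def dist_norm)
      qed (use lam e in auto)
      finally show "norm (trunc F \<delta> x v - trunc F \<delta> x w) \<le> (lam + 1) * norm (v - w)"
        by (simp add: trunc_def v'_def w'_def)
    qed
  qed
qed

text \<open>A simplified Newton iteration: with \<open>\<Psi>\<close> the inverse of the limit
  derivative, zeros of the end value U 1 are fixed points of p -> p - \<open>\<Psi>\<close> (U 1), a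
  contraction because the shooting map for N is close to linear with that derivative. The constants
  precede N, so all claims are uniform over the matrices with small oscillation on the
  \<open>H i\<close> and, for existence, on \<open>h0\<close>.\<close>

theorem perturbation:
  obtains \<delta> s C where "\<delta> > 0" "s > 0" "C \<ge> 0"
    "\<And>N. mat_bdd N r \<Longrightarrow> (\<And>i x. norm (osc N (H i) x) \<le> s) \<Longrightarrow> (\<And>x. norm (osc N h0 x) \<le> s) \<Longrightarrow>
      \<exists>p U. solution N p U \<and> (\<forall>x. norm (U x - U0 x) \<le> \<delta>)"
    "\<And>N p q U V x. mat_bdd N r \<Longrightarrow> (\<And>i x. norm (osc N (H i) x) \<le> s) \<Longrightarrow> solution N p U \<Longrightarrow> close \<delta> U \<Longrightarrow>
      solution N q V \<Longrightarrow> close \<delta> V \<Longrightarrow> U x = V x"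
    "\<And>N p U \<rho> x. mat_bdd N r \<Longrightarrow> (\<And>i x. norm (osc N (H i) x) \<le> s) \<Longrightarrow> solution N p U \<Longrightarrow> close \<delta> U \<Longrightarrow>
      (\<And>x. norm (osc N h0 x) \<le> \<rho>) \<Longrightarrow> norm (U x - U0 x) \<le> C * \<rho>"
proof -
  obtain \<kappa> where \<kappa>: "\<kappa> > 0" "\<And>q. \<kappa> * norm q \<le> norm (\<xi> q 1)"
    using linear_inj_bounded_below_pos[OF linear_\<xi> inj_\<xi>] by blast
  obtain \<Psi> where \<Psi>: "linear \<Psi>" "\<And>q. \<Psi> (\<xi> q 1) = q" "\<And>q. \<xi> (\<Psi> q) 1 = q"
    using linear_injective_isomorphism[OF linear_\<xi> inj_\<xi>] by blast
  have \<Psi>b: "norm (\<Psi> y) \<le> norm y / \<kappa>" for y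
    using \<kappa>(2)[of "\<Psi> y"] \<kappa>(1) by (simp add: \<Psi>(3) pos_le_divide_eq mult.commute)
  define n where "n = real CARD('n)"
  have n: "n > 0" by (simp add: n_def)
  have C1': "C1 > 0" using C1 by linarith
  have r': "r > 0" using r by linarith
  \<comment> \<open>Makes the linearization error 2 r e C1^2 at most a quarter of \<kappa>, the
    lower bound of the limit derivative.\<close>
  define e where "e = min 1 (\<kappa> / (8 * r * C1\<^sup>2))"
  have e: "0 < e" "e \<le> 1" using \<kappa> r' C1' by (auto simp: e_def)
  have eK: "2 * r * e * C1 * C1 \<le> \<kappa> / 4"
  proof -
    have "e * (8 * r * C1\<^sup>2) \<le> \<kappa>"
      using r' C1' by (simp add: e_def pos_le_divide_eq[symmetric])
    then show ?thesis by (simp add: power2_eq_square mult_ac)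
  qed
  obtain \<delta> where \<delta>: "\<delta> > 0" and mod: "modulus_at e \<delta>"
    using modulus[OF e(1)] unfolding modulus_at_def by blast
  \<comment> \<open>Radius of the ball of initial fluxes: together with s \<le> t it keeps the
    solutions within C1 (t + t) = \<delta> of \<open>U0\<close>.\<close>
  define t where "t = \<delta> / (2 * C1)"
  have t: "t > 0" using \<delta> C1' by (simp add: t_def)
  \<comment> \<open>The three bounds serve, in this order, the oscillation in the derivative (a
    further \<kappa> / 4), the residual of \<open>U0\<close>, and the requirement that the iteration
    moves \<open>p0\<close> by at most t / 2.\<close>
  define s where "s = min (\<kappa> / (4 * C1 * n)) (min t (t * \<kappa> / (2 * C1)))"
  have s: "s > 0" using \<kappa> C1' n t by (simp add: s_def)
  have s1: "C1 * (n * s) \<le> \<kappa> / 4"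
  proof -
    have "s * (4 * C1 * n) \<le> \<kappa>"
      using C1' n by (simp add: s_def pos_le_divide_eq[symmetric])
    then show ?thesis by (simp add: mult_ac)
  qed
  have s2: "s \<le> t" by (simp add: s_def)
  have s3: "C1 * s / \<kappa> \<le> t / 2"
  proof -
    have "s * (2 * C1) \<le> t * \<kappa>"
      using C1' by (simp add: s_def pos_le_divide_eq[symmetric])
    then show ?thesis using \<kappa>(1) by (simp add: field_simps)
  qed
  define K where "K = \<kappa> / 4 + C1"
  have K: "K > 0" using \<kappa> C1' by (simp add: K_def)
  \<comment> \<open>The shooting map deviates from its linearization by at most half of the lower
    bound \<kappa>, so the flux difference can be recovered from the end values, up to the residual
    term with K. Existence, uniqueness and the rate all follow from these three estimates.\<close>
  have star: "norm (U x - V x) \<le> C1 * (norm (p - q) + \<rho>)"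
      "norm (U 1 - V 1 - \<xi> (p - q) 1) \<le> \<kappa> / 2 * norm (p - q) + K * \<rho>"
      "\<kappa> * norm (p - q) \<le> 2 * (norm (U 1 - V 1) + K * \<rho>)"
    if N: "mat_bdd N r" and o: "\<And>i x. norm (osc N (H i) x) \<le> s"
      and U: "\<And>x. U x = shoot N f g p U x + R x" and V: "\<And>x. V x = shoot N f g q V x + S x"
      and m: "U \<in> borel_measurable I01" "V \<in> borel_measurable I01"
      and B: "\<exists>B. \<forall>x. norm (U x) \<le> B" "\<exists>B. \<forall>x. norm (V x) \<le> B"
      and cl: "close \<delta> U" "close \<delta> V"
      and \<rho>: "\<And>x. norm (R x - S x) \<le> \<rho>"
    for N U V p q R S \<rho> x
  proof -
    note bmU = ess_bdd_close[OF mod e(2) less_imp_le[OF \<delta>] cl(1) m(1)]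
    note bmV = ess_bdd_close[OF mod e(2) less_imp_le[OF \<delta>] cl(2) m(2)]
    have oq: "norm (osc N (Hq (p - q)) x) \<le> n * s * norm (p - q)" for x
      unfolding n_def by (rule osc_Hq[OF N o])
    note L = shoot_linearization[OF N U V m B bmU(1) bmV(1) bmU(2) bmV(2) \<rho> less_imp_le[OF e(1)] e(2) modulus_atD[OF mod cl] oq]
    show "norm (U x - V x) \<le> C1 * (norm (p - q) + \<rho>)" by (rule L(1))
    have \<rho>0: "\<rho> \<ge> 0" using \<rho>[of 0] norm_ge_zero order_trans by blast
    have "norm (U 1 - V 1 - \<xi> (p - q) 1) \<le> C1 * (n * s * norm (p - q) + 2 * r * e * (C1 * (norm (p - q) + \<rho>)) + \<rho>)"
      by (rule L(2))
    also have "\<dots> = (C1 * (n * s)) * norm (p - q) + (2 * r * e * C1 * C1) * norm (p - q) + (2 * r * e * C1 * C1) * \<rho> + C1 * \<rho>"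
      by (simp add: algebra_simps)
    also have "\<dots> \<le> (\<kappa> / 4) * norm (p - q) + (\<kappa> / 4) * norm (p - q) + (\<kappa> / 4) * \<rho> + C1 * \<rho>"
      using s1 eK \<rho>0 by (intro add_mono mult_right_mono) auto
    also have "\<dots> = \<kappa> / 2 * norm (p - q) + K * \<rho>" by (simp add: K_def algebra_simps)
    finally show st: "norm (U 1 - V 1 - \<xi> (p - q) 1) \<le> \<kappa> / 2 * norm (p - q) + K * \<rho>" .
    have "norm (\<xi> (p - q) 1) \<le> norm (U 1 - V 1) + norm (U 1 - V 1 - \<xi> (p - q) 1)"
      by (metis norm_minus_commute norm_triangle_sub add.commute)
    then have "\<kappa> * norm (p - q) \<le> norm (U 1 - V 1) + (\<kappa> / 2 * norm (p - q) + K * \<rho>)"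
      using \<kappa>(2)[of "p - q"] st by linarith
    then show "\<kappa> * norm (p - q) \<le> 2 * (norm (U 1 - V 1) + K * \<rho>)" by (simp add: field_simps)
  qed
  define C where "C = C1 * (2 * K / \<kappa> + 1)"
  show thesis
  proof (rule that[OF \<delta> s, of C])
    show "C \<ge> 0" using C1' K \<kappa> by (simp add: C_def)
  next
    fix N p q U V x
    assume N: "mat_bdd N r" and o: "\<And>i x. norm (osc N (H i) x) \<le> s" and U: "solution N p U" "close \<delta> U"
      and V: "solution N q V" "close \<delta> V"
    have US: "\<And>x. U x = shoot N f g p U x + 0" "\<And>x. V x = shoot N f g q V x + 0"
      "U 1 = 0" "V 1 = 0" using U V unfolding solution_def by auto
    have UM: "U \<in> borel_measurable I01" "V \<in> borel_measurable I01"
      "\<exists>B. \<forall>x. norm (U x) \<le> B" "\<exists>B. \<forall>x. norm (V x) \<le> B" using U V unfolding solution_def by blast+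
    note st = star[OF N o US(1,2) UM U(2) V(2), of 0]
    \<comment> \<open>Exact solutions have no residual and the same end value 0, so the third
      estimate leaves no flux difference.\<close>
    have "p = q" using st(3) US(3,4) \<kappa>(1) by (simp add: mult_le_0_iff)
    then show "U x = V x" using st(1)[of x] by simp
  next
    fix N p U \<rho> x
    assume N: "mat_bdd N r" and o: "\<And>i x. norm (osc N (H i) x) \<le> s" and U: "solution N p U" "close \<delta> U"
      and \<rho>: "\<And>x. norm (osc N h0 x) \<le> \<rho>"
    have US: "\<And>x. U x = shoot N f g p U x + 0" "U 1 = 0" and UM: "U \<in> borel_measurable I01" "\<exists>B. \<forall>x. norm (U x) \<le> B"
      using U unfolding solution_def by (simp, blast+)
    have \<rho>': "norm (0 - - osc N h0 x) \<le> \<rho>" for x using \<rho>[of x] by simp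
    note st = star[OF N o US(1) U0_perturbed[OF N] UM(1) U0_meas UM(2) U0_bound U(2) close_U0[OF less_imp_le[OF \<delta>]] \<rho>']
    have "norm (p - p0) \<le> 2 * K / \<kappa> * \<rho>"
      using st(3) US(2) U0(2) \<kappa>(1) by (simp add: field_simps)
    then have "C1 * (norm (p - p0) + \<rho>) \<le> C1 * (2 * K / \<kappa> * \<rho> + \<rho>)"
      using C1' by (intro mult_left_mono) auto
    then show "norm (U x - U0 x) \<le> C * \<rho>"
      using st(1)[of x] by (simp add: C_def algebra_simps)
  next
    fix N
    assume N: "mat_bdd N r" and o: "\<And>i x. norm (osc N (H i) x) \<le> s" and h: "\<And>x. norm (osc N h0 x) \<le> s"
    \<comment> \<open>Truncation provides a solution for every initial flux. For fluxes within t of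
      \<open>p0\<close> the solution stays within \<open>\<delta>\<close> of \<open>U0\<close>,
      where the truncation changes nothing.\<close>
    let ?f = "trunc f \<delta>" and ?g = "trunc g \<delta>"
    have \<delta>0: "\<delta> \<ge> 0" using \<delta> by simp
    have tm: "(\<lambda>x. ?f x (u x)) \<in> borel_measurable I01" "(\<lambda>x. ?g x (u x)) \<in> borel_measurable I01"
      if "u \<in> borel_measurable I01" for u
      by (rule trunc_measurable[OF _ \<delta>0 that], rule f_meas g_meas, assumption)+
    have "AE x in I01. \<forall>v w. norm (v - U0 x) \<le> \<delta> \<longrightarrow> norm (w - U0 x) \<le> \<delta> \<longrightarrow>
        norm (f x v - f x w - a x *v (v - w)) \<le> e * norm (v - w)"
      using mod unfolding modulus_at_def by eventually_elim blast
    note lf = trunc_Lipschitz[OF ab(1) less_imp_le[OF e(1)] e(2) \<delta>0 this]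
    have "AE x in I01. \<forall>v w. norm (v - U0 x) \<le> \<delta> \<longrightarrow> norm (w - U0 x) \<le> \<delta> \<longrightarrow>
        norm (g x v - g x w - b x *v (v - w)) \<le> e * norm (v - w)"
      using mod unfolding modulus_at_def by eventually_elim blast
    note lg = trunc_Lipschitz[OF ab(2) less_imp_le[OF e(1)] e(2) \<delta>0 this]
    obtain BU where BU: "\<And>x. norm (U0 x) \<le> BU" using U0_bound by blast
    have zero: "AE x in I01. norm (trunc F \<delta> x 0) \<le> C + (lam + 1) * BU"
      if "AE x in I01. norm (F x (U0 x)) \<le> C"
        "AE x in I01. \<forall>v w. norm (trunc F \<delta> x v - trunc F \<delta> x w) \<le> (lam + 1) * norm (v - w)" for F C
      using that
    proof eventually_elim
      case (elim x)
      have "norm (trunc F \<delta> x 0) \<le> norm (trunc F \<delta> x (U0 x)) + norm (trunc F \<delta> x 0 - trunc F \<delta> x (U0 x))"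
        by (rule norm_triangle_sub)
      moreover have "norm (trunc F \<delta> x 0 - trunc F \<delta> x (U0 x)) \<le> (lam + 1) * norm (0 - U0 x)" using elim(2) by blast
      moreover have "(lam + 1) * norm (0 - U0 x) \<le> (lam + 1) * BU" using BU[of x] lam by (intro mult_left_mono) auto
      ultimately show ?case using elim(1) trunc_eq[of "U0 x" x \<delta> F] \<delta> by simp
    qed
    obtain Cf Cg where "AE x in I01. norm (f x (U0 x)) \<le> Cf" "AE x in I01. norm (g x (U0 x)) \<le> Cg"
      using fgU0 unfolding ess_bdd_def by blast
    note z = zero[OF this(1) lf] zero[OF this(2) lg]
    define Z where "Z = max (Cf + (lam + 1) * BU) (Cg + (lam + 1) * BU)"
    have Z: "AE x in I01. norm (?f x 0) \<le> Z" "AE x in I01. norm (?g x 0) \<le> Z"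
      using z(1) apply (eventually_elim, simp add: Z_def)
      using z(2) apply (eventually_elim, simp add: Z_def)
      done
    have bmt: "ess_bdd (\<lambda>x. ?f x (u x))" "ess_bdd (\<lambda>x. ?g x (u x))" if "ess_bdd u" for u
      using ess_bdd_Lipschitz_superposition[OF that tm(1)[OF ess_bdd_measurable[OF that]] Z(1) lf]
        ess_bdd_Lipschitz_superposition[OF that tm(2)[OF ess_bdd_measurable[OF that]] Z(2) lg] lam by auto
    define P where "P = (\<lambda>p U. (\<forall>x. U x = shoot N ?f ?g p U x) \<and> continuous_on UNIV U \<and> (\<exists>B. \<forall>x. norm (U x) \<le> B))"
    have "\<exists>U. P p U" for p
    proof -
      have L: "0 < lam + 1" using lam by simp
      obtain U where "\<And>x. U x = shoot N ?f ?g p U x" "continuous_on UNIV U" "\<exists>b. \<forall>x. norm (U x) \<le> b"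
        by (rule shoot_exists[OF N r L tm Z lf lg]) (assumption | rule that)+
      then show ?thesis unfolding P_def by blast
    qed
    then have "\<forall>p. \<exists>U. P p U" by blast
    from choice[OF this] obtain W where W: "\<And>p. P p (W p)" by blast
    have Wm: "W p \<in> borel_measurable I01" "\<exists>B. \<forall>x. norm (W p x) \<le> B" for p
      using W[of p] continuous_measurable_I01 unfolding P_def by blast+
    have Wbm: "ess_bdd (W p)" for p
      using Wm[of p] by (auto intro: ess_bddI)
    have U0bm: "ess_bdd U0" using U0_meas BU by (auto intro: ess_bddI)
    have t0: "trunc F \<delta> x (U0 x) = F x (U0 x)" for F x by (rule trunc_eq) (simp add: \<delta>0)
    have near: "norm (W p x - U0 x) \<le> \<delta>" if p: "norm (p - p0) \<le> t" for p x
    proof -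
      have "norm (W p x - U0 x) \<le> C1 * (norm (p - p0) + s)"
      proof (rule shoot_difference[where F="?f" and G="?g", OF N])
        show "W p x = shoot N ?f ?g p (W p) x + 0" for x using W[of p] by (simp add: P_def)
        show "U0 x = shoot N ?f ?g p0 U0 x + - osc N h0 x" for x
          using U0_perturbed[OF N, of x] by (simp add: shoot_slope_def[abs_def] t0)
        show "AE x in I01. norm (?f x (W p x) - ?f x (U0 x)) \<le> (lam + 1) * norm (W p x - U0 x)"
          using lf by eventually_elim blast
        show "AE x in I01. norm (?g x (W p x) - ?g x (U0 x)) \<le> (lam + 1) * norm (W p x - U0 x)"
          using lg by eventually_elim blast
        show "norm (0 - - osc N h0 x) \<le> s" for x using h[of x] by simp
      qed (use Wm U0_meas U0_bound bmt[OF Wbm] bmt[OF U0bm] in auto)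
      also have "\<dots> \<le> C1 * (t + t)" using p s2 C1' by (intro mult_left_mono add_mono) auto
      also have "\<dots> = \<delta>" using C1' by (simp add: t_def)
      finally show ?thesis .
    qed
    have Wsol: "W p x = shoot N f g p (W p) x + 0" if p: "norm (p - p0) \<le> t" for p x
    proof -
      have "shoot N ?f ?g p (W p) x = shoot N f g p (W p) x"
        unfolding shoot_slope_def[abs_def] using near[OF p] by (simp add: trunc_eq)
      then show ?thesis using W[of p] unfolding P_def by simp
    qed
    have Wcl: "close \<delta> (W p)" if p: "norm (p - p0) \<le> t" for p
      using near[OF p] by (simp add: close_def)
    define Q where "Q = (\<lambda>p. p - \<Psi> (W p 1))"
    have Q: "dist (Q p) (Q q) \<le> 1 / 2 * dist p q" if pq: "norm (p - p0) \<le> t" "norm (q - p0) \<le> t" for p q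
    proof -
      have st: "norm (W p 1 - W q 1 - \<xi> (p - q) 1) \<le> \<kappa> / 2 * norm (p - q) + K * 0"
        by (rule star(2)[OF N o Wsol[OF pq(1)] Wsol[OF pq(2)] Wm(1) Wm(1) Wm(2) Wm(2) Wcl[OF pq(1)] Wcl[OF pq(2)]]) simp
      \<comment> \<open>Since p - q = \<open>\<Psi>\<close> (\<open>\<xi>\<close> (p - q) 1), the
        increment of Q is governed by the linearization error; \<open>star\<close> bounds that error
        with the factor \<kappa> / 2, and \<open>\<Psi>\<close> costs 1 / \<kappa>.\<close>
      have Qe: "Q p - Q q = - \<Psi> (W p 1 - W q 1 - \<xi> (p - q) 1)"
        using \<Psi>(2)[of "p - q"] by (simp add: Q_def linear_diff[OF \<Psi>(1)])
      have "norm (Q p - Q q) \<le> norm (W p 1 - W q 1 - \<xi> (p - q) 1) / \<kappa>"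
        unfolding Qe norm_minus_cancel by (rule \<Psi>b)
      also have "\<dots> \<le> (\<kappa> / 2 * norm (p - q)) / \<kappa>"
        using st \<kappa>(1) by (intro divide_right_mono) auto
      finally show ?thesis using \<kappa>(1) by (simp add: dist_norm)
    qed
    have Q0: "norm (Q p0 - p0) \<le> t / 2"
    proof -
      have p0: "norm (p0 - p0) \<le> t" using t by simp
      have "norm (0 - - osc N h0 x) \<le> s" for x using h[of x] by simp
      note st = star(1)[OF N o Wsol[OF p0] U0_perturbed[OF N] Wm(1) U0_meas Wm(2) U0_bound Wcl[OF p0] close_U0[OF \<delta>0] this]
      have "norm (W p0 1) \<le> C1 * s" using st[of 1] U0(2) by simp
      then have "norm (\<Psi> (W p0 1)) \<le> C1 * s / \<kappa>"
        using \<Psi>b[of "W p0 1"] \<kappa>(1) by (meson divide_right_mono less_imp_le order_trans)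
      also note s3
      finally show ?thesis by (simp add: Q_def)
    qed
    have "\<exists>!p\<in>cball p0 t. Q p = p"
    proof (rule Banach_fix)
      show "complete (cball p0 t)" by (rule compact_imp_complete) simp
      show "cball p0 t \<noteq> {}" using t by simp
      show "Q ` cball p0 t \<subseteq> cball p0 t"
      proof
        fix y assume "y \<in> Q ` cball p0 t"
        then obtain p where p: "y = Q p" "norm (p - p0) \<le> t" by (auto simp: dist_norm norm_minus_commute)
        have "dist (Q p) p0 \<le> dist (Q p) (Q p0) + dist (Q p0) p0" by (rule dist_triangle)
        also have "\<dots> \<le> 1 / 2 * dist p p0 + t / 2"
          using Q[OF p(2), of p0] t Q0 by (intro add_mono) (auto simp: dist_norm)
        also have "\<dots> \<le> t" using p(2) by (simp add: dist_norm)
        finally show "y \<in> cball p0 t" by (simp add: p(1) dist_commute)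
      qed
      show "dist (Q p) (Q q) \<le> 1 / 2 * dist p q" if "p \<in> cball p0 t" "q \<in> cball p0 t" for p q
        using that Q[of p q] by (simp add: dist_norm norm_minus_commute)
    qed auto
    then obtain p where p: "norm (p - p0) \<le> t" "Q p = p" by (auto simp: dist_norm norm_minus_commute)
    have "\<Psi> (W p 1) = 0" using p(2) by (simp add: Q_def)
    then have "W p 1 = 0" using \<Psi>(3)[of "W p 1"] linear_0[OF linear_\<xi>] by simp
    then have "solution N p (W p)"
      unfolding solution_def using Wsol[OF p(1)] Wm[of p] unfolding add_0_right by blast
    then show "\<exists>p U. solution N p U \<and> (\<forall>x. norm (U x - U0 x) \<le> \<delta>)" using near[OF p(1)] by blast
  qed
qed

end

section \<open>Oscillating coefficients\<close>

text \<open>Linear scaling preserves null sets, seen by substitution in the integral of the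
  indicator of an exceptional set.\<close>

lemma AE_lebesgue_scale:
  assumes e: "e > 0" and P: "AE y in lebesgue. P y"
  shows "AE x in I01. P (x / e)"
proof -
  obtain Z where Z: "{y. \<not> P y} \<subseteq> Z" "Z \<in> null_sets lebesgue"
    using P by (auto simp: eventually_ae_filter)
  have Zm: "Z \<in> sets lebesgue" using Z(2) by auto
  have "(\<integral>\<^sup>+ y. indicator Z y \<partial>lebesgue) = 0" using Z(2) Zm by (simp add: null_setsD1)
  then have "ennreal \<bar>1 / e\<bar> * (\<integral>\<^sup>+ x. indicator Z (0 + 1 / e * x) \<partial>lebesgue) = 0"
    using nn_integral_real_affine_lebesgue[of "indicator Z" "1 / e" 0] e Zm by simp
  then have "(\<integral>\<^sup>+ x. indicator Z (0 + 1 / e * x) \<partial>lebesgue) = 0" using e by simp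
  moreover have "(\<lambda>x. indicator Z (0 + 1 / e * x) :: ennreal) \<in> borel_measurable lebesgue"
    using measurable_compose[OF lebesgue_measurable_scaling[of "1 / e :: real"] borel_measurable_indicator[OF Zm]] by simp
  ultimately have "AE x in lebesgue. (indicator Z (0 + 1 / e * x) :: ennreal) = 0"
    by (simp add: nn_integral_0_iff_AE)
  then have "AE x in lebesgue. P (x / e)"
    by eventually_elim (use Z(1) in \<open>auto simp: indicator_eq_0_iff\<close>)
  then show ?thesis by (subst AE_restrict_space_iff) (auto elim!: eventually_mono)
qed

lemma AE_lebesgue_I01: "AE y in lebesgue. P y \<Longrightarrow> AE x in I01. P x"
  by (subst AE_restrict_space_iff) (auto elim!: eventually_mono)

lemma measurable_lebesgue_scale:
  assumes "f \<in> borel_measurable lebesgue"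
  shows "(\<lambda>x. f (x / e)) \<in> borel_measurable I01"
proof -
  have "(\<lambda>x. f (x / e)) \<in> borel_measurable lebesgue"
    using measurable_compose[OF lebesgue_measurable_scaling[of "1 / e :: real"] assms] by simp
  then show ?thesis by (rule measurable_restrict_space1)
qed

lemma nn_integral_I01_scale_le:
  assumes f: "f \<in> borel_measurable lebesgue" and e: "e > 0"
  shows "(\<integral>\<^sup>+ x. f (x / e) \<partial>I01) \<le> ennreal e * (\<integral>\<^sup>+ y. f y \<partial>lebesgue)"
proof -
  have "(\<integral>\<^sup>+ x. f (x / e) \<partial>I01) = (\<integral>\<^sup>+ x. f (x / e) * indicator {0<..<1} x \<partial>lebesgue)"
    by (rule nn_integral_restrict_space) simp
  also have "\<dots> \<le> (\<integral>\<^sup>+ x. f (x / e) \<partial>lebesgue)"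
    by (rule nn_integral_mono) (auto simp: indicator_def)
  also have "\<dots> = ennreal e * (ennreal \<bar>1 / e\<bar> * (\<integral>\<^sup>+ x. f (0 + 1 / e * x) \<partial>lebesgue))"
    using e by (simp add: mult.assoc[symmetric] flip: ennreal_mult)
  also have "\<dots> = ennreal e * (\<integral>\<^sup>+ y. f y \<partial>lebesgue)"
    using nn_integral_real_affine_lebesgue[OF f, of "1 / e" 0] e by simp
  finally show ?thesis .
qed

lemma measurable_lebesgue_indicator_scaleR:
  fixes P :: "real \<Rightarrow> 'a::euclidean_space"
  assumes "P \<in> borel_measurable lebesgue" "S \<in> sets borel"
  shows "(\<lambda>y. indicator S y *\<^sub>R P y) \<in> borel_measurable lebesgue"
proof -
  have "S \<in> sets lebesgue" using assms(2) by simp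
  then show ?thesis using assms(1) by (intro borel_measurable_scaleR borel_measurable_indicator)
qed

text \<open>Whole periods contribute zero and are removed one at a time, until an interval of length
  at most 1 remains, on which the bound on P bounds the integral.\<close>

lemma periodic_mean_zero_integral_bounded:
  fixes P :: "real \<Rightarrow> 'a::euclidean_space"
  assumes m: "P \<in> borel_measurable lebesgue" and b: "AE y in lebesgue. norm (P y) \<le> C"
    and per: "AE y in lebesgue. P (y + 1) = P y" and mean: "(\<integral>y. P y \<partial>I01) = 0" and T: "T \<ge> 0"
  shows "norm (\<integral>y. indicator {0<..<T} y *\<^sub>R P y \<partial>lebesgue) \<le> C"
proof -
  define Z where "Z = (\<lambda>T. \<integral>y. indicator {0<..<T} y *\<^sub>R P y \<partial>lebesgue)"
  have int: "integrable lebesgue (\<lambda>y. indicator {a<..<b} y *\<^sub>R P y)" for a b :: real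
  proof (rule integrableI_bounded_set_indicator[where B=C])
    show "emeasure lebesgue {a<..<b} < \<infinity>" by (cases "a \<le> b") auto
    show "AE x in lebesgue. x \<in> {a<..<b} \<longrightarrow> norm (P x) \<le> C" using b by eventually_elim simp
  qed (use m in auto)
  have neq: "AE y in lebesgue. y \<noteq> x" for x :: real by (metis AE_lborel_singleton AE_completion)
  have Z1: "Z 1 = 0"
    unfolding Z_def using mean by (subst (asm) integral_restrict_space) auto
  have C: "C \<ge> 0"
  proof -
    have "P \<in> borel_measurable I01" using m by (rule measurable_restrict_space1)
    from norm_prim_le_const[OF this AE_lebesgue_I01[OF b], of 0] show ?thesis by simp
  qed
  have small: "norm (Z t) \<le> C" if t: "0 \<le> t" "t \<le> 1" for t
  proof -
    have "Z t = prim P t"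
      unfolding prim_def Z_def
    proof (subst integral_restrict_space, simp, rule integral_cong_AE)
      show "AE y in lebesgue. indicator {0<..<t} y *\<^sub>R P y = indicator {0<..<1} y *\<^sub>R indicator {..t} y *\<^sub>R P y"
        using neq[of t] by eventually_elim (use t in \<open>auto simp: indicator_def\<close>)
    qed (intro measurable_lebesgue_indicator_scaleR m; simp)+
    moreover have "P \<in> borel_measurable I01" using m by (rule measurable_restrict_space1)
    ultimately show ?thesis using norm_prim_le_const[of P C t] AE_lebesgue_I01[OF b] by simp
  qed
  have shift: "Z (t + 1) = Z t" if t: "0 \<le> t" for t
  proof -
    have "Z (t + 1) = (\<integral>y. indicator {0<..<1} y *\<^sub>R P y + indicator {1<..<t+1} y *\<^sub>R P y \<partial>lebesgue)"
      unfolding Z_def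
    proof (rule integral_cong_AE)
      show "AE y in lebesgue. indicator {0<..<t + 1} y *\<^sub>R P y = indicator {0<..<1} y *\<^sub>R P y + indicator {1<..<t+1} y *\<^sub>R P y"
        using neq[of 1] by eventually_elim (use t in \<open>auto simp: indicator_def\<close>)
    qed (intro borel_measurable_add measurable_lebesgue_indicator_scaleR m; simp)+
    also have "\<dots> = Z 1 + (\<integral>y. indicator {1<..<t+1} y *\<^sub>R P y \<partial>lebesgue)"
      unfolding Z_def by (rule Bochner_Integration.integral_add[OF int int])
    also have "(\<integral>y. indicator {1<..<t+1} y *\<^sub>R P y \<partial>lebesgue) = (\<integral>y. indicator {1<..<t+1} (1 + y) *\<^sub>R P (1 + y) \<partial>lebesgue)"
      using lebesgue_integral_real_affine[of 1 "\<lambda>y. indicator {1<..<t+1} y *\<^sub>R P y" 1] by simp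
    also have "\<dots> = Z t"
      unfolding Z_def
    proof (rule integral_cong_AE)
      have "integrable lebesgue (\<lambda>y. indicator {1<..<t+1} (1 + 1 * y) *\<^sub>R P (1 + 1 * y))"
        using lebesgue_integrable_real_affine_iff[of 1 "\<lambda>y. indicator {1<..<t+1} y *\<^sub>R P y" 1] int by simp
      then show "(\<lambda>y. indicator {1<..<t+1} (1 + y) *\<^sub>R P (1 + y)) \<in> borel_measurable lebesgue" by auto
      show "AE y in lebesgue. indicator {1<..<t+1} (1 + y) *\<^sub>R P (1 + y) = indicator {0<..<t} y *\<^sub>R P y"
        using per by eventually_elim (auto simp: indicator_def add.commute)
    qed (intro measurable_lebesgue_indicator_scaleR m; simp)+
    finally show ?thesis using Z1 by simp
  qed
  have "\<forall>t. 0 \<le> t \<longrightarrow> t \<le> real k + 1 \<longrightarrow> norm (Z t) \<le> C" for k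
  proof (induction k)
    case (Suc k)
    show ?case
    proof (intro allI impI)
      fix t assume t: "0 \<le> t" "t \<le> real (Suc k) + 1"
      show "norm (Z t) \<le> C"
      proof (cases "t \<le> 1")
        case False
        then show ?thesis using Suc[rule_format, of "t - 1"] shift[of "t - 1"] t by simp
      qed (use small t in simp)
    qed
  qed (use small in simp)
  moreover obtain k where "T \<le> real k" using real_arch_simple by blast
  ultimately show ?thesis using T unfolding Z_def by (meson le_add_same_cancel1 order_trans zero_le_one)
qed

text \<open>Substitution stretches the interval of integration by 1 / e and produces the factor e,
  while the integral over the stretched interval is bounded by C whatever its length.\<close>

lemma prim_periodic_scaled:
  fixes P :: "real \<Rightarrow> 'a::euclidean_space"
  assumes m: "P \<in> borel_measurable lebesgue" and b: "AE y in lebesgue. norm (P y) \<le> C"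
    and per: "AE y in lebesgue. P (y + 1) = P y" and mean: "(\<integral>y. P y \<partial>I01) = 0" and e: "e > 0"
  shows "norm (prim (\<lambda>y. P (y / e)) x) \<le> e * C"
proof -
  define t where "t = max 0 (min x 1)"
  have t: "0 \<le> t" "t \<le> 1" by (auto simp: t_def)
  have neq: "AE y in lebesgue. y \<noteq> x" for x :: real by (metis AE_lborel_singleton AE_completion)
  have mm: "(\<lambda>y. P (y / e)) \<in> borel_measurable lebesgue"
    using measurable_compose[OF lebesgue_measurable_scaling[of "1 / e :: real"] m] by simp
  have "prim (\<lambda>y. P (y / e)) x = (\<integral>y. indicator {0<..<t} y *\<^sub>R P (y / e) \<partial>lebesgue)"
    unfolding prim_def
  proof (subst integral_restrict_space, simp, rule integral_cong_AE)
    show "AE y in lebesgue. indicator {0<..<1} y *\<^sub>R indicator {..x} y *\<^sub>R P (y / e) = indicator {0<..<t} y *\<^sub>R P (y / e)"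
      using neq[of x] by eventually_elim (auto simp: indicator_def t_def)
  qed (intro measurable_lebesgue_indicator_scaleR mm; simp)+
  also have "\<dots> = (\<integral>y. indicator {0<..<t / e} (0 + 1 / e * y) *\<^sub>R P (0 + 1 / e * y) \<partial>lebesgue)"
    by (rule Bochner_Integration.integral_cong) (use e in \<open>auto simp: indicator_def field_simps\<close>)
  also have "\<dots> = e *\<^sub>R (\<integral>y. indicator {0<..<t / e} y *\<^sub>R P y \<partial>lebesgue)"
    using lebesgue_integral_real_affine[of "1 / e" "\<lambda>y. indicator {0<..<t / e} y *\<^sub>R P y" 0] e by simp
  finally show ?thesis
    using periodic_mean_zero_integral_bounded[OF m b per mean, of "t / e"] t e by (simp add: mult_left_mono)
qed

text \<open>The resolvent identity (A + B)^-1 - A^-1 = - (A + B)^-1 B A^-1. The difference of the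
  inverses is thus bounded linearly by B, so an L^1 bound on B carries over to it.\<close>

lemma matrix_inv_resolvent:
  fixes A B :: "real^'n^'n"
  assumes a: "a > 0" "\<And>v. (A *v v) \<bullet> v \<ge> a * (norm v)\<^sup>2"
    and m: "m > 0" "\<And>v. ((A + B) *v v) \<bullet> v \<ge> m * (norm v)\<^sup>2"
  shows "norm (matrix_inv (A + B) - matrix_inv A) \<le> (real CARD('n))\<^sup>2 * (onorm ((*v) B) / (a * m))"
proof (rule norm_matrix_le_bound)
  fix v
  note IA = elliptic_invertible[OF a] and IB = elliptic_invertible[OF m]
  have "matrix_inv A *v v = matrix_inv (A + B) *v ((A + B) *v (matrix_inv A *v v))"
    by (simp only: IB(2))
  also have "(A + B) *v (matrix_inv A *v v) = v + B *v (matrix_inv A *v v)"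
    by (simp add: matrix_vector_mult_add_rdistrib IA(1))
  finally have "(matrix_inv (A + B) - matrix_inv A) *v v = - (matrix_inv (A + B) *v (B *v (matrix_inv A *v v)))"
    by (simp add: matrix_vector_mult_diff_rdistrib matrix_vector_right_distrib algebra_simps)
  then have "norm ((matrix_inv (A + B) - matrix_inv A) *v v) \<le> norm (B *v (matrix_inv A *v v)) / m"
    using IB(3) by simp
  also have "\<dots> \<le> onorm ((*v) B) * norm (matrix_inv A *v v) / m"
    using m(1) by (intro divide_right_mono onorm) auto
  also have "\<dots> \<le> onorm ((*v) B) * (norm v / a) / m"
    using m(1) IA(3)[of v] by (intro divide_right_mono mult_left_mono onorm_pos_le) auto
  finally show "norm ((matrix_inv (A + B) - matrix_inv A) *v v) \<le> onorm ((*v) B) / (a * m) * norm v"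
    by (simp add: mult_ac)
qed

lemma integral_norm_le_nn_integral:
  fixes w :: "real \<Rightarrow> 'a::euclidean_space"
  assumes "integrable I01 w" "(\<integral>\<^sup>+ x. ennreal (norm (w x)) \<partial>I01) \<le> ennreal k" "k \<ge> 0"
  shows "(\<integral>x. norm (w x) \<partial>I01) \<le> k"
proof -
  have "ennreal (\<integral>x. norm (w x) \<partial>I01) = (\<integral>\<^sup>+ x. ennreal (norm (w x)) \<partial>I01)"
    using assms(1) by (intro nn_integral_eq_integral[symmetric]) auto
  then show ?thesis using assms(2,3) by (metis ennreal_le_iff)
qed

text \<open>With Q the primitive of N - N0, integration by parts leaves only Q, which is bounded by
  k, and the slope w of h. The dimension factor converts the Frobenius norm of Q into an operator
  bound; D occurs twice, from the boundary term and from the remaining integral.\<close>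

lemma osc_Lipschitz:
  fixes N :: "real \<Rightarrow> real^'n^'n" and N0 :: "real^'n^'n"
  assumes N: "mat_bdd N r" and k: "\<And>x. norm (prim (\<lambda>y. N y - N0) x) \<le> k"
    and w: "w \<in> borel_measurable I01" "AE x in I01. norm (w x) \<le> D"
    and h: "AE x in I01. h x = h1 + prim w x"
  shows "norm (prim (\<lambda>y. N y *v h y - N0 *v h y) x) \<le> k * (real CARD('n) * (norm h1 + 2 * D))"
proof -
  note wi = integrable_bounded_I01[OF w]
  have Nm: "N \<in> borel_measurable I01" "AE x in I01. \<forall>v. norm (N x *v v) \<le> r * norm v" using N by (auto simp: mat_bdd_def)
  have "AE x in I01. norm (N x) \<le> (real CARD('n))\<^sup>2 * r"
    using Nm(2) by eventually_elim (rule norm_matrix_le_bound, blast)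
  then have Ni: "integrable I01 N" using Nm(1) by (rule integrable_bounded_I01[rotated])
  define q where "q = (\<lambda>y. N y - N0)"
  have qi: "integrable I01 q" unfolding q_def using Ni by simp
  let ?Q = "prim q" and ?n = "real CARD('n)"
  have Q: "norm (?Q x) \<le> k" for x using k unfolding q_def .
  have k0: "0 \<le> k" using Q[of 0] norm_ge_zero order_trans by blast
  have Qm: "norm (?Q x *v v) \<le> k * ?n * norm v" for x v
  proof -
    have "norm (?Q x *v v) \<le> norm (?Q x) * ?n * norm v" by (rule matrix_bound_norm)
    also have "\<dots> \<le> k * ?n * norm v" using Q by (intro mult_right_mono) auto
    finally show ?thesis .
  qed
  have bl: "bounded_linear (\<lambda>M :: real^'n^'n. M *v h1)"
    by (rule bounded_bilinear.bounded_linear_left[OF bounded_bilinear_matrix_vector_mult])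
  have i1: "integrable I01 (\<lambda>y. q y *v h1)" by (rule integrable_bounded_linear[OF bl qi])
  have qn: "AE y in I01. norm (q y) \<le> (real CARD('n))\<^sup>2 * r + norm N0"
  proof -
    have "AE x in I01. norm (N x) \<le> (real CARD('n))\<^sup>2 * r"
      using Nm(2) by eventually_elim (rule norm_matrix_le_bound, blast)
    then show ?thesis unfolding q_def by eventually_elim (meson norm_triangle_ineq4 add_right_mono order_trans)
  qed
  have i2: "integrable I01 (\<lambda>y. q y *v prim w y)"
    by (rule integrable_mult_bounded_I01[OF bounded_bilinear_matrix_vector_mult borel_measurable_integrable[OF qi] qn integrable_prim_I01[OF wi]])
  have i3: "integrable I01 (\<lambda>y. ?Q y *v w y)"
    by (rule integrable_mult_bounded_I01[OF bounded_bilinear_matrix_vector_mult measurable_prim[OF qi] _ wi]) (use Q in auto)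
  have "prim (\<lambda>y. N y *v h y - N0 *v h y) x = prim (\<lambda>y. q y *v h1 + q y *v prim w y) x"
  proof (rule prim_cong_AE[symmetric])
    show "(\<lambda>y. q y *v h1 + q y *v prim w y) \<in> borel_measurable I01" using i1 i2 by simp
    show "AE y in I01. q y *v h1 + q y *v prim w y = N y *v h y - N0 *v h y"
      using h by eventually_elim (simp add: q_def matrix_vector_mult_diff_rdistrib matrix_vector_right_distrib)
  qed
  also have "\<dots> = prim (\<lambda>y. q y *v h1) x + prim (\<lambda>y. q y *v prim w y) x" by (rule prim_add[OF i1 i2])
  also have "prim (\<lambda>y. q y *v h1) x = ?Q x *v h1" by (rule prim_bounded_linear[OF bl qi])
  also have "prim (\<lambda>y. q y *v prim w y) x = ?Q x *v prim w x - prim (\<lambda>y. ?Q y *v w y) x"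
    using prim_by_parts[OF bounded_bilinear_matrix_vector_mult qi wi, of x] by (simp add: eq_diff_eq add.commute)
  finally have "norm (prim (\<lambda>y. N y *v h y - N0 *v h y) x)
      \<le> norm (?Q x *v h1) + (norm (?Q x *v prim w x) + norm (prim (\<lambda>y. ?Q y *v w y) x))"
    by (simp add: norm_triangle_le norm_triangle_le_diff)
  also have "\<dots> \<le> k * ?n * norm h1 + (k * ?n * D + k * ?n * D)"
  proof (intro add_mono)
    show "norm (?Q x *v h1) \<le> k * ?n * norm h1" by (rule Qm)
    have "norm (?Q x *v prim w x) \<le> k * ?n * norm (prim w x)" by (rule Qm)
    also have "\<dots> \<le> k * ?n * D" using norm_prim_le_const[OF w, of x] k0 by (intro mult_left_mono) auto
    finally show "norm (?Q x *v prim w x) \<le> k * ?n * D" .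
    show "norm (prim (\<lambda>y. ?Q y *v w y) x) \<le> k * ?n * D"
    proof (rule norm_prim_le_const)
      show "(\<lambda>y. ?Q y *v w y) \<in> borel_measurable I01" using i3 by simp
      show "AE y in I01. norm (?Q y *v w y) \<le> k * ?n * D"
        using w(2)
      proof eventually_elim
        case (elim y)
        have "norm (?Q y *v w y) \<le> k * ?n * norm (w y)" by (rule Qm)
        also have "\<dots> \<le> k * ?n * D" using elim k0 by (intro mult_left_mono) auto
        finally show ?case .
      qed
    qed
  qed
  finally show ?thesis by (simp add: algebra_simps)
qed

text \<open>For merely bounded \<open>h\<close> integration by parts is applied to an approximation of \<open>h\<close> in \<open>L\<^sup>1\<close> by a
  test function.\<close>

lemma osc_bounded:
  fixes N0 :: "real^'n^'n"
  assumes h: "ess_bdd h" and \<eta>: "\<eta> > 0" and r: "r \<ge> 0" and N0: "mat_bdd (\<lambda>_. N0) r"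
  obtains D where "D \<ge> 0" "\<And>N k x. mat_bdd N r \<Longrightarrow> (\<And>x. norm (prim (\<lambda>y. N y - N0) x) \<le> k) \<Longrightarrow>
    norm (prim (\<lambda>y. N y *v h y - N0 *v h y) x) \<le> \<eta> + k * D"
proof -
  obtain C where C: "h \<in> borel_measurable I01" "AE x in I01. norm (h x) \<le> C" using h by (auto simp: ess_bdd_def)
  have "AE x in I01. norm (h x) \<le> max C 0" using C(2) by eventually_elim auto
  then obtain \<phi> where \<phi>: "\<And>k::nat. \<phi> k \<in> test_functions" "\<And>k x. norm (\<phi> k x) \<le> max C 0 + 1"
    "AE x in I01. (\<lambda>k. \<phi> k x) \<longlonglongrightarrow> h x"
    using test_functions_dense[OF C(1), of "max C 0"] by auto
  note [measurable] = measurable_test_function[OF \<phi>(1)] C(1)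
  have "(\<lambda>k. \<integral>x. norm (h x - \<phi> k x) \<partial>I01) \<longlonglongrightarrow> (\<integral>x. 0 \<partial>I01)"
  proof (rule integral_dominated_convergence[where w="\<lambda>_. C + (max C 0 + 1)"])
    show "AE x in I01. (\<lambda>k. norm (h x - \<phi> k x)) \<longlonglongrightarrow> 0"
      using \<phi>(3)
    proof eventually_elim
      case (elim x)
      show ?case using tendsto_norm[OF tendsto_diff[OF tendsto_const elim, of "h x"]] by simp
    qed
    show "AE x in I01. norm (norm (h x - \<phi> k x)) \<le> C + (max C 0 + 1)" for k
      using C(2) by eventually_elim (simp, meson \<phi>(2) add_mono norm_triangle_ineq4 order_trans)
  qed auto
  then have "(\<lambda>k. \<integral>x. norm (h x - \<phi> k x) \<partial>I01) \<longlonglongrightarrow> 0" by simp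
  \<comment> \<open>Replacing h by the test function costs 2 r times the L^1 error, hence at most
    \<eta>; adding 1 to r covers r = 0.\<close>
  moreover have "0 < \<eta> / (2 * (r + 1))" using \<eta> r by simp
  ultimately have "eventually (\<lambda>k. (\<integral>x. norm (h x - \<phi> k x) \<partial>I01) < \<eta> / (2 * (r + 1))) sequentially"
    by (rule order_tendstoD(2))
  then obtain j where j: "(\<integral>x. norm (h x - \<phi> j x) \<partial>I01) < \<eta> / (2 * (r + 1))"
    using eventually_happens'[OF sequentially_bot] by blast
  let ?g = "\<phi> j"
  let ?d = "\<lambda>x. vector_derivative ?g (at x)"
  have d: "?d \<in> test_functions" by (rule test_function_derivative[OF \<phi>(1)])
  obtain B where B: "0 \<le> B" "\<And>x. norm (?d x) \<le> B" by (rule test_function_bounded[OF d]) blast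
  have bg: "ess_bdd ?g" using \<phi>(2)[of j] by (intro ess_bddI[of _ "max C 0 + 1"]) auto
  show thesis
  \<comment> \<open>The constant depends on h, \<eta> and r through the chosen test function, but
    not on N. Uniformity in B relies on this.\<close>
  proof (rule that[of "real CARD('n) * (norm (0::real^'n) + 2 * B)"])
    show "0 \<le> real CARD('n) * (norm (0::real^'n) + 2 * B)" using B by simp
    fix N k x assume N: "mat_bdd N r" and k: "\<And>x. norm (prim (\<lambda>y. N y - N0) x) \<le> k"
    have ess_bdd: "ess_bdd (\<lambda>y. N y *v h y - N0 *v h y)" "ess_bdd (\<lambda>y. N y *v ?g y - N0 *v ?g y)"
      using ess_bdd_mult[OF N h r] ess_bdd_mult[OF N0 h r] ess_bdd_mult[OF N bg r] ess_bdd_mult[OF N0 bg r] by (auto intro: ess_bdd_diff)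
    have gi: "integrable I01 (\<lambda>y. h y - ?g y)" by (intro ess_bdd_integrable ess_bdd_diff h bg)
    have "norm (prim (\<lambda>y. N y *v h y - N0 *v h y) x - prim (\<lambda>y. N y *v ?g y - N0 *v ?g y) x)
      = norm (prim (\<lambda>y. (N y *v h y - N0 *v h y) - (N y *v ?g y - N0 *v ?g y)) x)"
      by (simp only: prim_ess_bdd_diff[OF ess_bdd])
    also have "\<dots> \<le> prim (\<lambda>y. 2 * r * norm (h y - ?g y)) x"
    proof (rule norm_prim_le)
      show "integrable I01 (\<lambda>y. 2 * r * norm (h y - ?g y))" using gi by simp
      show "(\<lambda>y. (N y *v h y - N0 *v h y) - (N y *v ?g y - N0 *v ?g y)) \<in> borel_measurable I01"
        by (intro ess_bdd_measurable ess_bdd_diff[OF ess_bdd])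
      have "AE y in I01. \<forall>v. norm (N y *v v) \<le> r * norm v" "AE y in I01. \<forall>v. norm (N0 *v v) \<le> r * norm v"
        using N N0 by (auto simp: mat_bdd_def)
      then show "AE y in I01. norm ((N y *v h y - N0 *v h y) - (N y *v ?g y - N0 *v ?g y)) \<le> 2 * r * norm (h y - ?g y)"
      proof eventually_elim
        case (elim y)
        have "(N y *v h y - N0 *v h y) - (N y *v ?g y - N0 *v ?g y) = N y *v (h y - ?g y) - N0 *v (h y - ?g y)"
          by (simp add: matrix_vector_mult_diff_distrib)
        also have "norm \<dots> \<le> norm (N y *v (h y - ?g y)) + norm (N0 *v (h y - ?g y))" by (rule norm_triangle_ineq4)
        also have "\<dots> \<le> r * norm (h y - ?g y) + r * norm (h y - ?g y)" using elim by (intro add_mono) blast+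
        finally show ?case by simp
      qed
    qed
    also have "\<dots> = 2 * r * prim (\<lambda>y. norm (h y - ?g y)) x" by (rule prim_mult)
    also have "\<dots> \<le> 2 * r * (\<integral>y. norm (h y - ?g y) \<partial>I01)"
      using gi r by (intro mult_left_mono prim_le_integral) auto
    also have "\<dots> \<le> 2 * r * (\<eta> / (2 * (r + 1)))" using j r by (intro mult_left_mono) auto
    also have "\<dots> \<le> \<eta>" using r \<eta> by (simp add: field_simps)
    finally have "norm (prim (\<lambda>y. N y *v h y - N0 *v h y) x - prim (\<lambda>y. N y *v ?g y - N0 *v ?g y) x) \<le> \<eta>" .
    moreover have "norm (prim (\<lambda>y. N y *v ?g y - N0 *v ?g y) x) \<le> k * (real CARD('n) * (norm (0::real^'n) + 2 * B))"
      by (rule osc_Lipschitz[OF N k measurable_test_function[OF d]])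
        (use B prim_test_function_derivative(1)[OF \<phi>(1)] in auto)
    ultimately show "norm (prim (\<lambda>y. N y *v h y - N0 *v h y) x) \<le> \<eta> + k * (real CARD('n) * (norm (0::real^'n) + 2 * B))"
      using norm_triangle_sub[of "prim (\<lambda>y. N y *v h y - N0 *v h y) x" "prim (\<lambda>y. N y *v ?g y - N0 *v ?g y) x"]
      by linarith
  qed
qed

section \<open>Superposition operators\<close>

lemma measurable_I01_LIMSEQ_AE:
  fixes f :: "nat \<Rightarrow> real \<Rightarrow> 'a::euclidean_space"
  assumes f: "\<And>k. f k \<in> borel_measurable I01" and lim: "AE x in I01. (\<lambda>k. f k x) \<longlonglongrightarrow> g x"
  shows "g \<in> borel_measurable I01"
proof -
  obtain Z where Z: "{x \<in> space I01. \<not> ((\<lambda>k. f k x) \<longlonglongrightarrow> g x)} \<subseteq> Z" "Z \<in> null_sets I01"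
    using lim by (auto simp: eventually_ae_filter)
  have Zs: "Z \<in> sets I01" using Z(2) by auto
  define G where "G = space I01 - Z"
  have G: "(\<lambda>x. indicator G x :: real) \<in> borel_measurable I01"
    unfolding G_def by (rule borel_measurable_indicator[OF sets.Diff[OF sets.top Zs]])
  have "(\<lambda>x. indicator G x *\<^sub>R g x) \<in> borel_measurable I01"
  proof (rule borel_measurable_LIMSEQ_metric)
    show "(\<lambda>x. indicator G x *\<^sub>R f k x) \<in> borel_measurable I01" for k
      by (intro borel_measurable_scaleR G f)
    show "(\<lambda>k. indicator G x *\<^sub>R f k x) \<longlonglongrightarrow> indicator G x *\<^sub>R g x" if "x \<in> space I01" for x
    proof (cases "x \<in> G")
      case True
      then have "(\<lambda>k. f k x) \<longlonglongrightarrow> g x" using Z(1) that unfolding G_def by blast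
      then show ?thesis by (intro tendsto_intros)
    qed simp
  qed
  moreover have "AE x in I01. x \<notin> Z" using Z(2) by (rule AE_not_in)
  then have "AE x in I01. indicator G x *\<^sub>R g x = g x"
    using AE_space by eventually_elim (simp add: G_def)
  ultimately show ?thesis by (rule measurable_I01_AE)
qed

text \<open>The argument for Caratheodory functions: along a simple function the superposition is a
  finite sum of indicators times measurable functions \<open>f x v\<close>, and continuity in the
  second argument permits the passage to the limit.\<close>

lemma superposition_measurable:
  fixes f :: "real \<Rightarrow> 'b::euclidean_space \<Rightarrow> 'a::euclidean_space"
  assumes f: "\<And>v. (\<lambda>x. f x v) \<in> borel_measurable I01" and c: "AE x in I01. continuous_on UNIV (f x)"
    and u: "u \<in> borel_measurable I01"
  shows "(\<lambda>x. f x (u x)) \<in> borel_measurable I01"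
proof -
  obtain F where F: "\<And>i. simple_function I01 (F i)" "\<And>x. x \<in> space I01 \<Longrightarrow> (\<lambda>i. F i x) \<longlonglongrightarrow> u x"
    using borel_measurable_implies_sequence_metric[OF u, of 0] by blast
  have "(\<lambda>x. f x (F i x)) \<in> borel_measurable I01" for i
  proof -
    have fin: "finite (F i ` space I01)" using F(1)[of i] by (rule simple_functionD)
    have S: "F i -` {v} \<inter> space I01 \<in> sets I01" for v using F(1)[of i] by (rule simple_functionD)
    have "(\<lambda>x. \<Sum>v\<in>F i ` space I01. indicator (F i -` {v} \<inter> space I01) x *\<^sub>R f x v) \<in> borel_measurable I01"
      by (intro borel_measurable_sum borel_measurable_scaleR borel_measurable_indicator S f)
    moreover have "(\<Sum>v\<in>F i ` space I01. indicator (F i -` {v} \<inter> space I01) x *\<^sub>R f x v) = f x (F i x)"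
      if x: "x \<in> space I01" for x
    proof -
      have "(\<Sum>v\<in>F i ` space I01. indicator (F i -` {v} \<inter> space I01) x *\<^sub>R f x v)
        = (\<Sum>v\<in>F i ` space I01. if v = F i x then f x v else 0)"
        by (rule sum.cong) (use x in \<open>auto simp: indicator_def\<close>)
      then show ?thesis using fin x by (simp add: sum.delta')
    qed
    ultimately show ?thesis by (subst measurable_cong[symmetric])
  qed
  moreover have "AE x in I01. (\<lambda>i. f x (F i x)) \<longlonglongrightarrow> f x (u x)"
    using c AE_space
  proof eventually_elim
    case (elim x)
    then show ?case using continuous_on_tendsto_compose[OF elim(1) F(2)[OF elim(2)]] by simp
  qed
  ultimately show ?thesis by (rule measurable_I01_LIMSEQ_AE)
qed

locale C1_superposition =
  fixes f :: "real \<Rightarrow> real^'n \<Rightarrow> real^'n"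
  assumes C1: "C1_into_Linf f" and rep: "continuous_representative f"
begin

abbreviation J :: "real \<Rightarrow> real^'n \<Rightarrow> real^'n^'n" where "J x u \<equiv> jacobian (f x) (at u)"

lemma derivative: "AE x in I01. \<forall>u. (f x has_derivative (\<lambda>h. J x u *v h)) (at u)"
  by (rule C1_into_Linf_regular(1)[OF C1 rep])

lemma measurable:
  assumes "u \<in> borel_measurable I01"
  shows "(\<lambda>x. f x (u x)) \<in> borel_measurable I01"
proof (rule superposition_measurable[OF _ _ assms])
  show "(\<lambda>x. f x v) \<in> borel_measurable I01" for v using C1 by (simp add: C1_into_Linf_def Linf_def)
  show "AE x in I01. continuous_on UNIV (f x)" using rep by (simp add: continuous_representative_def)
qed

text \<open>Each column of the Jacobian is an a.e. limit of difference quotients with step 1/(k+1),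
  and these are superpositions.\<close>

lemma jacobian_measurable:
  assumes u: "u \<in> borel_measurable I01"
  shows "(\<lambda>x. J x (u x)) \<in> borel_measurable I01"
proof (rule measurable_matrixI)
  fix i j
  let ?h = "\<lambda>k. (1 / real (Suc k)) *\<^sub>R (axis j 1 :: real^'n)"
  let ?q = "\<lambda>k x. real (Suc k) *\<^sub>R (f x (u x + ?h k) - f x (u x))"
  have q: "?q k \<in> borel_measurable I01" for k
    using measurable[OF u] measurable[of "\<lambda>x. u x + ?h k"] u by simp
  have "AE x in I01. (\<lambda>k. ?q k x) \<longlonglongrightarrow> J x (u x) *v axis j 1"
    using derivative
  proof eventually_elim
    case (elim x)
    have d: "(f x has_derivative (\<lambda>h. J x (u x) *v h)) (at (u x))" using elim by blast
    show ?case
    proof (rule metric_LIMSEQ_I)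
      fix e :: real assume e: "e > 0"
      then obtain \<delta> where \<delta>: "\<delta> > 0" "\<And>y. norm (y - u x) < \<delta> \<Longrightarrow>
          norm (f x y - f x (u x) - J x (u x) *v (y - u x)) \<le> e / 2 * norm (y - u x)"
        using d unfolding has_derivative_at_alt by (meson half_gt_zero)
      obtain K where K: "inverse (real (Suc K)) < \<delta>" using reals_Archimedean[OF \<delta>(1)] by auto
      show "\<exists>K. \<forall>k\<ge>K. dist (?q k x) (J x (u x) *v axis j 1) < e"
      proof (intro exI[of _ K] allI impI)
        fix k assume k: "K \<le> k"
        have "1 / real (Suc k) \<le> inverse (real (Suc K))"
          using k by (simp add: inverse_eq_divide frac_le)
        then have small: "norm (?h k) < \<delta>" using K by (simp add: norm_axis_1)
        have "norm (f x (u x + ?h k) - f x (u x) - J x (u x) *v ?h k) \<le> e / 2 * norm (?h k)"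
          using \<delta>(2)[of "u x + ?h k"] small by simp
        moreover have "norm (?h k) = 1 / real (Suc k)" by (simp add: norm_axis_1)
        ultimately have "norm (f x (u x + ?h k) - f x (u x) - J x (u x) *v ?h k) \<le> e / 2 * (1 / real (Suc k))"
          by simp
        then have "real (Suc k) * norm (f x (u x + ?h k) - f x (u x) - J x (u x) *v ?h k) \<le> real (Suc k) * (e / 2 * (1 / real (Suc k)))"
          by (intro mult_left_mono) auto
        also have "\<dots> = e / 2" by (simp del: of_nat_Suc)
        also have "real (Suc k) * norm (f x (u x + ?h k) - f x (u x) - J x (u x) *v ?h k)
          = norm (real (Suc k) *\<^sub>R (f x (u x + ?h k) - f x (u x) - J x (u x) *v ?h k))"
          by (simp only: norm_scaleR abs_of_nat)
        also have "real (Suc k) *\<^sub>R (f x (u x + ?h k) - f x (u x) - J x (u x) *v ?h k) = ?q k x - J x (u x) *v axis j 1"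
          by (simp add: scaleR_diff_right matrix_vector_mult_scaleR del: of_nat_Suc)
        finally show "dist (?q k x) (J x (u x) *v axis j 1) < e" using e by (simp add: dist_norm)
      qed
    qed
  qed
  then have "(\<lambda>x. J x (u x) *v axis j 1) \<in> borel_measurable I01" by (rule measurable_I01_LIMSEQ_AE[OF q])
  then have "(\<lambda>x. (J x (u x) *v axis j 1) \<bullet> axis i 1) \<in> borel_measurable I01" by simp
  then show "(\<lambda>x. J x (u x) $ i $ j) \<in> borel_measurable I01"
    by (simp add: inner_axis matrix_vector_mult_basis column_def)
qed

text \<open>The segment from 0 to u is cut into m pieces shorter than the modulus d for accuracy 1.
  The Jacobian changes by at most 1 along each piece, so it stays below C + m.\<close>

lemma jacobian_bound:
  "\<exists>C\<ge>0. AE x in I01. \<forall>u h. norm u \<le> R \<longrightarrow> norm (J x u *v h) \<le> C * norm h"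
proof -
  obtain d where d: "d > 0" "AE x in I01. \<forall>u v h. norm u \<le> R \<longrightarrow> norm v \<le> R \<longrightarrow> norm (v - u) < d \<longrightarrow>
        norm (J x v *v h - J x u *v h) \<le> 1 * norm h"
    using C1_into_Linf_regular(2)[OF C1 rep, of 1 R] by auto
  obtain C where C: "C \<ge> 0" "AE x in I01. \<forall>h. norm (J x 0 *v h) \<le> C * norm h"
    using C1_into_Linf_regular(3)[OF C1 rep] by blast
  obtain m0 where m0: "\<bar>R\<bar> / d < real m0" using reals_Archimedean2 by blast
  define m where "m = Suc m0"
  have m: "real m > 0" "\<bar>R\<bar> / real m < d"
    using m0 d(1) by (auto simp: m_def field_simps)
  have "AE x in I01. \<forall>u h. norm u \<le> R \<longrightarrow> norm (J x u *v h) \<le> (C + real m) * norm h"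
    using d(2) C(2)
  proof eventually_elim
    case (elim x)
    show ?case
    proof (intro allI impI)
      fix u h :: "real^'n" assume u: "norm u \<le> R"
      have "k \<le> m \<Longrightarrow> norm (J x ((real k / real m) *\<^sub>R u) *v h) \<le> (C + real k) * norm h" for k
      proof (induction k)
        case 0
        then show ?case using elim(2) by simp
      next
        case (Suc k)
        let ?a = "(real k / real m) *\<^sub>R u" and ?b = "(real (Suc k) / real m) *\<^sub>R u"
        have le: "norm ((real j / real m) *\<^sub>R u) \<le> R" if "j \<le> m" for j
        proof -
          have "real j / real m \<le> 1" using that m(1) by simp
          then have "real j / real m * norm u \<le> 1 * norm u" using m(1) by (intro mult_right_mono) auto
          then show ?thesis using u m(1) by simp
        qed
        have "?b - ?a = (1 / real m) *\<^sub>R u"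
          by (simp add: scaleR_diff_left[symmetric] diff_divide_distrib[symmetric])
        then have "norm (?b - ?a) = norm u / real m" using m(1) by simp
        also have "\<dots> \<le> \<bar>R\<bar> / real m" using u m(1) by (intro divide_right_mono) auto
        finally have "norm (?b - ?a) < d" using m(2) by simp
        then have "norm (J x ?b *v h - J x ?a *v h) \<le> 1 * norm h"
          using elim(1) le[of k] le[of "Suc k"] Suc.prems by auto
        moreover have "norm (J x ?a *v h) \<le> (C + real k) * norm h" using Suc by simp
        moreover have "norm (J x ?b *v h) \<le> norm (J x ?a *v h) + norm (J x ?b *v h - J x ?a *v h)"
          by (rule norm_triangle_sub)
        ultimately show ?case by (simp add: algebra_simps)
      qed
      from this[of m] m(1) show "norm (J x u *v h) \<le> (C + real m) * norm h" by simp
    qed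
  qed
  then show ?thesis using C(1) by (intro exI[of _ "C + real m"]) auto
qed

lemma bounded_Nemytskii: "bounded_Nemytskii f"
  unfolding bounded_Nemytskii_def
proof (intro allI impI, elim conjE)
  fix u :: "real \<Rightarrow> real^'n" and b :: real
  assume u: "u \<in> borel_measurable I01" "AE x in I01. norm (u x) \<le> b"
  obtain C where C: "C \<ge> 0" "AE x in I01. \<forall>u h. norm u \<le> b \<longrightarrow> norm (J x u *v h) \<le> C * norm h"
    using jacobian_bound by blast
  obtain C0 where C0: "AE x in I01. norm (f x 0) \<le> C0"
  proof -
    have "(\<lambda>x. f x 0) \<in> Linf I01" using C1 unfolding C1_into_Linf_def by blast
    then show thesis by (rule LinfE) (rule that)
  qed
  have "AE x in I01. norm (f x (u x)) \<le> C0 + C * b"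
    using u(2) C(2) C0 derivative
  proof eventually_elim
    case (elim x)
    have b: "0 \<le> b" using elim(1) norm_ge_zero order_trans by blast
    have "norm (f x (u x) - f x 0) \<le> C * norm (u x - 0)"
    proof (rule differentiable_bound[of "cball 0 b" "f x" "\<lambda>v h. J x v *v h"])
      show "(f x has_derivative (*v) (J x v)) (at v within cball 0 b)" for v
        by (rule has_derivative_at_withinI[OF elim(4)[rule_format]])
      show "onorm ((*v) (J x v)) \<le> C" if "v \<in> cball 0 b" for v
        by (rule onorm_le) (rule elim(2)[rule_format], use that in simp)
    qed (use elim(1) b in auto)
    also have "\<dots> \<le> C * b" using elim(1) C(1) by (intro mult_left_mono) auto
    finally show ?case using elim(3) norm_triangle_sub[of "f x (u x)" "f x 0"] by linarith
  qed
  then show "(\<lambda>x. f x (u x)) \<in> borel_measurable I01 \<and> (\<exists>C. AE x in I01. norm (f x (u x)) \<le> C)"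
    using measurable[OF u(1)] by blast
qed

text \<open>The mean value inequality is applied to f x minus its linear part at U x, whose
  derivative is small on a ball of radius \<delta>. As \<delta> \<le> 1, this ball lies in the one
  of radius B + 1 around 0, on which the Jacobian has a modulus uniform in x.\<close>

lemma modulus:
  assumes U: "\<And>x. norm (U x) \<le> B" and e: "e > 0"
  shows "\<exists>\<delta>>0. AE x in I01. \<forall>v w. norm (v - U x) \<le> \<delta> \<longrightarrow> norm (w - U x) \<le> \<delta> \<longrightarrow>
        norm (f x v - f x w - J x (U x) *v (v - w)) \<le> e * norm (v - w)"
proof -
  obtain d where d: "d > 0" "AE x in I01. \<forall>u v h. norm u \<le> B + 1 \<longrightarrow> norm v \<le> B + 1 \<longrightarrow> norm (v - u) < d \<longrightarrow>
        norm (J x v *v h - J x u *v h) \<le> e * norm h"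
    using C1_into_Linf_regular(2)[OF C1 rep e, of "B + 1"] by blast
  define \<delta> where "\<delta> = min 1 (d / 2)"
  have \<delta>: "\<delta> > 0" "\<delta> \<le> 1" "\<delta> < d" using d(1) by (auto simp: \<delta>_def)
  show ?thesis
  proof (intro exI[of _ \<delta>] conjI \<delta>(1))
    show "AE x in I01. \<forall>v w. norm (v - U x) \<le> \<delta> \<longrightarrow> norm (w - U x) \<le> \<delta> \<longrightarrow>
        norm (f x v - f x w - J x (U x) *v (v - w)) \<le> e * norm (v - w)"
      using d(2) derivative
    proof eventually_elim
      case (elim x)
      show ?case
      proof (intro allI impI)
        fix v w assume vw: "norm (v - U x) \<le> \<delta>" "norm (w - U x) \<le> \<delta>"
        let ?S = "cball (U x) \<delta>"
        let ?g = "\<lambda>z. f x z - J x (U x) *v z"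
        have "norm (?g v - ?g w) \<le> e * norm (v - w)"
        proof (rule differentiable_bound[of ?S ?g "\<lambda>z h. J x z *v h - J x (U x) *v h"])
          fix z assume z: "z \<in> ?S"
          have "(f x has_derivative (\<lambda>h. J x z *v h)) (at z within ?S)"
            by (rule has_derivative_at_withinI[OF elim(2)[rule_format]])
          then show "(?g has_derivative (\<lambda>h. J x z *v h - J x (U x) *v h)) (at z within ?S)"
            by (intro has_derivative_diff bounded_linear_imp_has_derivative) auto
          have nz: "norm (z - U x) \<le> \<delta>" using z by (simp add: dist_norm norm_minus_commute)
          have "norm z \<le> norm (U x) + norm (z - U x)" by (rule norm_triangle_sub)
          then have "norm z \<le> B + 1" "norm (U x) \<le> B + 1" "norm (z - U x) < d" using U[of x] nz \<delta> by linarith+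
          then show "onorm (\<lambda>h. J x z *v h - J x (U x) *v h) \<le> e"
            by (intro onorm_le elim(1)[rule_format])
        qed (use vw in \<open>auto simp: dist_norm norm_minus_commute\<close>)
        then show "norm (f x v - f x w - J x (U x) *v (v - w)) \<le> e * norm (v - w)"
          by (simp add: matrix_vector_mult_diff_distrib algebra_simps)
      qed
    qed
  qed
qed

end

section \<open>The homogenized matrix\<close>

locale periodic_coefficient =
  fixes A :: "real \<Rightarrow> real^'n^'n" and m L :: real
  assumes A_meas: "A \<in> borel_measurable lebesgue"
    and per: "AE y in lebesgue. A (y + 1) = A y"
    and m: "m > 0" and ell: "AE y in lebesgue. \<forall>v. (A y *v v) \<bullet> v \<ge> m * (norm v)\<^sup>2"
    and L: "L > 0" and bd: "AE y in lebesgue. \<forall>v. norm (A y *v v) \<le> L * norm v"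
begin

definition N0 :: "real^'n^'n" where "N0 = (\<integral>y. matrix_inv (A y) \<partial>I01)"

lemma elliptic: "elliptic_coefficient A m L"
  using measurable_restrict_space1[OF A_meas] m AE_lebesgue_I01[OF ell] AE_lebesgue_I01[OF bd]
  by unfold_locales

lemma inverse_measurable: "(\<lambda>y. matrix_inv (A y)) \<in> borel_measurable I01"
  using elliptic_coefficient.N_measurable[OF elliptic] unfolding elliptic_coefficient.N_def[OF elliptic, abs_def] .

lemma inverse_bound: "AE y in I01. \<forall>w. norm (matrix_inv (A y) *v w) \<le> 1 / m * norm w"
  using elliptic_coefficient.N_bound[OF elliptic] unfolding elliptic_coefficient.N_def[OF elliptic] .

lemma inverse_integrable: "integrable I01 (\<lambda>y. matrix_inv (A y))"
  by (rule integrable_bounded_I01[OF inverse_measurable, of "(real CARD('n))\<^sup>2 * (1 / m)"])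
    (use inverse_bound in eventually_elim, rule norm_matrix_le_bound, blast)

lemma N0_mult: "N0 *v v = (\<integral>y. matrix_inv (A y) *v v \<partial>I01)" "integrable I01 (\<lambda>y. matrix_inv (A y) *v v)"
proof -
  have bl: "bounded_linear (\<lambda>M :: real^'n^'n. M *v v)"
    by (rule bounded_bilinear.bounded_linear_left[OF bounded_bilinear_matrix_vector_mult])
  show "integrable I01 (\<lambda>y. matrix_inv (A y) *v v)" by (rule integrable_bounded_linear[OF bl inverse_integrable])
  show "N0 *v v = (\<integral>y. matrix_inv (A y) *v v \<partial>I01)"
    unfolding N0_def by (rule integral_bounded_linear[OF bl inverse_integrable, symmetric])
qed

lemma N0_bound: "norm (N0 *v v) \<le> 1 / m * norm v"
proof -
  have "norm (N0 *v v) \<le> (\<integral>y. norm (matrix_inv (A y) *v v) \<partial>I01)"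
    unfolding N0_mult(1) by (rule integral_norm_bound)
  also have "\<dots> \<le> (\<integral>y. 1 / m * norm v \<partial>I01)"
    using N0_mult(2) inverse_bound by (intro integral_mono_AE) auto
  finally show ?thesis by simp
qed

text \<open>For w = A(y)^-1 v the product (A(y)^-1 v) . v equals (A(y) w) . w, which is at least m
  |w|^2, and |v| \<le> L |w|. Averaging over the period keeps the constant m / L^2, and so makes
  \<open>N0\<close> invertible.\<close>

lemma N0_elliptic: "(N0 *v v) \<bullet> v \<ge> m / L\<^sup>2 * (norm v)\<^sup>2"
proof -
  have i: "integrable I01 (\<lambda>y. (matrix_inv (A y) *v v) \<bullet> v)"
    by (rule integrable_bounded_linear[OF bounded_linear_inner_left N0_mult(2)])
  have "AE y in I01. m / L\<^sup>2 * (norm v)\<^sup>2 \<le> (matrix_inv (A y) *v v) \<bullet> v"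
    using AE_lebesgue_I01[OF ell] AE_lebesgue_I01[OF bd]
  proof eventually_elim
    case (elim y)
    let ?w = "matrix_inv (A y) *v v"
    have Aw: "A y *v ?w = v" using elliptic_invertible(1)[OF m] elim(1) by blast
    have "norm v \<le> L * norm ?w" using elim(2)[rule_format, of ?w] Aw by simp
    then have "(norm v)\<^sup>2 \<le> (L * norm ?w)\<^sup>2" by (intro power_mono) auto
    then have "(norm v)\<^sup>2 / L\<^sup>2 \<le> (norm ?w)\<^sup>2"
      using L by (simp add: power_mult_distrib pos_divide_le_eq mult.commute)
    then have "m * ((norm v)\<^sup>2 / L\<^sup>2) \<le> m * (norm ?w)\<^sup>2" using m by (intro mult_left_mono) auto
    also have "\<dots> \<le> (A y *v ?w) \<bullet> ?w" using elim(1) by blast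
    finally show ?case using Aw by (simp add: inner_commute)
  qed
  then have "(\<integral>y. m / L\<^sup>2 * (norm v)\<^sup>2 \<partial>I01) \<le> (\<integral>y. (matrix_inv (A y) *v v) \<bullet> v \<partial>I01)"
    using i by (intro integral_mono_AE) auto
  also have "\<dots> = (N0 *v v) \<bullet> v"
    unfolding N0_mult(1) by (rule integral_inner_left[OF N0_mult(2)])
  finally show ?thesis by simp
qed

lemma N0_pos: "m / L\<^sup>2 > 0" using m L by simp

lemma homogenized: "homogenized_matrix A = matrix_inv N0"
  by (simp add: homogenized_matrix_def N0_def)

lemma homogenized_inverse:
  "N0 *v (homogenized_matrix A *v v) = v" "homogenized_matrix A *v (N0 *v v) = v"
  unfolding homogenized using elliptic_invertible(1,2)[OF N0_pos N0_elliptic] by auto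

text \<open>The same argument with the roles exchanged: \<open>N0\<close> has coercivity constant m
  / L^2 and operator norm at most 1 / m, whence the constant (m / L^2) m^2 for its inverse.
  Inverting once more returns \<open>N0\<close>.\<close>

lemma homogenized_elliptic:
  obtains m' L' where "elliptic_coefficient (\<lambda>x. homogenized_matrix A) m' L'"
    "elliptic_coefficient.N (\<lambda>x. homogenized_matrix A) = (\<lambda>x. N0)"
proof -
  let ?A0 = "homogenized_matrix A"
  define m' where "m' = m / L\<^sup>2 * m\<^sup>2"
  have m': "m' > 0" using m L by (simp add: m'_def)
  have ell: "(?A0 *v v) \<bullet> v \<ge> m' * (norm v)\<^sup>2" for v
  proof -
    let ?w = "?A0 *v v"
    have w: "N0 *v ?w = v" by (rule homogenized_inverse)
    have "norm v \<le> 1 / m * norm ?w" using N0_bound[of ?w] w by simp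
    then have "m * norm v \<le> norm ?w" using m by (simp add: pos_le_divide_eq mult.commute)
    then have "(m * norm v)\<^sup>2 \<le> (norm ?w)\<^sup>2" using m by (intro power_mono) auto
    then have "m / L\<^sup>2 * (m * norm v)\<^sup>2 \<le> m / L\<^sup>2 * (norm ?w)\<^sup>2" using N0_pos by (intro mult_left_mono) auto
    also have "\<dots> \<le> (N0 *v ?w) \<bullet> ?w" by (rule N0_elliptic)
    finally show ?thesis using w by (simp add: m'_def power_mult_distrib inner_commute mult_ac)
  qed
  have e: "elliptic_coefficient (\<lambda>x. ?A0) m' (norm ?A0 * real CARD('n))"
    by unfold_locales (use m' ell matrix_bound_norm in auto)
  have "matrix_inv ?A0 *v v = N0 *v v" for v
    using elliptic_invertible(2)[OF m' ell, of "N0 *v v"] homogenized_inverse(2)[of v] by simp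
  then have "matrix_inv ?A0 = N0" by (simp add: matrix_eq)
  then have "elliptic_coefficient.N (\<lambda>x. ?A0) = (\<lambda>x. N0)"
    unfolding elliptic_coefficient.N_def[OF e, abs_def] by simp
  with e show thesis by (rule that)
qed

text \<open>The two summands of K belong to the periodic part \<open>P\<close> of mean zero and to
  the remainder w caused by B; in the latter, scaling the L^1 norm yields the factor \<epsilon>. B
  enters K only through r.\<close>

lemma perturbed_rate:
  assumes r: "r > 0"
  obtains K where "K \<ge> 0"
    "\<And>\<epsilon> B. \<epsilon> > 0 \<Longrightarrow> B \<in> \<M> A r \<Longrightarrow> elliptic_coefficient (\<lambda>x. A (x / \<epsilon>) + B (x / \<epsilon>)) (1 / r) (L + r)"
    "\<And>\<epsilon> B x. \<epsilon> > 0 \<Longrightarrow> B \<in> \<M> A r \<Longrightarrow>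
      norm (prim (\<lambda>y. matrix_inv (A (y / \<epsilon>) + B (y / \<epsilon>)) - N0) x) \<le> K * \<epsilon>"
proof -
  let ?n = "(real CARD('n))\<^sup>2"
  define Cp where "Cp = ?n * (1 / m) + norm N0"
  have Cp: "Cp \<ge> 0" using m by (simp add: Cp_def)
  \<comment> \<open>\<open>cramer_inverse\<close> replaces \<open>matrix_inv\<close> because
    \<open>P\<close> has to be measurable on the whole line; the two agree a.e. by
    ellipticity.\<close>
  define P where "P = (\<lambda>y. cramer_inverse (A y) - N0)"
  have Pm: "P \<in> borel_measurable lebesgue"
    unfolding P_def using measurable_cramer_inverse[OF A_meas] by simp
  have ci: "AE y in lebesgue. cramer_inverse (A y) = matrix_inv (A y)"
    using ell by eventually_elim (rule cramer_inverse_eq, rule elliptic_invertible(4)[OF m], blast)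
  have Pb: "AE y in lebesgue. norm (P y) \<le> Cp"
    using ell ci
  proof eventually_elim
    case (elim y)
    have "norm (matrix_inv (A y)) \<le> ?n * (1 / m)"
      by (rule norm_matrix_le_bound) (use elliptic_invertible(3)[OF m, of "A y"] elim(1) in simp)
    then show ?case unfolding P_def Cp_def elim(2) by (meson add_right_mono norm_triangle_ineq4 order_trans)
  qed
  have Pper: "AE y in lebesgue. P (y + 1) = P y"
    using per by eventually_elim (simp add: P_def)
  have Pmean: "(\<integral>y. P y \<partial>I01) = 0"
  proof -
    have "(\<integral>y. P y \<partial>I01) = (\<integral>y. matrix_inv (A y) - N0 \<partial>I01)"
    proof (rule integral_cong_AE)
      show "P \<in> borel_measurable I01" using Pm by (rule measurable_restrict_space1)
      show "AE y in I01. P y = matrix_inv (A y) - N0"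
        using AE_lebesgue_I01[OF ci] by eventually_elim (simp add: P_def)
    qed (use inverse_measurable in simp)
    also have "\<dots> = 0" using inverse_integrable by (simp add: N0_def)
    finally show ?thesis .
  qed
  define K where "K = Cp + ?n * (r / m) * r"
  show thesis
  proof (rule that[of K])
    show "K \<ge> 0" using Cp m r by (simp add: K_def)
  next
    fix \<epsilon> B assume \<epsilon>: "\<epsilon> > (0::real)" and BM: "B \<in> \<M> A r"
    have B: "B \<in> borel_measurable lebesgue" "Linf_norm_mat lebesgue B + L1_norm_mat lebesgue B \<le> ennreal r"
      "AE y in lebesgue. \<forall>u. ((A y + B y) *v u) \<bullet> u \<ge> (norm u)\<^sup>2 / r"
      using BM by (auto simp: \<M>_def \<B>_def Linf_mat_def)
    have "Linf_norm_mat lebesgue B \<le> ennreal r"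
      by (rule order_trans[OF _ B(2)]) simp
    then have Bb: "AE y in lebesgue. \<forall>v. norm (B y *v v) \<le> r * norm v"
      using r by (intro AE_bound_Linf_norm_mat) auto
    have "AE y in lebesgue. \<forall>v. norm ((A y + B y) *v v) \<le> (L + r) * norm v"
      using bd Bb
    proof eventually_elim
      case (elim y)
      show ?case
      proof
        fix v
        have "norm ((A y + B y) *v v) \<le> norm (A y *v v) + norm (B y *v v)"
          by (simp add: matrix_vector_mult_add_rdistrib norm_triangle_ineq)
        also have "\<dots> \<le> L * norm v + r * norm v" using elim by (intro add_mono) blast+
        finally show "norm ((A y + B y) *v v) \<le> (L + r) * norm v" by (simp add: algebra_simps)
      qed
    qed
    note sbd = AE_lebesgue_scale[OF \<epsilon> this]
    have "AE y in lebesgue. \<forall>u. ((A y + B y) *v u) \<bullet> u \<ge> 1 / r * (norm u)\<^sup>2" using B(3) by simp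
    note sell = AE_lebesgue_scale[OF \<epsilon> this]
    have ABm: "(\<lambda>y. A y + B y) \<in> borel_measurable lebesgue" using A_meas B(1) by simp
    note sm = measurable_lebesgue_scale[OF ABm, of \<epsilon>]
    show E: "elliptic_coefficient (\<lambda>x. A (x / \<epsilon>) + B (x / \<epsilon>)) (1 / r) (L + r)"
      by unfold_locales (use sm sell sbd r in auto)
    fix x
    define Ne where "Ne = (\<lambda>y. matrix_inv (A (y / \<epsilon>) + B (y / \<epsilon>)))"
    have Nem: "Ne \<in> borel_measurable I01"
      using elliptic_coefficient.N_measurable[OF E] unfolding elliptic_coefficient.N_def[OF E, abs_def] Ne_def .
    have Neb: "AE y in I01. \<forall>w. norm (Ne y *v w) \<le> 1 / (1 / r) * norm w"
      using elliptic_coefficient.N_bound[OF E] unfolding elliptic_coefficient.N_def[OF E] Ne_def .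
    have Nei: "integrable I01 Ne"
      by (rule integrable_bounded_I01[OF Nem, of "?n * (1 / (1 / r))"])
        (use Neb in eventually_elim, rule norm_matrix_le_bound, blast)
    have Psm: "(\<lambda>y. P (y / \<epsilon>)) \<in> borel_measurable I01" by (rule measurable_lebesgue_scale[OF Pm])
    have Psi: "integrable I01 (\<lambda>y. P (y / \<epsilon>))"
      by (rule integrable_bounded_I01[OF Psm AE_lebesgue_scale[OF \<epsilon> Pb]])
    define w where "w = (\<lambda>y. Ne y - N0 - P (y / \<epsilon>))"
    have wi: "integrable I01 w" unfolding w_def using Nei Psi by simp
    \<comment> \<open>\<open>esssup\<close> of a non-measurable function is \<open>top\<close> by
      convention, so the finite norm of B already forces its pointwise operator norm to be
      measurable.\<close>
    have on_m: "(\<lambda>y. ennreal (onorm ((*v) (B y)))) \<in> borel_measurable lebesgue"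
    proof (rule ccontr)
      assume "\<not> ?thesis"
      then have "Linf_norm_mat lebesgue B = top" unfolding Linf_norm_mat_def by (rule esssup_non_measurable)
      then show False using \<open>Linf_norm_mat lebesgue B \<le> ennreal r\<close> by (simp add: top_unique)
    qed
    define c where "c = ?n * (r / m)"
    have c0: "c \<ge> 0" using r m by (simp add: c_def)
    have wb: "AE y in I01. ennreal (norm (w y)) \<le> ennreal c * ennreal (onorm ((*v) (B (y / \<epsilon>))))"
      using sell AE_lebesgue_scale[OF \<epsilon> ell] AE_lebesgue_scale[OF \<epsilon> ci]
    proof eventually_elim
      case (elim y)
      have "w y = matrix_inv (A (y / \<epsilon>) + B (y / \<epsilon>)) - matrix_inv (A (y / \<epsilon>))"
        unfolding w_def Ne_def P_def elim(3) by simp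
      also have "norm \<dots> \<le> ?n * (onorm ((*v) (B (y / \<epsilon>))) / (m * (1 / r)))"
        by (rule matrix_inv_resolvent[OF m _ _]) (use elim r in auto)
      also have "\<dots> = c * onorm ((*v) (B (y / \<epsilon>)))" by (simp add: c_def)
      finally show ?case using c0 by (simp add: ennreal_mult[symmetric] onorm_pos_le ennreal_leI)
    qed
    have "(\<integral>\<^sup>+ y. ennreal (norm (w y)) \<partial>I01) \<le> (\<integral>\<^sup>+ y. ennreal c * ennreal (onorm ((*v) (B (y / \<epsilon>)))) \<partial>I01)"
      by (rule nn_integral_mono_AE[OF wb])
    also have "\<dots> = ennreal c * (\<integral>\<^sup>+ y. ennreal (onorm ((*v) (B (y / \<epsilon>)))) \<partial>I01)"
      by (rule nn_integral_cmult) (rule measurable_lebesgue_scale[OF on_m])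
    also have "\<dots> \<le> ennreal c * (ennreal \<epsilon> * L1_norm_mat lebesgue B)"
      unfolding L1_norm_mat_def by (intro mult_left_mono nn_integral_I01_scale_le[OF on_m \<epsilon>]) simp
    also have "\<dots> \<le> ennreal c * (ennreal \<epsilon> * ennreal r)"
      using B(2) by (intro mult_left_mono) (auto intro: order_trans[rotated])
    also have "\<dots> = ennreal (c * r * \<epsilon>)" using c0 \<epsilon> r by (simp add: ennreal_mult[symmetric] mult_ac)
    finally have "(\<integral>y. norm (w y) \<partial>I01) \<le> c * r * \<epsilon>"
      using c0 \<epsilon> r by (intro integral_norm_le_nn_integral[OF wi]) auto
    then have w: "norm (prim w x) \<le> c * r * \<epsilon>" using norm_prim_le_integral[OF wi, of x] by simp
    have "prim (\<lambda>y. Ne y - N0) x = prim (\<lambda>y. P (y / \<epsilon>) + w y) x" unfolding w_def by simp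
    also have "\<dots> = prim (\<lambda>y. P (y / \<epsilon>)) x + prim w x" by (rule prim_add[OF Psi wi])
    finally have "norm (prim (\<lambda>y. Ne y - N0) x) \<le> \<epsilon> * Cp + c * r * \<epsilon>"
      using norm_triangle_mono[OF prim_periodic_scaled[OF Pm Pb Pper Pmean \<epsilon>] w] by simp
    then show "norm (prim (\<lambda>y. matrix_inv (A (y / \<epsilon>) + B (y / \<epsilon>)) - N0) x) \<le> K * \<epsilon>"
      unfolding Ne_def K_def c_def by (simp add: algebra_simps)
  qed
qed

end

section \<open>The main theorem\<close>

lemma bounded_Nemytskii_linear:
  fixes a :: "real \<Rightarrow> real^'n^'n"
  assumes "mat_bdd a lam" "lam \<ge> 0"
  shows "bounded_Nemytskii (\<lambda>x v. a x *v v)"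
  unfolding bounded_Nemytskii_def
proof (intro allI impI, elim conjE)
  fix u :: "real \<Rightarrow> real^'n" and b
  assume u: "u \<in> borel_measurable I01" "AE x in I01. norm (u x) \<le> b"
  from assms(1) have a: "a \<in> borel_measurable I01" "AE x in I01. \<forall>v. norm (a x *v v) \<le> lam * norm v"
    by (auto simp: mat_bdd_def)
  from bounded_matrix_mult[OF a u assms(2)]
  show "(\<lambda>x. a x *v u x) \<in> borel_measurable I01 \<and> (\<exists>C. AE x in I01. norm (a x *v u x) \<le> C)" by blast
qed

text \<open>The denominator is tailored to this use; the two added ones keep it positive when K or D
  vanishes.\<close>

lemma rate_small:
  fixes \<epsilon> :: real
  assumes "K \<ge> 0" "D \<ge> 0" "\<epsilon> > 0" "\<epsilon> \<le> t / (2 * (K + 1) * (D + 1))"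
  shows "K * \<epsilon> * D \<le> t / 2"
proof -
  have "K * D \<le> (K + 1) * (D + 1)" using assms by (intro mult_mono) auto
  then have "\<epsilon> * (K * D) \<le> \<epsilon> * ((K + 1) * (D + 1))" using assms by (intro mult_left_mono) auto
  also have "\<dots> \<le> t / 2"
  proof -
    have "0 < 2 * (K + 1) * (D + 1)" using assms by simp
    then have "\<epsilon> * (2 * (K + 1) * (D + 1)) \<le> t" using assms(4) by (simp only: pos_le_divide_eq)
    then show ?thesis by (simp add: mult_ac)
  qed
  finally show ?thesis by (simp add: mult_ac)
qed

theorem theorem1p1:
  fixes A :: "real \<Rightarrow> real^'n^'n"
    and c d :: "real \<Rightarrow> real^'n \<Rightarrow> real^'n"
    and u\<^sub>0 :: "real \<Rightarrow> real^'n"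
  assumes A_Linf: "A \<in> Linf_mat lebesgue"
    and A_periodic: "AE y in lebesgue. A (y + 1) = A y"
    and A_elliptic: "\<exists>a>0. AE y in lebesgue. \<forall>u. (A y *v u) \<bullet> u \<ge> a * (norm u)\<^sup>2"
    and c_d_C1: "C1_into_Linf c" "C1_into_Linf d"
    and c_d_repr: "continuous_representative c" "continuous_representative d"
    and u\<^sub>0_solution: "weak_solution (\<lambda>x. homogenized_matrix A) c d u\<^sub>0"
    and u\<^sub>0_nondegenerate:
      "\<And>u. weak_solution (\<lambda>x. homogenized_matrix A)
              (\<lambda>x v. jacobian (c x) (at (u\<^sub>0 x)) *v v)
              (\<lambda>x v. jacobian (d x) (at (u\<^sub>0 x)) *v v) u
            \<Longrightarrow> AE x in I01. u x = 0"
  shows "\<forall>r>1. \<exists>\<epsilon>\<^sub>r>0. \<exists>\<delta>\<^sub>r>0.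
    (let sol = (\<lambda>\<epsilon> B u. weak_solution (\<lambda>x. A (x / \<epsilon>) + B (x / \<epsilon>)) c d u \<and>
                          Linf_norm I01 (\<lambda>x. u x - u\<^sub>0 x) \<le> ennreal \<delta>\<^sub>r)
     in
      (\<forall>\<epsilon>\<in>{0<..\<epsilon>\<^sub>r}. \<forall>B\<in>\<M> A r.
         \<exists>u. sol \<epsilon> B u \<and> (\<forall>v. sol \<epsilon> B v \<longrightarrow> (AE x in I01. v x = u x))) \<and>
      (\<forall>\<eta>>0. \<exists>\<epsilon>\<^sub>1\<in>{0<..\<epsilon>\<^sub>r}. \<forall>\<epsilon>\<in>{0<..\<epsilon>\<^sub>1}. \<forall>B\<in>\<M> A r. \<forall>u.
         sol \<epsilon> B u \<longrightarrow> Linf_norm I01 (\<lambda>x. u x - u\<^sub>0 x) \<le> ennreal \<eta>) \<and>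
      ((\<lambda>x. c x (u\<^sub>0 x)) \<in> W1inf \<longrightarrow>
        (\<exists>C\<ge>0. \<exists>\<epsilon>\<^sub>1\<in>{0<..\<epsilon>\<^sub>r}. \<forall>\<epsilon>\<in>{0<..\<epsilon>\<^sub>1}. \<forall>B\<in>\<M> A r. \<forall>u.
           sol \<epsilon> B u \<longrightarrow> Linf_norm I01 (\<lambda>x. u x - u\<^sub>0 x) \<le> ennreal (C * \<epsilon>))))"
proof (intro allI impI)
  fix r :: real assume r: "r > 1"
  obtain m where m: "m > 0" "AE y in lebesgue. \<forall>u. (A y *v u) \<bullet> u \<ge> m * (norm u)\<^sup>2"
    using A_elliptic by blast
  obtain L where L: "L > 0" "AE y in lebesgue. \<forall>v. norm (A y *v v) \<le> L * norm v"
  proof -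
    have "Linf_norm_mat lebesgue A < \<infinity>" using A_Linf by (simp add: Linf_mat_def)
    then obtain L0 where L0: "L0 \<ge> 0" "Linf_norm_mat lebesgue A = ennreal L0"
      by (cases "Linf_norm_mat lebesgue A") auto
    \<comment> \<open>The bound is raised by 1 because L has to be positive: the coercivity constant
      of \<open>N0\<close> contains 1 / L^2.\<close>
    have "Linf_norm_mat lebesgue A \<le> ennreal (L0 + 1)" using L0 by (simp add: ennreal_leI)
    then show thesis using L0 by (intro that[of "L0 + 1"] AE_bound_Linf_norm_mat) auto
  qed
  interpret pc: periodic_coefficient A m L
    by unfold_locales (use A_Linf A_periodic m L in \<open>auto simp: Linf_mat_def\<close>)
  interpret cc: C1_superposition c by unfold_locales (use c_d_C1 c_d_repr in auto)
  interpret dd: C1_superposition d by unfold_locales (use c_d_C1 c_d_repr in auto)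
  let ?A0 = "homogenized_matrix A" and ?N0 = pc.N0
  obtain m' L' where E0: "elliptic_coefficient (\<lambda>x. ?A0) m' L'"
    and N0: "elliptic_coefficient.N (\<lambda>x. ?A0) = (\<lambda>x. ?N0)"
    by (rule pc.homogenized_elliptic)
  have solution_measurable: "u \<in> borel_measurable I01" if "weak_solution M f g u"
    for M f g and u :: "real \<Rightarrow> real^'n"
    using W12_0_D(1)[of u] that by (simp add: weak_solution_def L2_def)
  note u0m = solution_measurable[OF u\<^sub>0_solution]
  obtain p0 U0 where U0: "\<And>x. U0 x = shoot (\<lambda>x. ?N0) c d p0 U0 x" "U0 1 = 0" "AE x in I01. u\<^sub>0 x = U0 x"
    "\<exists>B. \<forall>x. norm (U0 x) \<le> B" "U0 \<in> borel_measurable I01"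
    by (rule elliptic_coefficient.weak_solution_imp_shoot[OF E0 cc.bounded_Nemytskii dd.bounded_Nemytskii u\<^sub>0_solution, unfolded N0])
       (rule that)
  obtain BU where BU: "\<And>x. norm (U0 x) \<le> BU" using U0(4) by blast
  \<comment> \<open>A common bound for both inverses: coercivity 1 / r of the perturbed coefficient
    gives r, and coercivity m of \<open>A\<close> gives 1 / m for \<open>N0\<close>.\<close>
  define R where "R = max r (1 / m)"
  have R: "R \<ge> 1" "R \<ge> 0" "r \<le> R" "1 / m \<le> R" using r by (auto simp: R_def)
  \<comment> \<open>Taken along \<open>u\<^sub>0\<close>, as in the nondegeneracy hypothesis; a.e.
    this is the Jacobian along \<open>U0\<close>, the representative that shooting works
    with.\<close>
  define a where "a = (\<lambda>x. jacobian (c x) (at (u\<^sub>0 x)))"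
  define b where "b = (\<lambda>x. jacobian (d x) (at (u\<^sub>0 x)))"
  obtain lc where lc: "lc \<ge> 0" "AE x in I01. \<forall>u h. norm u \<le> BU \<longrightarrow> norm (cc.J x u *v h) \<le> lc * norm h"
    using cc.jacobian_bound by blast
  obtain ld where ld: "ld \<ge> 0" "AE x in I01. \<forall>u h. norm u \<le> BU \<longrightarrow> norm (dd.J x u *v h) \<le> ld * norm h"
    using dd.jacobian_bound by blast
  define lam where "lam = max lc ld"
  have lam: "lam \<ge> 0" using lc(1) by (simp add: lam_def)
  have ab: "mat_bdd a lam" "mat_bdd b lam"
  proof -
    have "AE x in I01. \<forall>v. norm (a x *v v) \<le> lam * norm v"
      using lc(2) U0(3)
    proof eventually_elim
      case (elim x)
      have "norm (a x *v v) \<le> lc * norm v" for v using elim BU[of x] by (simp add: a_def)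
      moreover have "lc * norm v \<le> lam * norm v" for v :: "real^'n"
        by (rule mult_right_mono) (auto simp: lam_def)
      ultimately show ?case using order_trans by blast
    qed
    then show "mat_bdd a lam" unfolding mat_bdd_def a_def using cc.jacobian_measurable[OF u0m] by blast
    have "AE x in I01. \<forall>v. norm (b x *v v) \<le> lam * norm v"
      using ld(2) U0(3)
    proof eventually_elim
      case (elim x)
      have "norm (b x *v v) \<le> ld * norm v" for v using elim BU[of x] by (simp add: b_def)
      moreover have "ld * norm v \<le> lam * norm v" for v :: "real^'n"
        by (rule mult_right_mono) (auto simp: lam_def)
      ultimately show ?case using order_trans by blast
    qed
    then show "mat_bdd b lam" unfolding mat_bdd_def b_def using dd.jacobian_measurable[OF u0m] by blast
  qed
  have mbN0: "mat_bdd (\<lambda>x. ?N0) R"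
  proof -
    have "norm (?N0 *v v) \<le> R * norm v" for v
      using pc.N0_bound[of v] mult_right_mono[OF R(4) norm_ge_zero[of v]] by linarith
    then show ?thesis by (simp add: mat_bdd_def)
  qed
  have ess_bdd_sup: "ess_bdd (\<lambda>x. f x (U0 x))" if f: "bounded_Nemytskii f" for f :: "real \<Rightarrow> real^'n \<Rightarrow> real^'n"
  proof -
    obtain C where "(\<lambda>x. f x (U0 x)) \<in> borel_measurable I01" "AE x in I01. norm (f x (U0 x)) \<le> C"
      by (rule bounded_NemytskiiE[OF f U0(5), of BU]) (use BU in auto)
    then show ?thesis by (rule ess_bddI)
  qed
  have modulus: "\<exists>\<delta>>0. AE x in I01. \<forall>v w. norm (v - U0 x) \<le> \<delta> \<longrightarrow> norm (w - U0 x) \<le> \<delta> \<longrightarrow>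
        norm (c x v - c x w - a x *v (v - w)) \<le> e * norm (v - w) \<and>
        norm (d x v - d x w - b x *v (v - w)) \<le> e * norm (v - w)" if e: "e > 0" for e
  proof -
    obtain \<delta>1 where \<delta>1: "\<delta>1 > 0" "AE x in I01. \<forall>v w. norm (v - U0 x) \<le> \<delta>1 \<longrightarrow> norm (w - U0 x) \<le> \<delta>1 \<longrightarrow>
        norm (c x v - c x w - cc.J x (U0 x) *v (v - w)) \<le> e * norm (v - w)"
      using cc.modulus[of U0, OF BU e] by blast
    obtain \<delta>2 where \<delta>2: "\<delta>2 > 0" "AE x in I01. \<forall>v w. norm (v - U0 x) \<le> \<delta>2 \<longrightarrow> norm (w - U0 x) \<le> \<delta>2 \<longrightarrow>
        norm (d x v - d x w - dd.J x (U0 x) *v (v - w)) \<le> e * norm (v - w)"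
      using dd.modulus[of U0, OF BU e] by blast
    show ?thesis
    proof (intro exI[of _ "min \<delta>1 \<delta>2"] conjI)
      show "0 < min \<delta>1 \<delta>2" using \<delta>1 \<delta>2 by simp
      show "AE x in I01. \<forall>v w. norm (v - U0 x) \<le> min \<delta>1 \<delta>2 \<longrightarrow> norm (w - U0 x) \<le> min \<delta>1 \<delta>2 \<longrightarrow>
        norm (c x v - c x w - a x *v (v - w)) \<le> e * norm (v - w) \<and>
        norm (d x v - d x w - b x *v (v - w)) \<le> e * norm (v - w)"
        using \<delta>1(2) \<delta>2(2) U0(3) by eventually_elim (simp add: a_def b_def)
    qed
  qed
  \<comment> \<open>The hypothesis gives X = 0 a.e. only. Then the slope is a.e. the constant
    \<open>N0\<close> q, whose integral is X 1 = 0, and q = 0 by invertibility of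
    \<open>N0\<close>.\<close>
  have nondegenerate: "q = 0"
    if X: "\<And>x. X x = shoot (\<lambda>_. ?N0) (\<lambda>x v. a x *v v) (\<lambda>x v. b x *v v) q X x"
      "X \<in> borel_measurable I01" "\<exists>B. \<forall>x. norm (X x) \<le> B" "X 1 = 0" for q X
  proof -
    obtain BX where BX: "\<And>x. norm (X x) \<le> BX" using X(3) by blast
    have "weak_solution (\<lambda>x. ?A0) (\<lambda>x v. a x *v v) (\<lambda>x v. b x *v v) X"
      by (rule elliptic_coefficient.shoot_imp_weak_solution[OF E0 bounded_Nemytskii_linear[OF ab(1) lam]
            bounded_Nemytskii_linear[OF ab(2) lam], unfolded N0, OF X(1,4,2) BX])
    then have X0: "AE x in I01. X x = 0"
      unfolding a_def b_def by (rule u\<^sub>0_nondegenerate)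
    have "prim (\<lambda>z. 0) y = prim (\<lambda>z. b z *v X z) y" for y
      by (rule prim_cong_AE) (use X0 in \<open>eventually_elim, simp\<close>, simp)
    then have bX: "prim (\<lambda>z. b z *v X z) y = 0" for y by simp
    have "prim (\<lambda>_. ?N0 *v q) 1 = prim (shoot_slope (\<lambda>_. ?N0) (\<lambda>x v. a x *v v) (\<lambda>x v. b x *v v) q X) 1"
      by (rule prim_cong_AE) (use X0 in \<open>eventually_elim, simp add: shoot_slope_def bX\<close>, simp)
    then have "?N0 *v q = 0" using X(1)[of 1] X(4) prim_ge_1[of 1 "\<lambda>_. ?N0 *v q"] by simp
    then show "q = 0" using pc.homogenized_inverse(2)[of q] by simp
  qed
  interpret sh: shooting c d a b "\<lambda>_. ?N0" U0 p0 R lam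
  proof
    show "(\<lambda>x. c x (u x)) \<in> borel_measurable I01" "(\<lambda>x. d x (u x)) \<in> borel_measurable I01"
      if "u \<in> borel_measurable I01" for u
      using cc.measurable[OF that] dd.measurable[OF that] by auto
  qed (fact R(1) lam U0(1,2,4,5) ab mbN0 ess_bdd_sup[OF cc.bounded_Nemytskii] ess_bdd_sup[OF dd.bounded_Nemytskii] modulus
      | rule nondegenerate, assumption+)+
  \<comment> \<open>These constants stem from the homogenized problem and R; \<epsilon> and B enter
    afterwards, through the size of \<open>osc\<close>.\<close>
  obtain \<delta> s C where \<delta>: "\<delta> > 0" and s: "s > 0" and C: "C \<ge> 0"
    and ex: "\<And>N. mat_bdd N R \<Longrightarrow> (\<And>i x. norm (sh.osc N (sh.H i) x) \<le> s) \<Longrightarrow> (\<And>x. norm (sh.osc N sh.h0 x) \<le> s) \<Longrightarrow>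
      \<exists>p U. sh.solution N p U \<and> (\<forall>x. norm (U x - U0 x) \<le> \<delta>)"
    and uniq: "\<And>N p q U V x. mat_bdd N R \<Longrightarrow> (\<And>i x. norm (sh.osc N (sh.H i) x) \<le> s) \<Longrightarrow> sh.solution N p U \<Longrightarrow> sh.close \<delta> U \<Longrightarrow>
      sh.solution N q V \<Longrightarrow> sh.close \<delta> V \<Longrightarrow> U x = V x"
    and rate: "\<And>N p U \<rho> x. mat_bdd N R \<Longrightarrow> (\<And>i x. norm (sh.osc N (sh.H i) x) \<le> s) \<Longrightarrow> sh.solution N p U \<Longrightarrow> sh.close \<delta> U \<Longrightarrow>
      (\<And>x. norm (sh.osc N sh.h0 x) \<le> \<rho>) \<Longrightarrow> norm (U x - U0 x) \<le> C * \<rho>"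
    apply (rule sh.perturbation)
    subgoal premises prems for \<delta> s C by (rule prems(1)[of \<delta> s C]; fact prems)
    done
  have r0: "r > 0" using r by simp
  obtain K where K: "K \<ge> 0"
    and Eeps: "\<And>\<epsilon> B. \<epsilon> > 0 \<Longrightarrow> B \<in> \<M> A r \<Longrightarrow> elliptic_coefficient (\<lambda>x. A (x / \<epsilon>) + B (x / \<epsilon>)) (1 / r) (L + r)"
    and Krate: "\<And>\<epsilon> B x. \<epsilon> > 0 \<Longrightarrow> B \<in> \<M> A r \<Longrightarrow>
      norm (prim (\<lambda>y. matrix_inv (A (y / \<epsilon>) + B (y / \<epsilon>)) - ?N0) x) \<le> K * \<epsilon>"
    by (rule pc.perturbed_rate[OF r0]) (rule that)
  define N where "N = (\<lambda>\<epsilon> B y. matrix_inv (A (y / \<epsilon>) + B (y / \<epsilon>)))"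
  have N: "elliptic_coefficient.N (\<lambda>x. A (x / \<epsilon>) + B (x / \<epsilon>)) = N \<epsilon> B" if "\<epsilon> > 0" "B \<in> \<M> A r" for \<epsilon> B
    unfolding elliptic_coefficient.N_def[OF Eeps[OF that], abs_def] N_def ..
  have mbN: "mat_bdd (N \<epsilon> B) R" if "\<epsilon> > 0" "B \<in> \<M> A r" for \<epsilon> B
  proof -
    have "AE x in I01. \<forall>w. norm (N \<epsilon> B x *v w) \<le> 1 / (1 / r) * norm w"
      using elliptic_coefficient.N_bound[OF Eeps[OF that]] unfolding N[OF that] .
    then have "AE x in I01. \<forall>w. norm (N \<epsilon> B x *v w) \<le> R * norm w"
    proof eventually_elim
      case (elim x)
      show ?case
      proof
        fix w
        have "norm (N \<epsilon> B x *v w) \<le> r * norm w" using elim by simp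
        also have "\<dots> \<le> R * norm w" by (rule mult_right_mono[OF R(3)]) simp
        finally show "norm (N \<epsilon> B x *v w) \<le> R * norm w" .
      qed
    qed
    then show ?thesis
      using elliptic_coefficient.N_measurable[OF Eeps[OF that]] unfolding mat_bdd_def N[OF that] by blast
  qed
  have kN: "norm (prim (\<lambda>y. N \<epsilon> B y - ?N0) x) \<le> K * \<epsilon>" if "\<epsilon> > 0" "B \<in> \<M> A r" for \<epsilon> B x
    unfolding N_def by (rule Krate[OF that])
  \<comment> \<open>\<open>osc_bounded\<close> is used with k = K \<epsilon>, and its constant D is
    the same for all \<epsilon> and B.\<close>
  have osc: "\<exists>D\<ge>0. \<forall>\<epsilon> B x. \<epsilon> > 0 \<longrightarrow> B \<in> \<M> A r \<longrightarrow> norm (sh.osc (N \<epsilon> B) h x) \<le> t + K * \<epsilon> * D"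
    if h: "ess_bdd h" and t: "t > 0" for h t
  proof -
    obtain D where D: "D \<ge> 0" "\<And>N k x. mat_bdd N R \<Longrightarrow> (\<And>x. norm (prim (\<lambda>y. N y - ?N0) x) \<le> k) \<Longrightarrow>
      norm (prim (\<lambda>y. N y *v h y - ?N0 *v h y) x) \<le> t + k * D"
      apply (rule osc_bounded[OF h t R(2) mbN0])
      subgoal premises prems for D by (rule prems(1)[of D]; fact prems)
      done
    show ?thesis
      unfolding sh.osc_def using D(1) D(2)[OF mbN kN] by blast
  qed
  have "\<forall>i. \<exists>D\<ge>0. \<forall>\<epsilon> B x. \<epsilon> > 0 \<longrightarrow> B \<in> \<M> A r \<longrightarrow> norm (sh.osc (N \<epsilon> B) (sh.H i) x) \<le> s / 2 + K * \<epsilon> * D"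
    using osc[OF sh.ess_bdd_H, of "s / 2"] s by simp
  from choice[OF this] obtain DH where DH: "\<And>i. DH i \<ge> 0" "\<And>i \<epsilon> B x. \<epsilon> > 0 \<Longrightarrow> B \<in> \<M> A r \<Longrightarrow>
      norm (sh.osc (N \<epsilon> B) (sh.H i) x) \<le> s / 2 + K * \<epsilon> * DH i" by blast
  obtain D0 where D0: "D0 \<ge> 0" "\<And>\<epsilon> B x. \<epsilon> > 0 \<Longrightarrow> B \<in> \<M> A r \<Longrightarrow>
      norm (sh.osc (N \<epsilon> B) sh.h0 x) \<le> s / 2 + K * \<epsilon> * D0"
    using osc[OF sh.ess_bdd_h0, of "s / 2"] s by auto
  \<comment> \<open>One constant that dominates \<open>D0\<close> and each of the finitely many
    nonnegative \<open>DH i\<close>.\<close>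
  define D where "D = D0 + (\<Sum>i\<in>UNIV. DH i)"
  have sumDH: "0 \<le> (\<Sum>i\<in>UNIV. DH i)" by (rule sum_nonneg) (rule DH(1))
  have D: "D \<ge> 0" "D0 \<le> D" using D0(1) sumDH by (auto simp: D_def)
  have DHle: "DH i \<le> D" for i
    using member_le_sum[of i UNIV DH] DH(1) D0(1) by (simp add: D_def add_increasing)
  \<comment> \<open>By \<open>rate_small\<close> this makes K \<epsilon> D at most s / 2, which
    together with the approximation error s / 2 keeps the oscillations below the threshold
    s.\<close>
  define \<epsilon>r where "\<epsilon>r = s / (2 * (K + 1) * (D + 1))"
  have \<epsilon>r: "\<epsilon>r > 0" using s K D(1) by (simp add: \<epsilon>r_def)
  have oscH: "norm (sh.osc (N \<epsilon> B) (sh.H i) x) \<le> s" and osch0: "norm (sh.osc (N \<epsilon> B) sh.h0 x) \<le> s"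
    if e: "0 < \<epsilon>" "\<epsilon> \<le> \<epsilon>r" and B: "B \<in> \<M> A r" for \<epsilon> B x i
  proof -
    have le: "K * \<epsilon> * D \<le> s / 2" by (rule rate_small[OF K D(1) e(1) e(2)[unfolded \<epsilon>r_def]])
    have *: "s / 2 + K * \<epsilon> * D' \<le> s" if "D' \<le> D" for D'
    proof -
      have "K * \<epsilon> * D' \<le> K * \<epsilon> * D" using that K e by (intro mult_left_mono) auto
      then show ?thesis using le by linarith
    qed
    show "norm (sh.osc (N \<epsilon> B) (sh.H i) x) \<le> s" by (rule order_trans[OF DH(2)[OF e(1) B] *[OF DHle]])
    show "norm (sh.osc (N \<epsilon> B) sh.h0 x) \<le> s" by (rule order_trans[OF D0(2)[OF e(1) B] *[OF D(2)]])
  qed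
  \<comment> \<open>Weak solutions within \<open>\<delta>\<close> of \<open>u\<^sub>0\<close> are
    shooting solutions near \<open>U0\<close>, so uniqueness and the estimates can be read off from
    \<open>perturbation\<close>.\<close>
  have fwd: "\<exists>p U. sh.solution (N \<epsilon> B) p U \<and> sh.close \<delta> U \<and> (AE x in I01. u x = U x)"
    if e: "0 < \<epsilon>" and B: "B \<in> \<M> A r" and u: "weak_solution (\<lambda>x. A (x / \<epsilon>) + B (x / \<epsilon>)) c d u"
      "Linf_norm I01 (\<lambda>x. u x - u\<^sub>0 x) \<le> ennreal \<delta>" for \<epsilon> B u
  proof -
    obtain p U where U: "\<And>x. U x = shoot (N \<epsilon> B) c d p U x" "U 1 = 0" "AE x in I01. u x = U x"
      "\<exists>B. \<forall>x. norm (U x) \<le> B" "U \<in> borel_measurable I01"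
      by (rule elliptic_coefficient.weak_solution_imp_shoot[OF Eeps[OF e B] cc.bounded_Nemytskii dd.bounded_Nemytskii u(1), unfolded N[OF e B]])
         (rule that)
    have "AE x in I01. norm (u x - u\<^sub>0 x) \<le> \<delta>" by (rule AE_norm_le_Linf_norm[OF u(2) less_imp_le[OF \<delta>]])
    then have "sh.close \<delta> U" unfolding sh.close_def using U(3) U0(3) by eventually_elim simp
    moreover have "sh.solution (N \<epsilon> B) p U" unfolding sh.solution_def using U by blast
    ultimately show ?thesis using U(3) by blast
  qed
  have est: "Linf_norm I01 (\<lambda>x. u x - u\<^sub>0 x) \<le> ennreal (C * \<rho>)"
    if e: "0 < \<epsilon>" "\<epsilon> \<le> \<epsilon>r" and B: "B \<in> \<M> A r" and u: "weak_solution (\<lambda>x. A (x / \<epsilon>) + B (x / \<epsilon>)) c d u"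
      "Linf_norm I01 (\<lambda>x. u x - u\<^sub>0 x) \<le> ennreal \<delta>"
      and \<rho>: "\<And>x. norm (sh.osc (N \<epsilon> B) sh.h0 x) \<le> \<rho>" for \<epsilon> B u \<rho>
  proof -
    obtain p U where U: "sh.solution (N \<epsilon> B) p U" "sh.close \<delta> U" "AE x in I01. u x = U x"
      using fwd[OF e(1) B u] by blast
    have le: "norm (U x - U0 x) \<le> C * \<rho>" for x by (rule rate[OF mbN[OF e(1) B] oscH[OF e B] U(1,2) \<rho>])
    have "0 \<le> C * \<rho>" using le[of 0] norm_ge_zero order_trans by blast
    moreover have "AE x in I01. norm (u x - u\<^sub>0 x) \<le> C * \<rho>" using U(3) U0(3) by eventually_elim (simp add: le)
    ultimately show ?thesis
      using solution_measurable[OF u(1)] u0m by (subst Linf_norm_le_iff) auto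
  qed
  have exists_unique: "\<exists>u. (weak_solution (\<lambda>x. A (x / \<epsilon>) + B (x / \<epsilon>)) c d u \<and> Linf_norm I01 (\<lambda>x. u x - u\<^sub>0 x) \<le> ennreal \<delta>) \<and>
      (\<forall>v. weak_solution (\<lambda>x. A (x / \<epsilon>) + B (x / \<epsilon>)) c d v \<and> Linf_norm I01 (\<lambda>x. v x - u\<^sub>0 x) \<le> ennreal \<delta>
        \<longrightarrow> (AE x in I01. v x = u x))"
    if e: "0 < \<epsilon>" "\<epsilon> \<le> \<epsilon>r" and B: "B \<in> \<M> A r" for \<epsilon> B
  proof -
    obtain p U where U: "sh.solution (N \<epsilon> B) p U" "\<And>x. norm (U x - U0 x) \<le> \<delta>"
      using ex[OF mbN[OF e(1) B] oscH[OF e B] osch0[OF e B]] by blast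
    obtain BB where BB: "\<And>x. norm (U x) \<le> BB" using U(1) unfolding sh.solution_def by blast
    have Us: "\<And>x. U x = shoot (N \<epsilon> B) c d p U x" "U 1 = 0" "U \<in> borel_measurable I01"
      using U(1) unfolding sh.solution_def by blast+
    have cl: "sh.close \<delta> U" using U(2) by (simp add: sh.close_def)
    have "weak_solution (\<lambda>x. A (x / \<epsilon>) + B (x / \<epsilon>)) c d U"
      by (rule elliptic_coefficient.shoot_imp_weak_solution[OF Eeps[OF e(1) B] cc.bounded_Nemytskii dd.bounded_Nemytskii,
            unfolded N[OF e(1) B], OF Us BB])
    moreover have "AE x in I01. norm (U x - u\<^sub>0 x) \<le> \<delta>" using U0(3) by eventually_elim (simp add: U(2))
    then have "Linf_norm I01 (\<lambda>x. U x - u\<^sub>0 x) \<le> ennreal \<delta>"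
      using Us(3) u0m \<delta> by (subst Linf_norm_le_iff) auto
    moreover have "AE x in I01. v x = U x"
      if v: "weak_solution (\<lambda>x. A (x / \<epsilon>) + B (x / \<epsilon>)) c d v" "Linf_norm I01 (\<lambda>x. v x - u\<^sub>0 x) \<le> ennreal \<delta>" for v
    proof -
      obtain q V where V: "sh.solution (N \<epsilon> B) q V" "sh.close \<delta> V" "AE x in I01. v x = V x"
        using fwd[OF e(1) B v] by blast
      have "V x = U x" for x by (rule uniq[OF mbN[OF e(1) B] oscH[OF e B] V(1,2) U(1) cl])
      then show ?thesis using V(3) by simp
    qed
    ultimately show ?thesis by blast
  qed
  have convergence: "\<exists>\<epsilon>1\<in>{0<..\<epsilon>r}. \<forall>\<epsilon>\<in>{0<..\<epsilon>1}. \<forall>B\<in>\<M> A r. \<forall>u.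
      weak_solution (\<lambda>x. A (x / \<epsilon>) + B (x / \<epsilon>)) c d u \<and> Linf_norm I01 (\<lambda>x. u x - u\<^sub>0 x) \<le> ennreal \<delta> \<longrightarrow>
      Linf_norm I01 (\<lambda>x. u x - u\<^sub>0 x) \<le> ennreal \<eta>" if \<eta>: "\<eta> > 0" for \<eta>
  proof -
    \<comment> \<open>Adding 1 to C admits C = 0.\<close>
    define \<rho> where "\<rho> = \<eta> / (C + 1)"
    have \<rho>: "\<rho> > 0" using \<eta> C by (simp add: \<rho>_def)
    have C\<rho>: "C * \<rho> \<le> \<eta>" using \<eta> C by (simp add: \<rho>_def field_simps)
    obtain D' where D': "D' \<ge> 0" "\<And>\<epsilon> B x. \<epsilon> > 0 \<Longrightarrow> B \<in> \<M> A r \<Longrightarrow>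
        norm (sh.osc (N \<epsilon> B) sh.h0 x) \<le> \<rho> / 2 + K * \<epsilon> * D'"
      using osc[OF sh.ess_bdd_h0, of "\<rho> / 2"] \<rho> by auto
    define \<epsilon>1 where "\<epsilon>1 = min \<epsilon>r (\<rho> / (2 * (K + 1) * (D' + 1)))"
    have \<epsilon>1: "\<epsilon>1 \<in> {0<..\<epsilon>r}" using \<epsilon>r \<rho> K D'(1) by (simp add: \<epsilon>1_def)
    show ?thesis
    proof (intro bexI[OF _ \<epsilon>1] ballI allI impI, elim conjE)
      fix \<epsilon> B u assume e: "\<epsilon> \<in> {0<..\<epsilon>1}" and B: "B \<in> \<M> A r"
        and u: "weak_solution (\<lambda>x. A (x / \<epsilon>) + B (x / \<epsilon>)) c d u" "Linf_norm I01 (\<lambda>x. u x - u\<^sub>0 x) \<le> ennreal \<delta>"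
      have e': "0 < \<epsilon>" "\<epsilon> \<le> \<epsilon>r" "\<epsilon> \<le> \<rho> / (2 * (K + 1) * (D' + 1))" using e by (auto simp: \<epsilon>1_def)
      have "norm (sh.osc (N \<epsilon> B) sh.h0 x) \<le> \<rho>" for x
        using D'(2)[OF e'(1) B, of x] rate_small[OF K D'(1) e'(1,3)] by linarith
      from est[OF e'(1,2) B u this] show "Linf_norm I01 (\<lambda>x. u x - u\<^sub>0 x) \<le> ennreal \<eta>"
        by (rule order_trans) (rule ennreal_leI[OF C\<rho>])
    qed
  qed
  have linear_rate: "\<exists>C\<ge>0. \<exists>\<epsilon>1\<in>{0<..\<epsilon>r}. \<forall>\<epsilon>\<in>{0<..\<epsilon>1}. \<forall>B\<in>\<M> A r. \<forall>u.
      weak_solution (\<lambda>x. A (x / \<epsilon>) + B (x / \<epsilon>)) c d u \<and> Linf_norm I01 (\<lambda>x. u x - u\<^sub>0 x) \<le> ennreal \<delta> \<longrightarrow>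
      Linf_norm I01 (\<lambda>x. u x - u\<^sub>0 x) \<le> ennreal (C * \<epsilon>)" if W: "(\<lambda>x. c x (u\<^sub>0 x)) \<in> W1inf"
  proof -
    obtain c1 w Cw where w: "w \<in> borel_measurable I01" "AE x in I01. norm (w x) \<le> Cw" "Cw \<ge> 0"
      "AE x in I01. c x (u\<^sub>0 x) = c1 + prim w x" using W by (rule W1infE)
    let ?d = "\<lambda>z. d z (U0 z)"
    have bmw: "ess_bdd w" using w(1,2) by (rule ess_bddI)
    \<comment> \<open>If c(x,u0(x)) has a bounded weak derivative w, then \<open>h0\<close> has the
      bounded slope d(x,U0(x)) - w. So \<open>osc_Lipschitz\<close> applies to \<open>h0\<close>
      directly, without the approximation error of \<open>osc_bounded\<close>, and the rate is
      linear.\<close>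
    define w' where "w' = (\<lambda>x. ?d x - w x)"
    have "ess_bdd w'" unfolding w'_def by (intro ess_bdd_diff bmw ess_bdd_sup dd.bounded_Nemytskii)
    then obtain W' where W': "AE x in I01. norm (w' x) \<le> W'" "w' \<in> borel_measurable I01" by (auto simp: ess_bdd_def)
    have W'0: "AE x in I01. norm (w' x) \<le> max W' 0" using W'(1) by eventually_elim simp
    have h0: "AE x in I01. sh.h0 x = (p0 - c1) + prim w' x"
      using w(4) U0(3)
    proof eventually_elim
      case (elim x)
      have "prim w' x = prim ?d x - prim w x"
        unfolding w'_def by (intro prim_ess_bdd_diff bmw ess_bdd_sup dd.bounded_Nemytskii)
      then show ?case using elim by (simp add: sh.h0_def)
    qed
    define Q where "Q = real CARD('n) * (norm (p0 - c1) + 2 * max W' 0)"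
    have Q: "Q \<ge> 0" by (simp add: Q_def)
    have oscQ: "norm (sh.osc (N \<epsilon> B) sh.h0 x) \<le> K * \<epsilon> * Q" if "0 < \<epsilon>" "B \<in> \<M> A r" for \<epsilon> B x
      unfolding sh.osc_def Q_def by (rule osc_Lipschitz[OF mbN[OF that] kN[OF that] W'(2) W'0 h0])
    show ?thesis
    proof (intro exI[of _ "C * K * Q"] conjI bexI[of _ \<epsilon>r] ballI allI impI, goal_cases)
      case 1 then show ?case using C K Q by simp
    next
      case (2 \<epsilon> B u)
      then have "Linf_norm I01 (\<lambda>x. u x - u\<^sub>0 x) \<le> ennreal (C * (K * \<epsilon> * Q))"
        by (intro est[of \<epsilon> B u] oscQ) auto
      then show ?case by (simp add: mult_ac)
    next
      case 3 then show ?case using \<epsilon>r by simp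
    qed
  qed
  show "\<exists>\<epsilon>\<^sub>r>0. \<exists>\<delta>\<^sub>r>0.
    (let sol = (\<lambda>\<epsilon> B u. weak_solution (\<lambda>x. A (x / \<epsilon>) + B (x / \<epsilon>)) c d u \<and>
                          Linf_norm I01 (\<lambda>x. u x - u\<^sub>0 x) \<le> ennreal \<delta>\<^sub>r)
     in
      (\<forall>\<epsilon>\<in>{0<..\<epsilon>\<^sub>r}. \<forall>B\<in>\<M> A r.
         \<exists>u. sol \<epsilon> B u \<and> (\<forall>v. sol \<epsilon> B v \<longrightarrow> (AE x in I01. v x = u x))) \<and>
      (\<forall>\<eta>>0. \<exists>\<epsilon>\<^sub>1\<in>{0<..\<epsilon>\<^sub>r}. \<forall>\<epsilon>\<in>{0<..\<epsilon>\<^sub>1}. \<forall>B\<in>\<M> A r. \<forall>u.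
         sol \<epsilon> B u \<longrightarrow> Linf_norm I01 (\<lambda>x. u x - u\<^sub>0 x) \<le> ennreal \<eta>) \<and>
      ((\<lambda>x. c x (u\<^sub>0 x)) \<in> W1inf \<longrightarrow>
        (\<exists>C\<ge>0. \<exists>\<epsilon>\<^sub>1\<in>{0<..\<epsilon>\<^sub>r}. \<forall>\<epsilon>\<in>{0<..\<epsilon>\<^sub>1}. \<forall>B\<in>\<M> A r. \<forall>u.
           sol \<epsilon> B u \<longrightarrow> Linf_norm I01 (\<lambda>x. u x - u\<^sub>0 x) \<le> ennreal (C * \<epsilon>))))"
    unfolding Let_def
  proof (rule exI[of _ \<epsilon>r], rule conjI[OF \<epsilon>r], rule exI[of _ \<delta>], rule conjI[OF \<delta>], intro conjI, goal_cases)
    case 1 show ?case using exists_unique by simp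
  next
    case 2 show ?case using convergence by blast
  next
    case 3 show ?case using linear_rate by blast
  qed
qed

end
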